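(* Let $L_{bc}$ be the Hill operator $Ly=-y''+v(x)y$ on $[0,\pi]$ with potential $v=v_0+Q'$ as described in the context, with $bc\in\{Per^+,Per^-,Dir\}$. For $N$ large, let $S_N=\frac{1}{2\pi i}\int_{\partial R_N}(z-L_{bc})^{-1}dz$ with $R_N=\{z\in\mathbb{C}: -N<\operatorname{Re}z<N^2+N,\ |\operatorname{Im}z|<N\}$, let $E^N=\operatorname{Ran}S_N$, and for $n$ large let $E_n=\operatorname{Ran}P_n$, where $P_n=\frac{1}{2\pi i}\int_{C_n}(z-L_{bc})^{-1}dz$, $C_n=\{|z-n^2|=n\}$. Then the $L^p$-norms ($1\le p\le\infty$) on these subspaces are uniformly equivalent; precisely, for all sufficiently large $N$, $$\|f\|_1\le\|f\|_\infty\le C(N)\|f\|_1\quad\forall f\in E^N,\qquad C(N)\le 50N\ln N,$$ and there is $N^*(v)$ such that $$\|f\|_\infty\le 3\|f\|_1\quad\forall f\in E_n,\ n\ge N^*(v).$$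
   Context: Let $v_0\in\mathbb{C}$ and $Q\in L^2_{loc}(\mathbb{R})$ be $\pi$-periodic with $\int_0^\pi Q(x)\,dx=0$; set $v=v_0+Q'$. For $y$ on $[0,\pi]$ let $u=y'-Qy$. The operator $L_{bc}$ acts by $\ell(y)=-u'-Qu-Q^2y+v_0y$ on the domain of those $y$ with $y,u$ absolutely continuous, $\ell(y)\in L^2([0,\pi])$, and satisfying $Per^\pm$: $y(\pi)=\pm y(0)$, $u(\pi)=\pm u(0)$; or $Dir$: $y(0)=y(\pi)=0$. For large $N$ (resp. $n$) the contours $\partial R_N$ (resp. $C_n$) lie in the resolvent set, so the Riesz projections are well defined (and $S_N$ has finite rank). Norms are normalized: $\|f\|_p=\left(\frac1\pi\int_0^\pi|f|^p\,dx\right)^{1/p}$. *)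

theory Defs
  imports "HOL-Complex_Analysis.Complex_Analysis"
begin

datatype bc = PerP | PerM | Dir

definition L2_on :: "(real \<Rightarrow> complex) \<Rightarrow> bool" where
  "L2_on f \<longleftrightarrow> f measurable_on {0..pi} \<and> (\<lambda>x. (cmod (f x))\<^sup>2) integrable_on {0..pi}"

definition AC_with_deriv :: "(real \<Rightarrow> complex) \<Rightarrow> (real \<Rightarrow> complex) \<Rightarrow> bool" where
  "AC_with_deriv g g' \<longleftrightarrow> g' absolutely_integrable_on {0..pi} \<and>
     (\<forall>x\<in>{0..pi}. g x = g 0 + integral {0..x} g')"

text \<open>y is in the domain of L_bc, u = y' - Q y is its quasi-derivative with u' = w a.e.,
  and ell y = -w - Q u - Q^2 y + v0 y.  Values of y outside [0,pi] are normalised to 0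
  (only the restriction to [0,pi] matters).\<close>
definition dom_rep ::
  "complex \<Rightarrow> (real \<Rightarrow> complex) \<Rightarrow> bc \<Rightarrow> (real \<Rightarrow> complex) \<Rightarrow> (real \<Rightarrow> complex)
     \<Rightarrow> (real \<Rightarrow> complex) \<Rightarrow> bool" where
  "dom_rep v0 Q b y u w \<longleftrightarrow>
     (\<forall>x. x \<notin> {0..pi} \<longrightarrow> y x = 0) \<and>
     AC_with_deriv y (\<lambda>t. u t + Q t * y t) \<and>
     AC_with_deriv u w \<and>
     L2_on (\<lambda>t. - w t - Q t * u t - (Q t)\<^sup>2 * y t + v0 * y t) \<and>
     (case b of
        PerP \<Rightarrow> y pi = y 0 \<and> u pi = u 0
      | PerM \<Rightarrow> y pi = - y 0 \<and> u pi = - u 0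
      | Dir \<Rightarrow> y 0 = 0 \<and> y pi = 0)"

definition solves ::
  "complex \<Rightarrow> (real \<Rightarrow> complex) \<Rightarrow> bc \<Rightarrow> complex \<Rightarrow> (real \<Rightarrow> complex)
     \<Rightarrow> (real \<Rightarrow> complex) \<Rightarrow> bool" where
  "solves v0 Q b z f y \<longleftrightarrow>
     (\<exists>u w. dom_rep v0 Q b y u w \<and>
        negligible {x\<in>{0..pi}. z * y x - (- w x - Q x * u x - (Q x)\<^sup>2 * y x + v0 * y x) \<noteq> f x})"

text \<open>Resolvent (z - L_bc)^(-1) f (meaningful for z in the resolvent set).\<close>
definition resolvent ::
  "complex \<Rightarrow> (real \<Rightarrow> complex) \<Rightarrow> bc \<Rightarrow> complex \<Rightarrow> (real \<Rightarrow> complex) \<Rightarrow> (real \<Rightarrow> complex)" where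
  "resolvent v0 Q b z f = (THE y. solves v0 Q b z f y)"

definition riesz_proj ::
  "complex \<Rightarrow> (real \<Rightarrow> complex) \<Rightarrow> bc \<Rightarrow> (real \<Rightarrow> complex) \<Rightarrow> (real \<Rightarrow> complex) \<Rightarrow> (real \<Rightarrow> complex)" where
  "riesz_proj v0 Q b \<gamma> f = (\<lambda>x. (1 / (2 * pi * \<i>)) * contour_integral \<gamma> (\<lambda>z. resolvent v0 Q b z f x))"

definition proj_range ::
  "complex \<Rightarrow> (real \<Rightarrow> complex) \<Rightarrow> bc \<Rightarrow> (real \<Rightarrow> complex) \<Rightarrow> (real \<Rightarrow> complex) set" where
  "proj_range v0 Q b \<gamma> = {riesz_proj v0 Q b \<gamma> f | f. L2_on f}"

definition rect_boundary :: "nat \<Rightarrow> real \<Rightarrow> complex" where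
  "rect_boundary N =
     (let a = - real N; c = (real N)\<^sup>2 + real N; h = real N in
      linepath (Complex a (-h)) (Complex c (-h)) +++
      linepath (Complex c (-h)) (Complex c h) +++
      linepath (Complex c h) (Complex a h) +++
      linepath (Complex a h) (Complex a (-h)))"

definition circ_contour :: "nat \<Rightarrow> real \<Rightarrow> complex" where
  "circ_contour n = circlepath (of_nat (n\<^sup>2)) (real n)"

definition E_big :: "complex \<Rightarrow> (real \<Rightarrow> complex) \<Rightarrow> bc \<Rightarrow> nat \<Rightarrow> (real \<Rightarrow> complex) set" where
  "E_big v0 Q b N = proj_range v0 Q b (rect_boundary N)"

definition E_small :: "complex \<Rightarrow> (real \<Rightarrow> complex) \<Rightarrow> bc \<Rightarrow> nat \<Rightarrow> (real \<Rightarrow> complex) set" where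
  "E_small v0 Q b n = proj_range v0 Q b (circ_contour n)"

definition norm1 :: "(real \<Rightarrow> complex) \<Rightarrow> real" where
  "norm1 f = integral {0..pi} (\<lambda>x. cmod (f x)) / pi"

definition norm_inf :: "(real \<Rightarrow> complex) \<Rightarrow> real" where
  "norm_inf f = Inf {C. 0 \<le> C \<and> negligible {x\<in>{0..pi}. C < cmod (f x)}}"

end

theory Submission
  imports Defs
begin

text \<open>
With \<open>c\<^sup>2 = v0 - z\<close>, \<open>Re c \<le> 0\<close> and \<open>y = \<alpha> + \<beta>\<close>, \<open>u = c (\<alpha> - \<beta>)\<close>, the equation \<open>(z - L) y = f\<close> becomes a first
order system in which \<open>\<alpha>\<close> and \<open>\<beta>\<close> are coupled only through \<open>Q\<close> and through terms of size \<open>1 / c\<close>.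
Solving each equation by variation of constants, forwards for \<open>\<alpha>\<close> and backwards for \<open>\<beta>\<close>, uses only decaying
exponentials, and an integration by parts replaces the coupling \<open>Q\<close> by \<open>\<integral> e\<^bsup>2c(x-t)\<^esup> Q(t) dt\<close>, which
tends to 0 by the Riemann--Lebesgue lemma. Hence, away from the free spectrum, the resolvent exists
and maps \<open>L\<^sup>1\<close> to \<open>L\<^sup>\<infinity>\<close> with norm at most \<open>(1 + o(1)) (2 / \<bar>1 - e\<^bsup>2\<pi>c\<^esup>\<bar> + 1) / \<bar>c\<bar>\<close>.

The resolvent identity gives \<open>h = (1 / 2\<pi>i) \<integral> R(z) h dz\<close> over a circle around the contour whenever \<open>h\<close> lies in the
range of the projection, so \<open>\<parallel>h\<parallel>\<^sub>\<infinity>\<close> is at most the radius times the norm of the resolvent times the integral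
of \<open>\<bar>h\<bar>\<close>. For \<open>E\<^sup>N\<close> the circle \<open>\<bar>z\<bar> = N\<^sup>2 + N + 1\<close> gives \<open>O(N)\<close>. For \<open>E\<^sub>n\<close> the contour is first
shrunk; on \<open>\<bar>z - n\<^sup>2\<bar> = n / 32\<close> the crude bound for the resolvent already gives a constant below 3.
\<close>

subsection \<open>Absolutely continuous functions\<close>

text \<open>Since \<open>Q\<close> is merely square integrable, \<open>Q'\<close> never appears:
  only \<open>y\<close> and the quasi-derivative \<open>u\<close> are absolutely continuous, and
  every differential equation is read as an integral identity. Two obstacles shape the proof. The
  coupling \<open>Q\<close> has no small norm, so one step of the natural iteration need not
  contract. Oscillation helps only when the pair inserted into the coupling itself solves an
  amplitude equation and can be integrated by parts; this holds from the second step on, so the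
  square of the iteration is used. The constant 3 leaves little room. On the given contour of radius
  \<open>n\<close> the factor \<open>amp\<close> is at least 2, so the method would give at least
  about \<open>2 * pi\<close>; on shrinking circles its constant tends to 2. This also explains why
  the resolvent bound must keep the leading constant of the free problem up to a factor close to
  1.\<close>

lemmas HK_norm_bound = Henstock_Kurzweil_Integration.integral_norm_bound_integral
  and HK_nonneg = Henstock_Kurzweil_Integration.integral_nonneg

lemma absolutely_integrable_continuous_mult:
  fixes f g :: "real \<Rightarrow> complex"
  assumes f: "f absolutely_integrable_on {a..b}" and g: "continuous_on {a..b} g"
  shows "(\<lambda>x. g x * f x) absolutely_integrable_on {a..b}"
proof (rule absolutely_integrable_bounded_measurable_product[where h="(*)" and f=g and g=f])
  show "bilinear ((*) :: complex \<Rightarrow> complex \<Rightarrow> complex)"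
    using bounded_bilinear_mult by (simp add: bilinear_conv_bounded_bilinear)
  show "g \<in> borel_measurable (lebesgue_on {a..b})"
    by (simp add: continuous_imp_measurable_on_sets_lebesgue g)
  show "bounded (g ` {a..b})"
    using g by (simp add: compact_continuous_image compact_imp_bounded)
qed (use f in auto)

lemma integral_complex_bound:
  fixes f :: "real \<Rightarrow> complex" and g :: "real \<Rightarrow> real"
  assumes "f absolutely_integrable_on {a..b}" "g integrable_on {a..b}" "0 \<le> a'" "a \<le> a'" "b' \<le> b"
    "\<And>t. t \<in> {a..b} \<Longrightarrow> 0 \<le> g t"
    "\<And>t. t \<in> {a'..b'} \<Longrightarrow> cmod (f t) \<le> g t"
  shows "cmod (integral {a'..b'} f) \<le> integral {a..b} g"
proof -
  have s: "{a'..b'} \<subseteq> {a..b}" using assms by auto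
  have f': "f integrable_on {a'..b'}"
    using assms(1) s absolutely_integrable_on_subinterval set_lebesgue_integral_eq_integral(1) by blast
  have g': "g integrable_on {a'..b'}" using assms(2) s integrable_on_subinterval by blast
  have "cmod (integral {a'..b'} f) \<le> integral {a'..b'} g"
    by (rule HK_norm_bound[OF f' g' assms(7)])
  also have "\<dots> \<le> integral {a..b} g"
    by (rule integral_subset_le[OF s g' assms(2)]) (use assms(6) in auto)
  finally show ?thesis .
qed

lemma abs_integrableD:
  fixes f :: "real \<Rightarrow> complex"
  shows "f absolutely_integrable_on S \<Longrightarrow> f integrable_on S"
    and "f absolutely_integrable_on S \<Longrightarrow> (\<lambda>x. cmod (f x)) integrable_on S"
  by (auto simp: absolutely_integrable_on_def)

lemma L2_on_imp_absolutely_integrable: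
  assumes "L2_on f"
  shows "f absolutely_integrable_on {0..pi}" "(\<lambda>x. (f x)\<^sup>2) absolutely_integrable_on {0..pi}"
proof -
  have m: "f \<in> borel_measurable (lebesgue_on {0..pi})"
    using assms by (simp add: L2_on_def measurable_on_iff_borel_measurable)
  have i: "(\<lambda>x. (cmod (f x))\<^sup>2) integrable_on {0..pi}" using assms by (simp add: L2_on_def)
  show "f absolutely_integrable_on {0..pi}"
  proof (rule measurable_bounded_by_integrable_imp_absolutely_integrable[OF m])
    show "(\<lambda>x. 1 + (cmod (f x))\<^sup>2) integrable_on {0..pi}"
      by (intro integrable_add i) auto
    show "norm (f x) \<le> 1 + (cmod (f x))\<^sup>2" for x
      using sum_squares_bound[of 1 "cmod (f x)"] norm_ge_zero[of "f x"] by (simp del: norm_ge_zero)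
  qed auto
  show "(\<lambda>x. (f x)\<^sup>2) absolutely_integrable_on {0..pi}"
  proof (rule measurable_bounded_by_integrable_imp_absolutely_integrable[OF _ _ i])
    show "(\<lambda>x. (f x)\<^sup>2) \<in> borel_measurable (lebesgue_on {0..pi})" using m by measurable
  qed (auto simp: norm_power)
qed

lemma L2_on_add_scaled:
  assumes "L2_on f" "L2_on g"
  shows "L2_on (\<lambda>x. f x + a * g x)"
proof -
  have m: "f \<in> borel_measurable (lebesgue_on {0..pi})" "g \<in> borel_measurable (lebesgue_on {0..pi})"
    using assms by (simp_all add: L2_on_def measurable_on_iff_borel_measurable)
  have mm: "(\<lambda>x. f x + a * g x) \<in> borel_measurable (lebesgue_on {0..pi})"
    using m by measurable
  have "(\<lambda>x. (cmod (f x + a * g x))\<^sup>2) absolutely_integrable_on {0..pi}"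
  proof (rule measurable_bounded_by_integrable_imp_absolutely_integrable)
    show "(\<lambda>x. (cmod (f x + a * g x))\<^sup>2) \<in> borel_measurable (lebesgue_on {0..pi})" using mm by measurable
    show "(\<lambda>x. 2 * (cmod (f x))\<^sup>2 + (2 * (cmod a)\<^sup>2) * (cmod (g x))\<^sup>2) integrable_on {0..pi}"
      using assms by (intro integrable_add integrable_on_mult_right) (auto simp: L2_on_def)
    show "norm ((cmod (f x + a * g x))\<^sup>2) \<le> 2 * (cmod (f x))\<^sup>2 + (2 * (cmod a)\<^sup>2) * (cmod (g x))\<^sup>2" for x
    proof -
      have "(cmod (f x + a * g x))\<^sup>2 \<le> (cmod (f x) + cmod (a * g x))\<^sup>2"
        by (intro power_mono norm_triangle_ineq) auto
      also have "\<dots> \<le> 2 * (cmod (f x))\<^sup>2 + 2 * (cmod (a * g x))\<^sup>2"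
        using sum_squares_bound[of "cmod (f x)" "cmod (a * g x)"] by (simp add: power2_sum)
      finally show ?thesis by (simp add: norm_mult power_mult_distrib)
    qed
  qed auto
  then show ?thesis
    using mm by (simp add: L2_on_def measurable_on_iff_borel_measurable absolutely_integrable_on_def)
qed

lemma L2_on_continuous:
  assumes "continuous_on {0..pi} f"
  shows "L2_on f"
  unfolding L2_on_def
proof
  show "f measurable_on {0..pi}"
    using assms by (simp add: measurable_on_iff_borel_measurable continuous_imp_measurable_on_sets_lebesgue)
  show "(\<lambda>x. (cmod (f x))\<^sup>2) integrable_on {0..pi}"
    by (intro integrable_continuous_real continuous_intros assms)
qed

lemma L2_on_scaled: "L2_on f \<Longrightarrow> L2_on (\<lambda>x. a * f x)"
  using L2_on_add_scaled[OF L2_on_continuous[of "\<lambda>_. 0"], of f a] by simp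

lemma AC_abs_int: "AC_with_deriv g h \<Longrightarrow> h absolutely_integrable_on {0..pi}"
  by (simp add: AC_with_deriv_def)

lemma AC_eq: "AC_with_deriv g h \<Longrightarrow> x \<in> {0..pi} \<Longrightarrow> g x = g 0 + integral {0..x} h"
  unfolding AC_with_deriv_def by blast

lemma AC_I:
  assumes "h absolutely_integrable_on {0..pi}" "\<And>x. x \<in> {0..pi} \<Longrightarrow> g x = g 0 + integral {0..x} h"
  shows "AC_with_deriv g h"
  using assms unfolding AC_with_deriv_def by blast

lemma AC_cong:
  assumes "AC_with_deriv g h" "\<And>x. x \<in> {0..pi} \<Longrightarrow> g' x = g x" "\<And>x. x \<in> {0..pi} \<Longrightarrow> h' x = h x"
  shows "AC_with_deriv g' h'"
proof -
  have "h' absolutely_integrable_on {0..pi}"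
    using assms(3) by (intro absolutely_integrable_spike[OF AC_abs_int[OF assms(1)], where S="{}"]) auto
  moreover have "integral {0..x} h' = integral {0..x} h" if "x \<in> {0..pi}" for x
    by (rule integral_cong) (use assms(3) that in auto)
  ultimately show ?thesis
    by (intro AC_I) (simp_all add: assms(2) AC_eq[OF assms(1), symmetric])
qed

lemma AC_cong_ae:
  assumes "AC_with_deriv g h" "negligible {x \<in> {0..pi}. h' x \<noteq> h x}"
  shows "AC_with_deriv g h'"
proof -
  let ?N = "{x \<in> {0..pi}. h' x \<noteq> h x}"
  have "h' absolutely_integrable_on {0..pi}"
    by (intro absolutely_integrable_spike[OF AC_abs_int[OF assms(1)] assms(2)]) auto
  moreover have "integral {0..x} h' = integral {0..x} h" if "x \<in> {0..pi}" for x
    by (rule integral_spike[OF assms(2)]) (use that in auto)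
  ultimately show ?thesis
    by (intro AC_I) (simp_all add: AC_eq[OF assms(1), symmetric])
qed

lemma AC_increment:
  assumes "AC_with_deriv g h" "0 \<le> x" "x \<le> y" "y \<le> pi"
  shows "g y - g x = integral {x..y} h"
proof -
  have "h integrable_on {0..y}"
    using abs_integrableD(1)[OF AC_abs_int[OF assms(1)]] assms by (auto intro: integrable_on_subinterval)
  then have "integral {0..x} h + integral {x..y} h = integral {0..y} h"
    using assms by (intro Henstock_Kurzweil_Integration.integral_combine) auto
  moreover have "g x = g 0 + integral {0..x} h" "g y = g 0 + integral {0..y} h"
    by (rule AC_eq[OF assms(1)]; use assms(2-4) in simp)+
  ultimately show ?thesis by (metis add_diff_cancel_left' add_diff_cancel_left)
qed

lemma AC_continuous: "AC_with_deriv g h \<Longrightarrow> continuous_on {0..pi} g"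
proof -
  assume a: "AC_with_deriv g h"
  have "continuous_on {0..pi} (\<lambda>x. g 0 + integral {0..x} h)"
    by (intro continuous_intros indefinite_integral_continuous_1 abs_integrableD AC_abs_int[OF a])
  then show ?thesis
    by (rule continuous_on_eq) (metis AC_eq[OF a])
qed

lemma AC_indefinite:
  assumes "h absolutely_integrable_on {0..pi}"
  shows "AC_with_deriv (\<lambda>x. A + integral {0..x} h) h"
  using assms by (simp add: AC_with_deriv_def)

lemma AC_lincomb:
  assumes "AC_with_deriv f f'" "AC_with_deriv g g'"
  shows "AC_with_deriv (\<lambda>x. a * f x + b * g x) (\<lambda>x. a * f' x + b * g' x)"
proof (rule AC_I)
  show "(\<lambda>x. a * f' x + b * g' x) absolutely_integrable_on {0..pi}"
    using assms by (intro set_integral_add absolutely_integrable_continuous_mult) (auto simp: AC_with_deriv_def)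
  fix x assume x: "x \<in> {0..pi}"
  have "f' integrable_on {0..x}" "g' integrable_on {0..x}"
    using assms[THEN AC_abs_int, THEN abs_integrableD(1)] x by (auto intro: integrable_on_subinterval)
  then have "integral {0..x} (\<lambda>x. a * f' x + b * g' x) = a * integral {0..x} f' + b * integral {0..x} g'"
    by (subst Henstock_Kurzweil_Integration.integral_add) (simp_all add: integrable_on_mult_right)
  then show "a * f x + b * g x = a * f 0 + b * g 0 + integral {0..x} (\<lambda>x. a * f' x + b * g' x)"
    by (subst AC_eq[OF assms(1) x], subst AC_eq[OF assms(2) x]) (simp add: algebra_simps)
qed

lemma AC_smooth:
  assumes "\<And>x. x \<in> {0..pi} \<Longrightarrow> (g has_vector_derivative h x) (at x within {0..pi})" "continuous_on {0..pi} h"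
  shows "AC_with_deriv g h"
proof (rule AC_I)
  show "h absolutely_integrable_on {0..pi}"
    using assms(2) by (rule absolutely_integrable_continuous_real)
  fix x assume x: "x \<in> {0..pi}"
  have "(h has_integral (g x - g 0)) {0..x}"
  proof (rule fundamental_theorem_of_calculus)
    fix t assume "t \<in> {0..x}"
    then show "(g has_vector_derivative h t) (at t within {0..x})"
      using assms(1)[of t] x by (intro has_vector_derivative_within_subset[OF assms(1)]) auto
  qed (use x in auto)
  then show "g x = g 0 + integral {0..x} h"
    by (simp add: integral_unique)
qed

lemma AC_exp: "AC_with_deriv (\<lambda>x. exp (c * of_real x)) (\<lambda>x. c * exp (c * of_real x))"
proof (rule AC_smooth)
  fix x :: real
  have "((\<lambda>z. exp (c * z)) has_field_derivative c * exp (c * of_real x)) (at (of_real x))"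
    by (auto intro!: derivative_eq_intros)
  then have "(((\<lambda>z. exp (c * z)) \<circ> of_real) has_vector_derivative c * exp (c * of_real x)) (at x within {0..pi})"
    using has_vector_derivative_real_field[of "\<lambda>z. exp (c*z)" "c * exp (c * of_real x)" x "{0..pi}"]
    by (simp add: o_def)
  then show "((\<lambda>x. exp (c * of_real x)) has_vector_derivative c * exp (c * of_real x)) (at x within {0..pi})"
    by (simp add: o_def)
qed (intro continuous_intros)

text \<open>The increments of such a \<open>D\<close> add up to less than any \<open>e\<close> over a fine enough partition.\<close>
lemma constant_if_product_increments:
  fixes D :: "real \<Rightarrow> complex" and F G :: "real \<Rightarrow> real"
  assumes F: "continuous_on {0..b} F" and G: "mono_on {0..b} G"
    and le: "\<And>x y. 0 \<le> x \<Longrightarrow> x \<le> y \<Longrightarrow> y \<le> b \<Longrightarrow> cmod (D y - D x) \<le> \<bar>F y - F x\<bar> * (G y - G x)"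
    and b: "0 \<le> b"
  shows "D b = D 0"
proof (rule ccontr)
  assume ne: "D b \<noteq> D 0"
  \<comment> \<open>The \<open>+ 1\<close> keeps the denominator positive even if \<open>G\<close>
    is constant; the 2 leaves the total at most half of \<open>cmod (D b - D 0)\<close>.\<close>
  define e where "e = cmod (D b - D 0) / (2 * (G b - G 0 + 1))"
  have Gb: "G b - G 0 \<ge> 0" using mono_onD[OF G, of 0 b] b by auto
  have e: "e > 0" using ne Gb by (simp add: e_def)
  have "uniformly_continuous_on {0..b} F" using F by (simp add: compact_uniformly_continuous)
  then obtain d where d: "d > 0" "\<And>x y. x \<in> {0..b} \<Longrightarrow> y \<in> {0..b} \<Longrightarrow> dist y x < d \<Longrightarrow> dist (F y) (F x) < e"
    using e unfolding uniformly_continuous_on_def by meson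
  obtain m :: nat where m: "b / d < real m" using reals_Archimedean2 by blast
  have m0: "m > 0" using m b d(1) by (metis divide_nonneg_pos gr0I less_le_not_le of_nat_0)
  define p where "p i = b * real i / real m" for i
  have p: "p 0 = 0" "p m = b" using m0 by (auto simp: p_def)
  have pin: "p i \<in> {0..b}" if "i \<le> m" for i
  proof -
    have "b * (real i / real m) \<le> b * 1" using that b m0 by (intro mult_left_mono) auto
    then show ?thesis using b by (auto simp: p_def)
  qed
  have step: "p (Suc i) - p i = b / m" for i by (simp add: p_def diff_divide_distrib[symmetric] algebra_simps)
  have bm: "b / m < d" using m d(1) m0 by (simp add: field_simps)
  have "cmod (D (p (Suc i)) - D (p i)) \<le> e * (G (p (Suc i)) - G (p i))" if "i < m" for i
  proof -
    have le': "p i \<le> p (Suc i)" using step[of i] b by (smt (verit) divide_nonneg_nonneg of_nat_0_le_iff)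
    have "cmod (D (p (Suc i)) - D (p i)) \<le> \<bar>F (p (Suc i)) - F (p i)\<bar> * (G (p (Suc i)) - G (p i))"
      using le[of "p i" "p (Suc i)"] le' pin[of i] pin[of "Suc i"] that by auto
    also have "\<dots> \<le> e * (G (p (Suc i)) - G (p i))"
    proof (rule mult_right_mono)
      show "\<bar>F (p (Suc i)) - F (p i)\<bar> \<le> e"
        using d(2)[of "p i" "p (Suc i)"] pin[of i] pin[of "Suc i"] that le' step[of i] bm
        by (auto simp: dist_real_def)
      show "0 \<le> G (p (Suc i)) - G (p i)"
        using mono_onD[OF G, of "p i" "p (Suc i)"] le' pin[of i] pin[of "Suc i"] that by auto
    qed
    finally show ?thesis .
  qed
  then have "(\<Sum>i<m. cmod (D (p (Suc i)) - D (p i))) \<le> (\<Sum>i<m. e * (G (p (Suc i)) - G (p i)))"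
    by (intro sum_mono) auto
  also have "\<dots> = e * (G b - G 0)"
  proof -
    have "(\<Sum>i<m. G (p (Suc i)) - G (p i)) = G b - G 0"
      using sum_lessThan_telescope[of "\<lambda>i. G (p i)" m] p by simp
    then show ?thesis by (metis sum_distrib_left)
  qed
  also have "\<dots> < cmod (D b - D 0)"
  proof -
    have "e * (G b - G 0) \<le> cmod (D b - D 0) / 2"
      using Gb by (simp add: e_def divide_simps) (simp add: algebra_simps)
    then show ?thesis using ne by (smt (verit) field_sum_of_halves norm_eq_zero norm_ge_zero eq_iff_diff_eq_0)
  qed
  finally have "(\<Sum>i<m. cmod (D (p (Suc i)) - D (p i))) < cmod (D b - D 0)" .
  moreover have "cmod (D b - D 0) \<le> (\<Sum>i<m. cmod (D (p (Suc i)) - D (p i)))"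
  proof -
    have "D b - D 0 = (\<Sum>i<m. D (p (Suc i)) - D (p i))"
      using sum_lessThan_telescope[of "\<lambda>i. D (p i)" m] p by simp
    then show ?thesis using norm_sum by metis
  qed
  ultimately show False by linarith
qed

text \<open>Let \<open>D\<close> be the product minus the integral of the expected derivative.
  Expanding both increments cancels everything of first order and leaves the integrals of
  \<open>f' t * (g x - g t)\<close> and \<open>(f y - f t) * g' t\<close>, each at most the product
  of the variations of \<open>f\<close> and \<open>g\<close>. Hence
  \<open>constant_if_product_increments\<close> applies, and no pointwise derivative occurs.\<close>

lemma AC_mult:
  assumes f: "AC_with_deriv f f'" and g: "AC_with_deriv g g'"
  shows "AC_with_deriv (\<lambda>x. f x * g x) (\<lambda>x. f' x * g x + f x * g' x)"
proof -
  let ?h = "\<lambda>x. f' x * g x + f x * g' x"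
  note fc = AC_continuous[OF f] and gc = AC_continuous[OF g]
  note fi = AC_abs_int[OF f] and gi = AC_abs_int[OF g]
  have h1: "(\<lambda>x. f' x * g x) absolutely_integrable_on {0..pi}"
    using absolutely_integrable_continuous_mult[OF fi gc] by (simp add: mult.commute)
  have h2: "(\<lambda>x. f x * g' x) absolutely_integrable_on {0..pi}"
    using absolutely_integrable_continuous_mult[OF gi fc] .
  have h: "?h absolutely_integrable_on {0..pi}" using h1 h2 by (rule set_integral_add)
  define F where "F x = integral {0..x} (\<lambda>t. cmod (f' t))" for x
  define G where "G x = integral {0..x} (\<lambda>t. cmod (g' t))" for x
  have Finc: "F y - F x = integral {x..y} (\<lambda>t. cmod (f' t))" "G y - G x = integral {x..y} (\<lambda>t. cmod (g' t))"
    if "0 \<le> x" "x \<le> y" "y \<le> pi" for x y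
  proof -
    have "(\<lambda>t. cmod (f' t)) integrable_on {0..y}" "(\<lambda>t. cmod (g' t)) integrable_on {0..y}"
      using fi gi that by (auto intro: integrable_on_subinterval dest: abs_integrableD(2))
    then have "integral {0..x} (\<lambda>t. cmod (f' t)) + integral {x..y} (\<lambda>t. cmod (f' t)) = integral {0..y} (\<lambda>t. cmod (f' t))"
        "integral {0..x} (\<lambda>t. cmod (g' t)) + integral {x..y} (\<lambda>t. cmod (g' t)) = integral {0..y} (\<lambda>t. cmod (g' t))"
      using that by (auto intro!: Henstock_Kurzweil_Integration.integral_combine)
    then show "F y - F x = integral {x..y} (\<lambda>t. cmod (f' t))" "G y - G x = integral {x..y} (\<lambda>t. cmod (g' t))"
      by (auto simp: F_def G_def)
  qed
  have Fpos: "F y - F x \<ge> 0" "G y - G x \<ge> 0" if "0 \<le> x" "x \<le> y" "y \<le> pi" for x y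
    using Finc[OF that] that
    by (auto intro!: HK_nonneg
        integrable_on_subinterval[OF abs_integrableD(2)[OF fi]] integrable_on_subinterval[OF abs_integrableD(2)[OF gi]])
  define D where "D x = f x * g x - integral {0..x} ?h" for x
  \<comment> \<open>The 2 in front of \<open>F\<close> accounts for the two remainder terms.\<close>
  have Dle: "cmod (D y - D x) \<le> \<bar>2 * F y - 2 * F x\<bar> * (G y - G x)" if xy: "0 \<le> x" "x \<le> y" "y \<le> pi" for x y
  proof -
    have sub: "{x..y} \<subseteq> {0..pi}" using xy by auto
    have I: "k integrable_on {x..y}" if "k absolutely_integrable_on {0..pi}" for k :: "real \<Rightarrow> complex"
      using abs_integrableD(1)[OF that] sub integrable_on_subinterval by blast
    have "integral {0..x} ?h + integral {x..y} ?h = integral {0..y} ?h"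
      by (rule Henstock_Kurzweil_Integration.integral_combine)
         (use xy in \<open>auto intro!: integrable_on_subinterval[OF abs_integrableD(1)[OF h]]\<close>)
    then have "D y - D x = f y * g y - f x * g x - integral {x..y} ?h"
      by (simp add: D_def algebra_simps)
    also have "integral {x..y} ?h = integral {x..y} (\<lambda>t. f' t * g t) + integral {x..y} (\<lambda>t. f t * g' t)"
      by (intro Henstock_Kurzweil_Integration.integral_add I h1 h2)
    also have "f y * g y - f x * g x = (f y - f x) * g x + f y * (g y - g x)" by (simp add: algebra_simps)
    also have "f y - f x = integral {x..y} f'" by (rule AC_increment[OF f xy])
    also have "g y - g x = integral {x..y} g'" by (rule AC_increment[OF g xy])
    also have "integral {x..y} f' * g x + f y * integral {x..y} g' -
       (integral {x..y} (\<lambda>t. f' t * g t) + integral {x..y} (\<lambda>t. f t * g' t)) =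
       integral {x..y} (\<lambda>t. f' t * (g x - g t)) + integral {x..y} (\<lambda>t. (f y - f t) * g' t)"
    proof -
      have "integral {x..y} (\<lambda>t. f' t * (g x - g t)) = integral {x..y} (\<lambda>t. f' t * g x) - integral {x..y} (\<lambda>t. f' t * g t)"
        unfolding right_diff_distrib
        by (intro Henstock_Kurzweil_Integration.integral_diff I h1 integrable_on_mult_left fi)
      moreover have "integral {x..y} (\<lambda>t. (f y - f t) * g' t) = integral {x..y} (\<lambda>t. f y * g' t) - integral {x..y} (\<lambda>t. f t * g' t)"
        unfolding left_diff_distrib
        by (intro Henstock_Kurzweil_Integration.integral_diff I h2 integrable_on_mult_right gi)
      ultimately show ?thesis by simp
    qed
    finally have eq: "D y - D x = integral {x..y} (\<lambda>t. f' t * (g x - g t)) + integral {x..y} (\<lambda>t. (f y - f t) * g' t)" .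
    have osc_g: "cmod (g t - g s) \<le> G y - G x" if "x \<le> s" "s \<le> t" "t \<le> y" for s t
    proof -
      have "cmod (g t - g s) = cmod (integral {s..t} g')" using AC_increment[OF g, of s t] xy that by auto
      also have "\<dots> \<le> integral {x..y} (\<lambda>t. cmod (g' t))"
        using gi sub that xy
        by (intro integral_complex_bound integrable_on_subinterval[OF abs_integrableD(2)[OF gi]])
          (auto intro: absolutely_integrable_on_subinterval)
      finally show ?thesis using Finc(2)[OF xy] by simp
    qed
    have osc_f: "cmod (f t - f s) \<le> F y - F x" if "x \<le> s" "s \<le> t" "t \<le> y" for s t
    proof -
      have "cmod (f t - f s) = cmod (integral {s..t} f')" using AC_increment[OF f, of s t] xy that by auto
      also have "\<dots> \<le> integral {x..y} (\<lambda>t. cmod (f' t))"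
        using fi sub that xy
        by (intro integral_complex_bound integrable_on_subinterval[OF abs_integrableD(2)[OF fi]])
          (auto intro: absolutely_integrable_on_subinterval)
      finally show ?thesis using Finc(1)[OF xy] by simp
    qed
    have c1: "continuous_on {0..pi} (\<lambda>t. g x - g t)" "continuous_on {0..pi} (\<lambda>t. f y - f t)"
      by (intro continuous_intros fc gc)+
    have a1: "(\<lambda>t. f' t * (g x - g t)) absolutely_integrable_on {0..pi}"
      using absolutely_integrable_continuous_mult[OF fi c1(1)] by (simp add: mult.commute)
    have a2: "(\<lambda>t. (f y - f t) * g' t) absolutely_integrable_on {0..pi}"
      using absolutely_integrable_continuous_mult[OF gi c1(2)] .
    have nf: "(\<lambda>t. cmod (f' t)) integrable_on {x..y}" "(\<lambda>t. cmod (g' t)) integrable_on {x..y}"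
      using sub fi gi by (auto intro: integrable_on_subinterval dest: abs_integrableD(2))
    have "cmod (integral {x..y} (\<lambda>t. f' t * (g x - g t))) \<le> integral {x..y} (\<lambda>t. cmod (f' t) * (G y - G x))"
      using osc_g[of x] by (intro HK_norm_bound I a1 integrable_on_mult_left nf)
        (auto simp: norm_mult norm_minus_commute intro!: mult_left_mono)
    also have "\<dots> = (F y - F x) * (G y - G x)" using Finc[OF xy] by simp
    finally have b1: "cmod (integral {x..y} (\<lambda>t. f' t * (g x - g t))) \<le> (F y - F x) * (G y - G x)" .
    have "cmod (integral {x..y} (\<lambda>t. (f y - f t) * g' t)) \<le> integral {x..y} (\<lambda>t. (F y - F x) * cmod (g' t))"
      using osc_f[of _ y] by (intro HK_norm_bound I a2 integrable_on_mult_right nf)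
        (auto simp: norm_mult norm_minus_commute intro!: mult_right_mono)
    also have "\<dots> = (F y - F x) * (G y - G x)" using Finc[OF xy] by simp
    finally have b2: "cmod (integral {x..y} (\<lambda>t. (f y - f t) * g' t)) \<le> (F y - F x) * (G y - G x)" .
    have "cmod (D y - D x) \<le> (F y - F x) * (G y - G x) + (F y - F x) * (G y - G x)"
      unfolding eq by (rule norm_triangle_le) (use b1 b2 in linarith)
    also have "\<dots> \<le> \<bar>2 * F y - 2 * F x\<bar> * (G y - G x)" using Fpos[OF xy] by (simp add: algebra_simps)
    finally show ?thesis .
  qed
  have Fc: "continuous_on {0..pi} (\<lambda>x. 2 * F x)" unfolding F_def
    by (intro continuous_intros indefinite_integral_continuous_1 abs_integrableD(2) fi)
  have Dc: "D x = D 0" if x: "x \<in> {0..pi}" for x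
  proof (rule constant_if_product_increments)
    show "continuous_on {0..x} (\<lambda>x. 2 * F x)" using Fc by (rule continuous_on_subset) (use x in auto)
    show "mono_on {0..x} G" using Fpos(2) x by (intro mono_onI) auto
    show "cmod (D ya - D xa) \<le> \<bar>2 * F ya - 2 * F xa\<bar> * (G ya - G xa)"
      if "0 \<le> xa" "xa \<le> ya" "ya \<le> x" for xa ya using Dle that x by auto
  qed (use x in auto)
  have D0: "D 0 = f 0 * g 0" by (simp add: D_def)
  have "f x * g x = D x + integral {0..x} ?h" for x by (simp add: D_def)
  then have "f x * g x = f 0 * g 0 + integral {0..x} ?h" if "x \<in> {0..pi}" for x
    using Dc[OF that] D0 by metis
  with h show ?thesis by (intro AC_I)
qed

section \<open>Variation of constants\<close>

text \<open>The Duhamel integrals: \<open>Vf c h\<close> solves \<open>y' = c * y + h\<close> with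
  value 0 at 0, and \<open>Vb c h\<close> solves \<open>y' = - c * y - h\<close> with value 0 at
  \<open>pi\<close>, which explains the minus signs in front of \<open>Vb\<close> later. Both
  kernels have modulus at most 1 when \<open>Re c \<le> 0\<close>.\<close>

definition Vf :: "complex \<Rightarrow> (real \<Rightarrow> complex) \<Rightarrow> real \<Rightarrow> complex" where
  "Vf c h x = integral {0..x} (\<lambda>t. exp (c * of_real (x - t)) * h t)"

definition Vb :: "complex \<Rightarrow> (real \<Rightarrow> complex) \<Rightarrow> real \<Rightarrow> complex" where
  "Vb c h x = integral {x..pi} (\<lambda>t. exp (c * of_real (t - x)) * h t)"

lemma norm_exp_le_1: "Re c \<le> 0 \<Longrightarrow> 0 \<le> t \<Longrightarrow> cmod (exp (c * of_real t)) \<le> 1"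
  by (simp add: mult_nonpos_nonneg)

lemma exp_forward_integrable:
  fixes h :: "real \<Rightarrow> complex"
  shows "h absolutely_integrable_on {0..pi} \<Longrightarrow>
    (\<lambda>t. exp (c * of_real (x - t)) * h t) absolutely_integrable_on {0..pi}"
  by (intro absolutely_integrable_continuous_mult continuous_intros) auto

lemma exp_backward_integrable:
  fixes h :: "real \<Rightarrow> complex"
  shows "h absolutely_integrable_on {0..pi} \<Longrightarrow>
    (\<lambda>t. exp (c * of_real (t - x)) * h t) absolutely_integrable_on {0..pi}"
  by (intro absolutely_integrable_continuous_mult continuous_intros) auto

lemma exp_mult_integrable:
  fixes h :: "real \<Rightarrow> complex"
  shows "h absolutely_integrable_on {0..pi} \<Longrightarrow> (\<lambda>t. exp (c * of_real t) * h t) absolutely_integrable_on {0..pi}"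
  by (intro absolutely_integrable_continuous_mult continuous_intros) auto

lemma exp_mult_exp: "exp a * (exp b * w) = exp (a + b) * (w :: complex)"
  by (simp add: exp_add)

lemma norm_Vf_le:
  assumes h: "h absolutely_integrable_on {0..pi}" and g: "g integrable_on {0..pi}"
    and c: "Re c \<le> 0" and x: "x \<in> {0..pi}" and le: "\<forall>t\<in>{0..pi}. cmod (h t) \<le> g t"
  shows "cmod (Vf c h x) \<le> integral {0..pi} g"
  unfolding Vf_def
proof (rule integral_complex_bound)
  note le = le[rule_format]
  show "(\<lambda>t. exp (c * of_real (x - t)) * h t) absolutely_integrable_on {0..pi}"
    by (rule exp_forward_integrable[OF h])
  show "0 \<le> g t" if "t \<in> {0..pi}" for t using le[OF that] norm_ge_zero order_trans by blast
  show "cmod (exp (c * complex_of_real (x - t)) * h t) \<le> g t" if "t \<in> {0..x}" for t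
  proof -
    have "cmod (exp (c * of_real (x - t))) * cmod (h t) \<le> 1 * g t"
      using that x by (intro mult_mono le norm_exp_le_1 c) auto
    then show ?thesis by (simp add: norm_mult)
  qed
qed (use x g in auto)

lemma norm_Vb_le:
  assumes h: "h absolutely_integrable_on {0..pi}" and g: "g integrable_on {0..pi}"
    and c: "Re c \<le> 0" and x: "x \<in> {0..pi}" and le: "\<forall>t\<in>{0..pi}. cmod (h t) \<le> g t"
  shows "cmod (Vb c h x) \<le> integral {0..pi} g"
  unfolding Vb_def
proof (rule integral_complex_bound)
  note le = le[rule_format]
  show "(\<lambda>t. exp (c * of_real (t - x)) * h t) absolutely_integrable_on {0..pi}"
    by (rule exp_backward_integrable[OF h])
  show "0 \<le> g t" if "t \<in> {0..pi}" for t using le[OF that] norm_ge_zero order_trans by blast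
  show "cmod (exp (c * complex_of_real (t - x)) * h t) \<le> g t" if "t \<in> {x..pi}" for t
  proof -
    have "cmod (exp (c * of_real (t - x))) * cmod (h t) \<le> 1 * g t"
      using that x by (intro mult_mono le norm_exp_le_1 c) auto
    then show ?thesis by (simp add: norm_mult)
  qed
qed (use x g in auto)

lemma integral_lincomb_on:
  fixes f g :: "real \<Rightarrow> complex"
  assumes "f absolutely_integrable_on {0..pi}" "g absolutely_integrable_on {0..pi}" "{a..b} \<subseteq> {0..pi}"
  shows "integral {a..b} (\<lambda>t. f t + k * g t) = integral {a..b} f + k * integral {a..b} g"
proof -
  have "f integrable_on {a..b}" "g integrable_on {a..b}"
    using assms by (auto intro: integrable_on_subinterval dest: abs_integrableD(1))
  then show ?thesis
    by (subst Henstock_Kurzweil_Integration.integral_add) (simp_all add: integrable_on_mult_right)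
qed

lemma Vf_lincomb:
  assumes "f absolutely_integrable_on {0..pi}" "g absolutely_integrable_on {0..pi}" "x \<in> {0..pi}"
  shows "Vf c (\<lambda>t. f t + k * g t) x = Vf c f x + k * Vf c g x"
  unfolding Vf_def
  using integral_lincomb_on[OF exp_forward_integrable[OF assms(1), of c x] exp_forward_integrable[OF assms(2), of c x],
      of 0 x k] assms(3)
  by (simp add: distrib_left mult.left_commute)

lemma Vb_lincomb:
  assumes "f absolutely_integrable_on {0..pi}" "g absolutely_integrable_on {0..pi}" "x \<in> {0..pi}"
  shows "Vb c (\<lambda>t. f t + k * g t) x = Vb c f x + k * Vb c g x"
  unfolding Vb_def
  using integral_lincomb_on[OF exp_backward_integrable[OF assms(1), of c x] exp_backward_integrable[OF assms(2), of c x],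
      of x pi k] assms(3)
  by (simp add: distrib_left mult.left_commute)

text \<open>This factored form serves differentiation. Estimates use the kernel of the definition,
  since the separate factor \<open>exp (- c * t)\<close> may be exponentially large.\<close>

lemma Vf_eq: "Vf c h x = exp (c * of_real x) * integral {0..x} (\<lambda>t. exp (-c * of_real t) * h t)"
proof -
  have "(\<lambda>t. exp (c * of_real (x - t)) * h t) = (\<lambda>t. exp (c * of_real x) * (exp (-c * of_real t) * h t))"
    unfolding exp_mult_exp by (simp add: algebra_simps)
  then show ?thesis by (simp add: Vf_def)
qed

lemma Vb_eq: "Vb c h x = exp (-c * of_real x) * integral {x..pi} (\<lambda>t. exp (c * of_real t) * h t)"
proof -
  have "(\<lambda>t. exp (c * of_real (t - x)) * h t) = (\<lambda>t. exp (-c * of_real x) * (exp (c * of_real t) * h t))"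
    unfolding exp_mult_exp by (simp add: algebra_simps)
  then show ?thesis by (simp add: Vb_def)
qed

lemma AC_Vf:
  assumes h: "h absolutely_integrable_on {0..pi}"
  shows "AC_with_deriv (Vf c h) (\<lambda>t. c * Vf c h t + h t)"
proof -
  note i = exp_mult_integrable[OF h, of "-c"]
  show ?thesis
  proof (rule AC_cong[OF AC_mult[OF AC_exp[of c] AC_indefinite[OF i, of 0]]])
    fix x
    show "Vf c h x = exp (c * of_real x) * (0 + integral {0..x} (\<lambda>t. exp (- c * of_real t) * h t))"
      by (simp add: Vf_eq)
    show "c * Vf c h x + h x = c * exp (c * of_real x) * (0 + integral {0..x} (\<lambda>t. exp (- c * of_real t) * h t))
        + exp (c * of_real x) * (exp (- c * of_real x) * h x)"
      by (simp add: Vf_eq exp_mult_exp)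
  qed
qed

lemma AC_Vb:
  assumes h: "h absolutely_integrable_on {0..pi}"
  shows "AC_with_deriv (Vb c h) (\<lambda>t. - c * Vb c h t - h t)"
proof -
  note i = exp_mult_integrable[OF h, of c]
  let ?E = "\<lambda>t. exp (c * of_real t) * h t"
  have eq: "1 * integral {0..pi} ?E + (-1) * integral {0..x} ?E = integral {x..pi} ?E" if "x \<in> {0..pi}" for x
  proof -
    have "integral {0..x} ?E + integral {x..pi} ?E = integral {0..pi} ?E"
      by (rule Henstock_Kurzweil_Integration.integral_combine) (use that abs_integrableD(1)[OF i] in auto)
    then show ?thesis by (simp add: algebra_simps)
  qed
  have "AC_with_deriv (\<lambda>x. 1 * integral {0..pi} ?E + (-1) * (0 + integral {0..x} ?E)) (\<lambda>x. 1 * 0 + (-1) * ?E x)"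
    by (intro AC_lincomb AC_indefinite[OF i]) (intro AC_smooth; simp)
  note AC_mult[OF AC_exp[of "-c"] this]
  then show ?thesis
  proof (rule AC_cong)
    fix x assume x: "x \<in> {0..pi}"
    show "Vb c h x = exp (-c * of_real x) * (1 * integral {0..pi} ?E + (-1) * (0 + integral {0..x} ?E))"
      using eq[OF x] by (simp add: Vb_eq)
    show "- c * Vb c h x - h x = - c * exp (-c * of_real x) * (1 * integral {0..pi} ?E + (-1) * (0 + integral {0..x} ?E))
        + exp (-c * of_real x) * (1 * 0 + (-1) * ?E x)"
      using eq[OF x] by (simp add: Vb_eq exp_mult_exp)
  qed
qed

lemma variation_forward:
  assumes a: "AC_with_deriv a (\<lambda>t. c * a t + h t)" and x: "x \<in> {0..pi}"
  shows "a x = exp (c * of_real x) * a 0 + Vf c h x"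
proof -
  have "AC_with_deriv (\<lambda>x. exp (-c * of_real x) * a x) (\<lambda>t. exp (-c * of_real t) * h t)"
    by (rule AC_cong[OF AC_mult[OF AC_exp[of "-c"] a]]) (auto simp: algebra_simps)
  from AC_eq[OF this x] have "exp (-c * of_real x) * a x = a 0 + integral {0..x} (\<lambda>t. exp (-c * of_real t) * h t)"
    by simp
  then have "exp (c * of_real x) * (exp (-c * of_real x) * a x) = exp (c * of_real x) * a 0 + Vf c h x"
    by (simp add: Vf_eq distrib_left)
  then show ?thesis unfolding exp_mult_exp by simp
qed

lemma variation_backward:
  assumes a: "AC_with_deriv a (\<lambda>t. - c * a t + h t)" and x: "x \<in> {0..pi}"
  shows "a x = exp (c * of_real (pi - x)) * a pi - Vb c h x"
proof -
  have "AC_with_deriv (\<lambda>x. exp (c * of_real x) * a x) (\<lambda>t. exp (c * of_real t) * h t)"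
    by (rule AC_cong[OF AC_mult[OF AC_exp[of c] a]]) (auto simp: algebra_simps)
  from AC_increment[OF this, of x pi] x
  have "exp (c * of_real x) * a x = exp (c * pi) * a pi - integral {x..pi} (\<lambda>t. exp (c * of_real t) * h t)"
    by (simp add: algebra_simps)
  then have "exp (-c * of_real x) * (exp (c * of_real x) * a x) =
     exp (-c * of_real x) * (exp (c * pi) * a pi) - Vb c h x"
    by (simp add: Vb_eq right_diff_distrib)
  then show ?thesis unfolding exp_mult_exp by (simp add: algebra_simps)
qed

text \<open>Integration by parts: the product moves the oscillation of the exponentials onto \<open>Q\<close>,
  which leaves the factor \<open>Vf (2 * c) Q\<close>, small by the Riemann--Lebesgue lemma.\<close>
lemma Vf_product:
  assumes B: "AC_with_deriv B (\<lambda>t. - c * B t + h t)" and Q: "Q absolutely_integrable_on {0..pi}"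
    and h: "h absolutely_integrable_on {0..pi}" and x: "x \<in> {0..pi}"
  shows "Vf c (\<lambda>t. Q t * B t) x = Vf (2 * c) Q x * B x - Vf c (\<lambda>t. Vf (2 * c) Q t * h t) x"
proof -
  let ?P = "Vf (2 * c) Q"
  note P = AC_Vf[OF Q, of "2 * c"]
  have "AC_with_deriv (\<lambda>t. ?P t * B t) (\<lambda>t. c * (?P t * B t) + (Q t * B t + 1 * (?P t * h t)))"
    by (rule AC_cong[OF AC_mult[OF P B]]) (auto simp: algebra_simps)
  \<comment> \<open>The initial term drops out because \<open>?P\<close> vanishes at 0.\<close>
  from variation_forward[OF this x]
  have "?P x * B x = Vf c (\<lambda>t. Q t * B t + 1 * (?P t * h t)) x"
    by (simp add: Vf_def)
  also have "\<dots> = Vf c (\<lambda>t. Q t * B t) x + 1 * Vf c (\<lambda>t. ?P t * h t) x"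
    using absolutely_integrable_continuous_mult[OF Q AC_continuous[OF B]]
      absolutely_integrable_continuous_mult[OF h AC_continuous[OF P]]
    by (intro Vf_lincomb x) (auto simp: mult.commute)
  finally show ?thesis by simp
qed

lemma Vb_product:
  assumes A: "AC_with_deriv A (\<lambda>t. c * A t + h t)" and Q: "Q absolutely_integrable_on {0..pi}"
    and h: "h absolutely_integrable_on {0..pi}" and x: "x \<in> {0..pi}"
  shows "Vb c (\<lambda>t. Q t * A t) x = Vb (2 * c) Q x * A x + Vb c (\<lambda>t. Vb (2 * c) Q t * h t) x"
proof -
  let ?P = "Vb (2 * c) Q"
  note P = AC_Vb[OF Q, of "2 * c"]
  \<comment> \<open>\<open>?P\<close> solves its equation with source \<open>- Q\<close>, so the
    negated product has source \<open>Q * A\<close> up to the \<open>h\<close> term; the summand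
    \<open>0 * A t\<close> brings it into the shape of \<open>AC_lincomb\<close>. The end term
    vanishes because \<open>?P\<close> is 0 at \<open>pi\<close>.\<close>
  have "AC_with_deriv (\<lambda>t. (-1) * (?P t * A t) + 0 * A t) (\<lambda>t. - c * ((-1) * (?P t * A t) + 0 * A t) + (Q t * A t + (-1) * (?P t * h t)))"
    by (rule AC_cong[OF AC_lincomb[OF AC_mult[OF P A] A, of "-1" 0]]) (auto simp: algebra_simps)
  from variation_backward[OF this x]
  have "?P x * A x = Vb c (\<lambda>t. Q t * A t + (-1) * (?P t * h t)) x"
    by (simp add: Vb_def)
  also have "\<dots> = Vb c (\<lambda>t. Q t * A t) x + (-1) * Vb c (\<lambda>t. ?P t * h t) x"
    using absolutely_integrable_continuous_mult[OF Q AC_continuous[OF A]]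
      absolutely_integrable_continuous_mult[OF h AC_continuous[OF P]]
    by (intro Vb_lincomb x) (auto simp: mult.commute)
  finally show ?thesis by simp
qed

subsection \<open>The Riemann--Lebesgue lemma\<close>

text \<open>The radial retraction onto the disc of radius \<open>k\<close>. It gives the continuous
  functions supplied by \<open>measurable_on\<close> a common bound, as dominated convergence
  requires.\<close>

definition clip :: "real \<Rightarrow> complex \<Rightarrow> complex" where
  "clip k w = (k / max k (cmod w)) *\<^sub>R w"

lemma clip: "k > 0 \<Longrightarrow> cmod (clip k w) \<le> k" "k > 0 \<Longrightarrow> cmod (clip k w) \<le> cmod w"
  "k > 0 \<Longrightarrow> cmod w \<le> k \<Longrightarrow> clip k w = w"
proof -
  assume k: "k > 0"
  have m: "max k (cmod w) > 0" using k by linarith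
  have "k * cmod w \<le> k * max k (cmod w)" "k * cmod w \<le> max k (cmod w) * cmod w"
    using k by (auto intro!: mult_left_mono mult_right_mono)
  then show "cmod (clip k w) \<le> k" "cmod (clip k w) \<le> cmod w"
    using k m by (auto simp: clip_def pos_divide_le_eq mult.commute)
  show "cmod w \<le> k \<Longrightarrow> clip k w = w" using k by (simp add: clip_def max_absorb1)
qed

lemma continuous_on_clip: "k > 0 \<Longrightarrow> continuous_on S f \<Longrightarrow> continuous_on S (\<lambda>x. clip k (f x))"
  unfolding clip_def by (intro continuous_intros) auto

text \<open>\<open>measurable_on\<close> provides continuous functions converging almost everywhere,
  but without a dominating function. Hence \<open>f\<close> is first clipped at a high level, at
  small cost in the mean, and the approximants are clipped at the same level; both limits are then
  dominated.\<close>

lemma L1_approx_continuous: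
  fixes f :: "real \<Rightarrow> complex"
  assumes f: "f absolutely_integrable_on {a..b}" and e: "e > 0"
  obtains g where "continuous_on UNIV g" "integral {a..b} (\<lambda>x. cmod (f x - g x)) < e"
proof -
  have fm: "f measurable_on {a..b}"
    using f by (simp add: measurable_on_iff_borel_measurable absolutely_integrable_measurable)
  then obtain N g where N: "negligible N" and g: "\<And>n. continuous_on UNIV (g n)"
    and lim: "\<And>x. x \<notin> N \<Longrightarrow> (\<lambda>n. g n x) \<longlonglongrightarrow> (if x \<in> {a..b} then f x else 0)"
    unfolding measurable_on_def by blast
  have fi: "(\<lambda>x. cmod (f x)) integrable_on {a..b}" using abs_integrableD(2)[OF f] .
  have fcm: "f \<in> borel_measurable (lebesgue_on {a..b})"
    using fm by (simp add: measurable_on_iff_borel_measurable)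
  have clipm: "(\<lambda>x. clip k (f x)) \<in> borel_measurable (lebesgue_on {a..b})" if "k > 0" for k
    unfolding clip_def using fcm by measurable
  have A: "(\<lambda>x. cmod (f x - clip (Suc k) (f x))) integrable_on {a..b}" for k
  proof (rule measurable_bounded_by_integrable_imp_integrable)
    show "(\<lambda>x. cmod (f x - clip (Suc k) (f x))) \<in> borel_measurable (lebesgue_on {a..b})"
      using fcm clipm[of "Suc k"] by measurable
    show "(\<lambda>x. 2 * cmod (f x)) integrable_on {a..b}" using fi by simp
    show "norm (cmod (f x - clip (Suc k) (f x))) \<le> 2 * cmod (f x)" for x
      using clip(2)[of "Suc k" "f x"] norm_triangle_ineq4[of "f x" "clip (Suc k) (f x)"] by simp
  qed auto
  have "(\<lambda>k. integral {a..b} (\<lambda>x. cmod (f x - clip (Suc k) (f x)))) \<longlonglongrightarrow> integral {a..b} (\<lambda>x. 0)"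
  proof (rule dominated_convergence(2)[OF A])
    show "(\<lambda>x. 2 * cmod (f x)) integrable_on {a..b}" using fi by simp
    show "norm (cmod (f x - clip (Suc k) (f x))) \<le> 2 * cmod (f x)" for x k
      using clip(2)[of "Suc k" "f x"] norm_triangle_ineq4[of "f x" "clip (Suc k) (f x)"] by simp
    fix x
    obtain m :: nat where "cmod (f x) < m" using reals_Archimedean2 by blast
    then have "\<forall>\<^sub>F k in sequentially. cmod (f x - clip (Suc k) (f x)) = 0"
      unfolding eventually_sequentially by (intro exI[of _ m]) (auto simp: clip(3))
    then show "(\<lambda>k. cmod (f x - clip (Suc k) (f x))) \<longlonglongrightarrow> 0" by (rule tendsto_eventually)
  qed
  then have "\<forall>\<^sub>F k in sequentially. integral {a..b} (\<lambda>x. cmod (f x - clip (Suc k) (f x))) < e / 2"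
    using e by (intro order_tendstoD) auto
  then obtain k where k: "integral {a..b} (\<lambda>x. cmod (f x - clip (Suc k) (f x))) < e / 2"
    by (meson eventually_sequentially order_refl)
  define K :: real where "K = Suc k"
  have K: "K > 0" by (simp add: K_def)
  \<comment> \<open>Setting \<open>d\<close> to 0 on the null set \<open>N\<close> makes it converge
    at every point of the interval.\<close>
  define d where "d n x = (if x \<in> N then 0 else cmod (clip K (f x) - clip K (g n x)))" for n x
  have I: "(\<lambda>x. cmod (clip K (f x) - clip K (g n x))) integrable_on {a..b}" for n
  proof (rule measurable_bounded_by_integrable_imp_integrable)
    have "g n \<in> borel_measurable (lebesgue_on {a..b})"
      by (intro continuous_imp_measurable_on_sets_lebesgue continuous_on_subset[OF g]) auto
    then have "(\<lambda>x. clip K (g n x)) \<in> borel_measurable (lebesgue_on {a..b})" unfolding clip_def by measurable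
    then show "(\<lambda>x. cmod (clip K (f x) - clip K (g n x))) \<in> borel_measurable (lebesgue_on {a..b})"
      using clipm[OF K] by measurable
    show "norm (cmod (clip K (f x) - clip K (g n x))) \<le> 2 * K" for x
      using clip(1)[OF K, of "f x"] clip(1)[OF K, of "g n x"] norm_triangle_ineq4[of "clip K (f x)" "clip K (g n x)"] by simp
  qed auto
  have dI: "d n integrable_on {a..b}" for n
    using integrable_spike[OF I N, of "d n" n] by (simp add: d_def)
  have "(\<lambda>n. integral {a..b} (d n)) \<longlonglongrightarrow> integral {a..b} (\<lambda>x. 0)"
  proof (rule dominated_convergence(2)[OF dI])
    show "(\<lambda>x. 2 * K) integrable_on {a..b}" by auto
    show "norm (d n x) \<le> 2 * K" for n x
      using K clip(1)[OF K, of "f x"] clip(1)[OF K, of "g n x"] norm_triangle_ineq4[of "clip K (f x)" "clip K (g n x)"]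
      by (simp add: d_def)
    fix x assume x: "x \<in> {a..b}"
    show "(\<lambda>n. d n x) \<longlonglongrightarrow> 0"
    proof (cases "x \<in> N")
      case False
      have "continuous_on UNIV (\<lambda>w. clip K w)" by (rule continuous_on_clip[OF K]) auto
      then have "(\<lambda>n. clip K (g n x)) \<longlonglongrightarrow> clip K (f x)"
        using lim[OF False] x isCont_tendsto_compose[of "f x" "clip K" "\<lambda>n. g n x"]
        by (simp add: continuous_on_eq_continuous_at)
      then have "(\<lambda>n. cmod (clip K (f x) - clip K (g n x))) \<longlonglongrightarrow> cmod (clip K (f x) - clip K (f x))"
        by (intro tendsto_intros)
      then show ?thesis using False by (simp add: d_def)
    qed (simp add: d_def)
  qed
  then have "\<forall>\<^sub>F n in sequentially. integral {a..b} (d n) < e / 2"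
    using e by (intro order_tendstoD) auto
  then obtain n where n: "integral {a..b} (d n) < e / 2"
    by (meson eventually_sequentially order_refl)
  have n': "integral {a..b} (\<lambda>x. cmod (clip K (f x) - clip K (g n x))) < e / 2"
    using n integral_spike[OF N, of "{a..b}" "\<lambda>x. cmod (clip K (f x) - clip K (g n x))" "d n"]
    by (simp add: d_def)
  have gc: "continuous_on UNIV (\<lambda>x. clip K (g n x))" by (rule continuous_on_clip[OF K g])
  have "integral {a..b} (\<lambda>x. cmod (f x - clip K (g n x))) \<le>
    integral {a..b} (\<lambda>x. cmod (f x - clip K (f x)) + cmod (clip K (f x) - clip K (g n x)))"
  proof (rule integral_le)
    have "(\<lambda>x. clip K (g n x)) absolutely_integrable_on {a..b}"
      by (intro absolutely_integrable_continuous_real continuous_on_subset[OF gc]) auto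
    then have "(\<lambda>x. f x - clip K (g n x)) absolutely_integrable_on {a..b}"
      by (intro set_integral_diff f)
    then show "(\<lambda>x. cmod (f x - clip K (g n x))) integrable_on {a..b}" by (rule abs_integrableD)
    show "(\<lambda>x. cmod (f x - clip K (f x)) + cmod (clip K (f x) - clip K (g n x))) integrable_on {a..b}"
      by (intro integrable_add I) (use A[of k] in \<open>simp add: K_def\<close>)
    show "cmod (f x - clip K (g n x)) \<le> cmod (f x - clip K (f x)) + cmod (clip K (f x) - clip K (g n x))" for x
      using norm_triangle_ineq[of "f x - clip K (f x)" "clip K (f x) - clip K (g n x)"] by simp
  qed
  also have "\<dots> = integral {a..b} (\<lambda>x. cmod (f x - clip K (f x))) + integral {a..b} (\<lambda>x. cmod (clip K (f x) - clip K (g n x)))"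
    by (intro Henstock_Kurzweil_Integration.integral_add I) (use A[of k] in \<open>simp add: K_def\<close>)
  also have "\<dots> < e" using k n' by (simp add: K_def)
  finally show ?thesis using that[OF gc] by blast
qed

text \<open>Stone--Weierstrass replaces the continuous approximant by a uniformly close polynomial.
  A differentiable function is wanted because one integration by parts then yields the decay in
  \<open>c\<close>.\<close>

lemma L1_approx_smooth:
  fixes f :: "real \<Rightarrow> complex"
  assumes f: "f absolutely_integrable_on {0..pi}" and e: "e > 0"
  obtains g g' where "continuous_on UNIV g" "continuous_on UNIV g'"
    "\<And>x. (g has_vector_derivative g' x) (at x)" "integral {0..pi} (\<lambda>x. cmod (f x - g x)) < e"
proof -
  obtain h where h: "continuous_on UNIV h" "integral {0..pi} (\<lambda>x. cmod (f x - h x)) < e / 2"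
    using L1_approx_continuous[OF f, of "e/2"] e by auto
  have "e / (2 * pi) > 0" using e by simp
  then obtain g where g: "polynomial_function g" "\<And>x. x \<in> {0..pi} \<Longrightarrow> norm (h x - g x) < e / (2 * pi)"
    using Stone_Weierstrass_polynomial_function[of "{0..pi}" h "e / (2 * pi)"] continuous_on_subset[OF h(1)]
    by (metis compact_Icc top_greatest)
  obtain g' where g': "polynomial_function g'" "\<And>x. (g has_vector_derivative g' x) (at x)"
    using has_vector_derivative_polynomial_function[OF g(1)] by blast
  have ai: "(\<lambda>x. f x - k x) absolutely_integrable_on {0..pi}" if "continuous_on UNIV k" for k
    by (intro set_integral_diff f absolutely_integrable_continuous_real continuous_on_subset[OF that]) auto
  have gc: "continuous_on UNIV g" "continuous_on UNIV g'"
    using continuous_on_polymonial_function g(1) g'(1) by auto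
  have "integral {0..pi} (\<lambda>x. cmod (f x - g x)) \<le> integral {0..pi} (\<lambda>x. cmod (f x - h x) + e / (2 * pi))"
  proof (rule integral_le)
    show "(\<lambda>x. cmod (f x - g x)) integrable_on {0..pi}" using abs_integrableD(2)[OF ai[OF gc(1)]] .
    show "(\<lambda>x. cmod (f x - h x) + e / (2 * pi)) integrable_on {0..pi}"
      by (intro integrable_add abs_integrableD(2)[OF ai[OF h(1)]]) auto
    show "cmod (f x - g x) \<le> cmod (f x - h x) + e / (2 * pi)" if "x \<in> {0..pi}" for x
      using g(2)[OF that] norm_triangle_ineq[of "f x - h x" "h x - g x"] by simp
  qed
  also have "\<dots> = integral {0..pi} (\<lambda>x. cmod (f x - h x)) + integral {0..pi} (\<lambda>x. e / (2 * pi))"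
    by (intro Henstock_Kurzweil_Integration.integral_add abs_integrableD(2)[OF ai[OF h(1)]]) auto
  also have "\<dots> < e" using h(2) by simp
  finally show ?thesis using that gc g' by blast
qed

text \<open>The kernels have modulus at most 1, so replacing \<open>Q\<close> by a smooth
  \<open>g\<close> costs the L1 distance for all \<open>c\<close> and \<open>x\<close> at once. For
  \<open>g\<close>, integration by parts bounds \<open>c * Vf c g x\<close> by \<open>L\<close>,
  which collects two boundary values and the integral of the modulus of \<open>g'\<close>.\<close>

lemma riemann_lebesgue_uniform:
  fixes Q :: "real \<Rightarrow> complex"
  assumes Q: "Q absolutely_integrable_on {0..pi}" and e: "e > 0"
  obtains R where "\<And>c x. Re c \<le> 0 \<Longrightarrow> cmod c \<ge> R \<Longrightarrow> x \<in> {0..pi} \<Longrightarrow> cmod (Vf c Q x) \<le> e"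
    "\<And>c x. Re c \<le> 0 \<Longrightarrow> cmod c \<ge> R \<Longrightarrow> x \<in> {0..pi} \<Longrightarrow> cmod (Vb c Q x) \<le> e"
proof -
  obtain g g' where g: "continuous_on UNIV g" "continuous_on UNIV g'"
    "\<And>x. (g has_vector_derivative g' x) (at x)" "integral {0..pi} (\<lambda>x. cmod (Q x - g x)) < e / 2"
    using L1_approx_smooth[OF Q, of "e/2"] e by auto
  have "compact (g ` {0..pi})" by (intro compact_continuous_image continuous_on_subset[OF g(1)]) auto
  then obtain M where M: "\<And>x. x \<in> {0..pi} \<Longrightarrow> cmod (g x) \<le> M"
    using compact_imp_bounded bounded_iff by (metis (no_types, lifting) imageI)
  have gi: "g absolutely_integrable_on {0..pi}" "g' absolutely_integrable_on {0..pi}"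
    using g by (auto intro!: absolutely_integrable_continuous_real intro: continuous_on_subset)
  have Qg: "(\<lambda>x. Q x - g x) absolutely_integrable_on {0..pi}" by (intro set_integral_diff Q gi)
  define L where "L = 2 * M + integral {0..pi} (\<lambda>x. cmod (g' x))"
  have M0: "M \<ge> 0" using M[of 0] norm_ge_zero[of "g 0"] by (simp del: norm_ge_zero)
  have L0: "L \<ge> 0" unfolding L_def
    using M0 HK_nonneg[OF abs_integrableD(2)[OF gi(2)]] by simp
  have acg: "AC_with_deriv g g'"
    using g by (intro AC_smooth) (auto intro: has_vector_derivative_at_within continuous_on_subset)
  \<comment> \<open>The threshold makes \<open>L\<close> at most \<open>e / 2 * cmod c\<close>; its
    \<open>+ 1\<close> excludes \<open>c = 0\<close>.\<close>
  have main: "cmod (Vf c Q x) \<le> e \<and> cmod (Vb c Q x) \<le> e" if c: "Re c \<le> 0" "cmod c \<ge> 2 * L / e + 1" and x: "x \<in> {0..pi}" for c x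
  proof -
    have c0: "cmod c > 0" using c(2) L0 e by (smt (verit) divide_nonneg_pos)
    have Lc: "L \<le> e / 2 * cmod c"
    proof -
      have "e / 2 * (2 * L / e + 1) \<le> e / 2 * cmod c" using c(2) e by (intro mult_left_mono) auto
      moreover have "e / 2 * (2 * L / e + 1) = L + e / 2" using e by (simp add: distrib_left)
      ultimately show ?thesis using e by linarith
    qed
    have bnd: "cmod w \<le> e / 2" if "cmod (c * w) \<le> L" for w
    proof -
      have "cmod c * cmod w \<le> cmod c * (e / 2)" using that Lc by (simp add: norm_mult mult.commute)
      then show ?thesis using c0 by simp
    qed
    \<comment> \<open>Regarding \<open>g\<close> as a solution with source \<open>g' - c * g\<close>
      turns the variation of constants formula into an integration by parts.\<close>
    have "AC_with_deriv g (\<lambda>t. c * g t + (g' t + (-c) * g t))" by (rule AC_cong[OF acg]) auto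
    from variation_forward[OF this x] have f: "c * Vf c g x = exp (c * of_real x) * g 0 + Vf c g' x - g x"
      by (subst (asm) Vf_lincomb[OF gi(2,1) x]) (simp add: algebra_simps)
    have "cmod (c * Vf c g x) \<le> cmod (exp (c * of_real x) * g 0) + cmod (Vf c g' x) + cmod (g x)"
      unfolding f by (intro norm_triangle_le_diff add_mono norm_triangle_ineq order_refl)
    also have "cmod (exp (c * of_real x) * g 0) \<le> 1 * M"
      unfolding norm_mult using x c by (intro mult_mono norm_exp_le_1 M) auto
    also have "cmod (Vf c g' x) \<le> integral {0..pi} (\<lambda>x. cmod (g' x))"
      by (intro norm_Vf_le gi abs_integrableD(2) c x) auto
    also have "cmod (g x) \<le> M" using M x by auto
    finally have 1: "cmod (Vf c g x) \<le> e / 2" by (intro bnd) (simp add: L_def)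
    have "AC_with_deriv g (\<lambda>t. -c * g t + (g' t + c * g t))" by (rule AC_cong[OF acg]) auto
    from variation_backward[OF this x] have f: "c * Vb c g x = exp (c * of_real (pi - x)) * g pi - Vb c g' x - g x"
      by (subst (asm) Vb_lincomb[OF gi(2,1) x]) (simp add: algebra_simps)
    have "cmod (c * Vb c g x) \<le> cmod (exp (c * of_real (pi - x)) * g pi) + cmod (Vb c g' x) + cmod (g x)"
      unfolding f by (intro norm_triangle_le_diff add_mono norm_triangle_ineq4 order_refl)
    also have "cmod (exp (c * of_real (pi - x)) * g pi) \<le> 1 * M"
      unfolding norm_mult using x c by (intro mult_mono norm_exp_le_1 M) auto
    also have "cmod (Vb c g' x) \<le> integral {0..pi} (\<lambda>x. cmod (g' x))"
      by (intro norm_Vb_le gi abs_integrableD(2) c x) auto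
    also have "cmod (g x) \<le> M" using M x by auto
    finally have 2: "cmod (Vb c g x) \<le> e / 2" by (intro bnd) (simp add: L_def)
    have "Vf c (\<lambda>t. Q t - g t) x = Vf c Q x - Vf c g x" "Vb c (\<lambda>t. Q t - g t) x = Vb c Q x - Vb c g x"
      using Vf_lincomb[OF Q gi(1) x, of c "-1"] Vb_lincomb[OF Q gi(1) x, of c "-1"] by simp_all
    moreover have "cmod (Vf c (\<lambda>t. Q t - g t) x) \<le> integral {0..pi} (\<lambda>x. cmod (Q x - g x))"
      by (intro norm_Vf_le Qg abs_integrableD(2) c x) auto
    moreover have "cmod (Vb c (\<lambda>t. Q t - g t) x) \<le> integral {0..pi} (\<lambda>x. cmod (Q x - g x))"
      by (intro norm_Vb_le Qg abs_integrableD(2) c x) auto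
    ultimately have "cmod (Vf c Q x - Vf c g x) \<le> e / 2" "cmod (Vb c Q x - Vb c g x) \<le> e / 2" using g(4) by auto
    then show ?thesis
      using 1 2 norm_triangle_ineq[of "Vf c Q x - Vf c g x" "Vf c g x"] norm_triangle_ineq[of "Vb c Q x - Vb c g x" "Vb c g x"]
      by simp
  qed
  show ?thesis using that main by blast
qed

subsection \<open>The boundary value problem for the wave amplitudes\<close>

text \<open>The boundary conditions for \<open>y = \<alpha> + \<beta>\<close> and
  \<open>u = c * (\<alpha> - \<beta>)\<close> with \<open>c \<noteq> 0\<close>. The periodic and
  antiperiodic ones separate into conditions on each amplitude; the Dirichlet condition couples
  them.\<close>

definition bcond :: "bc \<Rightarrow> (real \<Rightarrow> complex) \<Rightarrow> (real \<Rightarrow> complex) \<Rightarrow> bool" where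
  "bcond b \<alpha> \<beta> = (case b of
      PerP \<Rightarrow> \<alpha> pi = \<alpha> 0 \<and> \<beta> pi = \<beta> 0
    | PerM \<Rightarrow> \<alpha> pi = - \<alpha> 0 \<and> \<beta> pi = - \<beta> 0
    | Dir \<Rightarrow> \<alpha> 0 + \<beta> 0 = 0 \<and> \<alpha> pi + \<beta> pi = 0)"

text \<open>With given sources \<open>G\<close> and \<open>H\<close> these are the amplitude
  equations of the zero potential, coupled at most through the boundary conditions.\<close>

definition free_sol ::
  "bc \<Rightarrow> complex \<Rightarrow> (real \<Rightarrow> complex) \<Rightarrow> (real \<Rightarrow> complex) \<Rightarrow> (real \<Rightarrow> complex) \<Rightarrow> (real \<Rightarrow> complex) \<Rightarrow> bool" where
  "free_sol b c G H \<alpha> \<beta> \<longleftrightarrow> AC_with_deriv \<alpha> (\<lambda>t. c * \<alpha> t + G t) \<and>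
     AC_with_deriv \<beta> (\<lambda>t. - c * \<beta> t + H t) \<and> bcond b \<alpha> \<beta>"

text \<open>At the free eigenvalues, where \<open>exp (2 * pi * c) = 1\<close>, the division by zero makes this 1.\<close>
definition amp :: "complex \<Rightarrow> real" where
  "amp c = 2 / cmod (1 - exp (2 * of_real pi * c)) + 1"

lemma amp_ge_1: "amp c \<ge> 1"
  by (simp add: amp_def)

lemma exp_double: "exp ((c :: complex) * of_real pi) * exp (c * of_real pi) = exp (2 * of_real pi * c)"
  by (simp add: exp_add[symmetric] algebra_simps)

text \<open>With \<open>e = exp (c * pi)\<close>, the boundary conditions determine
  \<open>A = \<alpha> 0\<close> and \<open>B = \<beta> pi\<close> from the Volterra terms at the
  ends. Multiplying the periodic and antiperiodic equations by the complementary factor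
  \<open>1 + e\<close> or \<open>1 - e\<close> gives all three cases the determinant
  \<open>1 - e * e\<close>, with two terms of size at most \<open>m\<close> on the right. In
  \<open>amp\<close> the fraction stems from this homogeneous part and the summand 1 from the
  Volterra term.\<close>

lemma free_sol_bound:
  assumes s: "free_sol b c G H \<alpha> \<beta>" and c: "Re c \<le> 0" "exp (2 * of_real pi * c) \<noteq> 1"
    and m: "\<forall>x\<in>{0..pi}. cmod (Vf c G x) \<le> m" "\<forall>x\<in>{0..pi}. cmod (Vb c H x) \<le> m"
    and x: "x \<in> {0..pi}"
  shows "cmod (\<alpha> x) \<le> amp c * m" "cmod (\<beta> x) \<le> amp c * m"
proof -
  note m = m[rule_format]
  define e where "e = exp (c * of_real pi)"
  define A where "A = \<alpha> 0"
  define B where "B = \<beta> pi"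
  define I where "I = Vf c G pi"
  define J where "J = Vb c H 0"
  have ee: "e * e = exp (2 * of_real pi * c)" by (simp add: e_def exp_double)
  have e1: "cmod e \<le> 1" unfolding e_def by (rule norm_exp_le_1) (use c in auto)
  define d where "d = cmod (1 - exp (2 * of_real pi * c))"
  have d: "d > 0" using c(2) by (simp add: d_def)
  have AC: "AC_with_deriv \<alpha> (\<lambda>t. c * \<alpha> t + G t)" "AC_with_deriv \<beta> (\<lambda>t. - c * \<beta> t + H t)" "bcond b \<alpha> \<beta>"
    using s by (auto simp: free_sol_def)
  have IJ: "cmod I \<le> m" "cmod J \<le> m" using m[of 0] m[of pi] by (auto simp: I_def J_def)
  have m0: "m \<ge> 0" using IJ norm_ge_zero order_trans by blast
  have ap: "\<alpha> pi = e * A + I" using variation_forward[OF AC(1), of pi] by (simp add: e_def A_def I_def)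
  have b0: "\<beta> 0 = e * B - J" using variation_backward[OF AC(2), of 0] by (simp add: e_def B_def J_def)
  have two: "cmod (u + v * w) \<le> 2 * m" if "cmod u \<le> m" "cmod w \<le> m" "cmod v \<le> 1" for u v w
  proof -
    have "cmod (v * w) \<le> 1 * m" unfolding norm_mult using that m0 by (intro mult_mono) auto
    then show ?thesis using that norm_triangle_ineq[of u "v * w"] by linarith
  qed
  have key: "\<exists>u v w. (1 - e * e) * A = u + v * w \<and> cmod u \<le> m \<and> cmod w \<le> m \<and> cmod v \<le> 1"
    "\<exists>u v w. (1 - e * e) * B = u + v * w \<and> cmod u \<le> m \<and> cmod w \<le> m \<and> cmod v \<le> 1"
  proof -
    have "(1 - e * e) * A = I + e * I \<and> (1 - e * e) * B = -J + e * (-J)" if "b = PerP"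
    proof -
      have "e * A + I = A" "e * B - J = B" using AC(3) ap b0 that by (auto simp: bcond_def A_def B_def)
      then have IJ: "I = A - e * A" "J = e * B - B" by (simp only: eq_diff_eq add.commute, simp only: eq_diff_eq diff_eq_eq add.commute)
      show ?thesis unfolding IJ by (simp add: algebra_simps)
    qed
    moreover have "(1 - e * e) * A = -I + e * I \<and> (1 - e * e) * B = J + e * (-J)" if "b = PerM"
    proof -
      have "\<alpha> pi = - \<alpha> 0" "\<beta> 0 = - \<beta> pi" using AC(3) that by (auto simp: bcond_def)
      then have "e * A + I = -A" "e * B - J = -B" unfolding ap b0 A_def[symmetric] B_def[symmetric] .
      then have IJ: "I = - A - e * A" "J = e * B + B" by (simp only: eq_diff_eq add.commute, simp only: diff_eq_eq, simp)
      show ?thesis unfolding IJ by (simp add: algebra_simps)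
    qed
    moreover have "(1 - e * e) * A = J + e * I \<and> (1 - e * e) * B = -I + e * (-J)" if "b = Dir"
    proof -
      have "A + (e * B - J) = 0" "e * A + I + B = 0" using AC(3) ap b0 that by (auto simp: bcond_def A_def B_def)
      then have IJ: "J = A + e * B" "I = - (e * A) - B" by algebra+
      show ?thesis unfolding IJ by (simp add: algebra_simps)
    qed
    ultimately show "\<exists>u v w. (1 - e * e) * A = u + v * w \<and> cmod u \<le> m \<and> cmod w \<le> m \<and> cmod v \<le> 1"
      "\<exists>u v w. (1 - e * e) * B = u + v * w \<and> cmod u \<le> m \<and> cmod w \<le> m \<and> cmod v \<le> 1"
      using IJ e1 by (cases b; metis norm_minus_cancel)+
  qed
  have AB: "cmod A \<le> 2 / d * m" "cmod B \<le> 2 / d * m"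
  proof -
    have "d * cmod A \<le> 2 * m" using key(1) two by (metis d_def ee norm_mult)
    then show "cmod A \<le> 2 / d * m" using d by (simp add: field_simps)
    have "d * cmod B \<le> 2 * m" using key(2) two by (metis d_def ee norm_mult)
    then show "cmod B \<le> 2 / d * m" using d by (simp add: field_simps)
  qed
  have "\<alpha> x = exp (c * of_real x) * A + Vf c G x" using variation_forward[OF AC(1) x] by (simp add: A_def)
  then have "cmod (\<alpha> x) \<le> cmod (exp (c * of_real x)) * cmod A + cmod (Vf c G x)"
    by (metis norm_mult norm_triangle_ineq)
  also have "\<dots> \<le> 1 * (2 / d * m) + m"
    using x c AB m by (intro add_mono mult_mono norm_exp_le_1) auto
  finally show "cmod (\<alpha> x) \<le> amp c * m" by (simp add: amp_def d_def distrib_right)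
  have "\<beta> x = exp (c * of_real (pi - x)) * B - Vb c H x" using variation_backward[OF AC(2) x] by (simp add: B_def)
  then have "cmod (\<beta> x) \<le> cmod (exp (c * of_real (pi - x))) * cmod B + cmod (Vb c H x)"
    by (metis norm_mult norm_triangle_ineq4)
  also have "\<dots> \<le> 1 * (2 / d * m) + m"
    using x c AB m by (intro add_mono mult_mono norm_exp_le_1) auto
  finally show "cmod (\<beta> x) \<le> amp c * m" by (simp add: amp_def d_def distrib_right)
qed

lemma free_sol_exists:
  assumes G: "G absolutely_integrable_on {0..pi}" and H: "H absolutely_integrable_on {0..pi}"
    and c: "exp (2 * of_real pi * c) \<noteq> 1"
  obtains \<alpha> \<beta> where "free_sol b c G H \<alpha> \<beta>"
proof -
  define e where "e = exp (c * of_real pi)"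
  define I where "I = Vf c G pi"
  define J where "J = Vb c H 0"
  have ee: "e * e \<noteq> 1" using c by (simp add: e_def exp_double)
  have e1: "e \<noteq> 1" "e \<noteq> -1" using ee by auto
  have e2: "1 - e \<noteq> 0" "1 + e \<noteq> 0" "1 - e * e \<noteq> 0" using ee e1 by (auto simp: add_eq_0_iff)
  \<comment> \<open>\<open>A\<close> and \<open>B\<close> are to become \<open>\<alpha> 0\<close>
    and \<open>\<beta> pi\<close>; the values at the opposite ends are then \<open>e * A + I\<close>
    and \<open>e * B - J\<close>.\<close>
  obtain A B where AB: "case b of PerP \<Rightarrow> e * A + I = A \<and> B = e * B - J
      | PerM \<Rightarrow> e * A + I = - A \<and> B = - (e * B - J)
      | Dir \<Rightarrow> A + (e * B - J) = 0 \<and> (e * A + I) + B = 0"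
  proof (cases b)
    case PerP
    have "e * (I / (1 - e)) + I = I / (1 - e) \<and> (- J / (1 - e)) = e * (- J / (1 - e)) - J"
      using e2 by (simp add: field_simps)
    then show ?thesis by (intro that[of "I / (1 - e)" "- J / (1 - e)"]) (simp only: PerP bc.case)
  next
    case PerM
    have "e * (- I / (1 + e)) + I = - (- I / (1 + e)) \<and> (J / (1 + e)) = - (e * (J / (1 + e)) - J)"
      using e2 by (simp add: field_simps)
    then show ?thesis by (intro that[of "- I / (1 + e)" "J / (1 + e)"]) (simp only: PerM bc.case)
  next
    case Dir
    have "(J + e * I) / (1 - e * e) + (e * ((- I - e * J) / (1 - e * e)) - J) = 0"
      "(e * ((J + e * I) / (1 - e * e)) + I) + (- I - e * J) / (1 - e * e) = 0"
      using e2 by (simp_all add: field_simps)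
    then show ?thesis by (intro that[of "(J + e * I) / (1 - e * e)" "(- I - e * J) / (1 - e * e)"]) (simp only: Dir bc.case)
  qed
  define \<alpha> where "\<alpha> x = A * exp (c * of_real x) + 1 * Vf c G x" for x
  \<comment> \<open>Since \<open>e = exp (c * pi)\<close>, the factor \<open>B * e\<close> makes the
    exponential part equal to \<open>B\<close> at \<open>pi\<close>.\<close>
  define \<beta> where "\<beta> x = (B * e) * exp (- c * of_real x) + (-1) * Vb c H x" for x
  have "AC_with_deriv \<alpha> (\<lambda>t. c * \<alpha> t + G t)"
    by (rule AC_cong[OF AC_lincomb[OF AC_exp AC_Vf[OF G], of A c 1]]) (auto simp: \<alpha>_def algebra_simps)
  moreover have "AC_with_deriv \<beta> (\<lambda>t. - c * \<beta> t + H t)"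
    by (rule AC_cong[OF AC_lincomb[OF AC_exp AC_Vb[OF H], of "B * e" "-c" "-1"]]) (auto simp: \<beta>_def algebra_simps)
  moreover have "\<alpha> 0 = A" "\<alpha> pi = e * A + I" "\<beta> 0 = e * B - J" "\<beta> pi = B"
    by (auto simp: \<alpha>_def \<beta>_def I_def J_def e_def Vf_def[of c G 0] Vb_def[of c H pi] exp_minus)
  then have "bcond b \<alpha> \<beta>" using AB by (cases b) (simp_all add: bcond_def)
  ultimately show ?thesis using that by (auto simp: free_sol_def)
qed

lemma free_sol_diff:
  assumes "free_sol b c G H \<alpha> \<beta>" "free_sol b c G' H' \<alpha>' \<beta>'"
  shows "free_sol b c (\<lambda>t. G t - G' t) (\<lambda>t. H t - H' t) (\<lambda>t. \<alpha> t - \<alpha>' t) (\<lambda>t. \<beta> t - \<beta>' t)"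
proof -
  have AC: "AC_with_deriv \<alpha> (\<lambda>t. c * \<alpha> t + G t)" "AC_with_deriv \<beta> (\<lambda>t. - c * \<beta> t + H t)"
    "AC_with_deriv \<alpha>' (\<lambda>t. c * \<alpha>' t + G' t)" "AC_with_deriv \<beta>' (\<lambda>t. - c * \<beta>' t + H' t)"
    using assms by (auto simp: free_sol_def)
  have "AC_with_deriv (\<lambda>t. \<alpha> t - \<alpha>' t) (\<lambda>t. c * (\<alpha> t - \<alpha>' t) + (G t - G' t))"
    by (rule AC_cong[OF AC_lincomb[OF AC(1,3), of 1 "-1"]]) (auto simp: algebra_simps)
  moreover have "AC_with_deriv (\<lambda>t. \<beta> t - \<beta>' t) (\<lambda>t. - c * (\<beta> t - \<beta>' t) + (H t - H' t))"
    by (rule AC_cong[OF AC_lincomb[OF AC(2,4), of 1 "-1"]]) (auto simp: algebra_simps)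
  moreover have "bcond b (\<lambda>t. \<alpha> t - \<alpha>' t) (\<lambda>t. \<beta> t - \<beta>' t)"
  proof -
    have *: "\<alpha> t - \<alpha>' t + (\<beta> t - \<beta>' t) = (\<alpha> t + \<beta> t) - (\<alpha>' t + \<beta>' t)" for t by simp
    then show ?thesis using assms unfolding free_sol_def bcond_def * by (cases b) simp_all
  qed
  ultimately show ?thesis by (simp add: free_sol_def)
qed

section \<open>Estimates for the sources produced by the potential\<close>

locale potential =
  fixes Q :: "real \<Rightarrow> complex"
  assumes Q: "L2_on Q"
begin

lemmas Qi = L2_on_imp_absolutely_integrable[OF Q]

text \<open>For \<open>k = 1 / (2 * c)\<close> these are the inhomogeneities \<open>G\<close>, \<open>H\<close> of the amplitude equations
  \<open>\<alpha>' = c \<alpha> + G\<close>, \<open>\<beta>' = - c \<beta> + H\<close>; the second terms are \<open>O(1 / c)\<close>.\<close>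
definition srcG :: "complex \<Rightarrow> (real \<Rightarrow> complex) \<Rightarrow> (real \<Rightarrow> complex) \<Rightarrow> (real \<Rightarrow> complex) \<Rightarrow> real \<Rightarrow> complex" where
  "srcG k f \<alpha> \<beta> t = Q t * \<beta> t - k * ((Q t)\<^sup>2 * (\<alpha> t + \<beta> t) - f t)"

definition srcH :: "complex \<Rightarrow> (real \<Rightarrow> complex) \<Rightarrow> (real \<Rightarrow> complex) \<Rightarrow> (real \<Rightarrow> complex) \<Rightarrow> real \<Rightarrow> complex" where
  "srcH k f \<alpha> \<beta> t = Q t * \<alpha> t + k * ((Q t)\<^sup>2 * (\<alpha> t + \<beta> t) - f t)"

definition q1 :: real where "q1 = integral {0..pi} (\<lambda>t. cmod (Q t))"
definition q2 :: real where "q2 = integral {0..pi} (\<lambda>t. (cmod (Q t))\<^sup>2)"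

lemma q_nonneg: "q1 \<ge> 0" "q2 \<ge> 0"
  unfolding q1_def q2_def
  by (rule HK_nonneg; use Q abs_integrableD(2)[OF Qi(1)] in \<open>simp add: L2_on_def\<close>)+

lemma src_integrable:
  assumes "continuous_on {0..pi} \<alpha>" "continuous_on {0..pi} \<beta>" "f absolutely_integrable_on {0..pi}"
  shows "(\<lambda>t. Q t * \<alpha> t) absolutely_integrable_on {0..pi}" "(\<lambda>t. Q t * \<beta> t) absolutely_integrable_on {0..pi}"
    "(\<lambda>t. (Q t)\<^sup>2 * (\<alpha> t + \<beta> t) - f t) absolutely_integrable_on {0..pi}"
    "srcG k f \<alpha> \<beta> absolutely_integrable_on {0..pi}" "srcH k f \<alpha> \<beta> absolutely_integrable_on {0..pi}"
proof -
  show 1: "(\<lambda>t. Q t * \<alpha> t) absolutely_integrable_on {0..pi}" "(\<lambda>t. Q t * \<beta> t) absolutely_integrable_on {0..pi}"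
    using absolutely_integrable_continuous_mult[OF Qi(1) assms(1)] absolutely_integrable_continuous_mult[OF Qi(1) assms(2)]
    by (simp_all add: mult.commute)
  have "(\<lambda>t. (\<alpha> t + \<beta> t) * (Q t)\<^sup>2) absolutely_integrable_on {0..pi}"
    by (intro absolutely_integrable_continuous_mult Qi continuous_intros assms)
  then show 2: "(\<lambda>t. (Q t)\<^sup>2 * (\<alpha> t + \<beta> t) - f t) absolutely_integrable_on {0..pi}"
    by (intro set_integral_diff assms) (simp add: mult.commute)
  have 3: "(\<lambda>t. k * ((Q t)\<^sup>2 * (\<alpha> t + \<beta> t) - f t)) absolutely_integrable_on {0..pi}"
    by (rule absolutely_integrable_continuous_mult[OF 2 continuous_on_const])
  show "srcG k f \<alpha> \<beta> absolutely_integrable_on {0..pi}" unfolding srcG_def[abs_def] by (intro set_integral_diff 1 3)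
  show "srcH k f \<alpha> \<beta> absolutely_integrable_on {0..pi}" unfolding srcH_def[abs_def] by (intro set_integral_add 1 3)
qed

text \<open>\<open>g\<close> and \<open>h k\<close> are majorants under a common bound
  \<open>M\<close> for both amplitudes. They stay explicit functions of \<open>t\<close> because the
  Volterra estimates integrate a pointwise majorant.\<close>

lemma src_norm:
  assumes ab: "continuous_on {0..pi} \<alpha>" "continuous_on {0..pi} \<beta>" and f: "f absolutely_integrable_on {0..pi}"
    and M: "\<forall>x\<in>{0..pi}. cmod (\<alpha> x) \<le> M" "\<forall>x\<in>{0..pi}. cmod (\<beta> x) \<le> M"
    and M0: "M \<ge> 0"
  defines "F \<equiv> integral {0..pi} (\<lambda>t. cmod (f t))"
  defines "g \<equiv> \<lambda>t. (cmod (Q t))\<^sup>2 * (2 * M) + cmod (f t)"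
  defines "h \<equiv> \<lambda>k t. cmod (Q t) * M + cmod k * g t"
  shows "g integrable_on {0..pi}" "integral {0..pi} g = 2 * q2 * M + F"
    "h k integrable_on {0..pi}" "integral {0..pi} (h k) = q1 * M + cmod k * (2 * q2 * M + F)"
    "\<forall>t\<in>{0..pi}. cmod ((Q t)\<^sup>2 * (\<alpha> t + \<beta> t) - f t) \<le> g t"
    "\<forall>t\<in>{0..pi}. cmod (srcG k f \<alpha> \<beta> t) \<le> h k t"
    "\<forall>t\<in>{0..pi}. cmod (srcH k f \<alpha> \<beta> t) \<le> h k t"
proof -
  note M = M[rule_format]
  have i: "(\<lambda>t. cmod (Q t)) integrable_on {0..pi}" "(\<lambda>t. (cmod (Q t))\<^sup>2) integrable_on {0..pi}"
    "(\<lambda>t. cmod (f t)) integrable_on {0..pi}"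
    using Q abs_integrableD(2)[OF Qi(1)] abs_integrableD(2)[OF f] by (auto simp: L2_on_def)
  show gi: "g integrable_on {0..pi}" unfolding g_def by (intro integrable_add integrable_on_mult_left i)
  show g2: "integral {0..pi} g = 2 * q2 * M + F"
    unfolding g_def F_def q2_def
    by (subst Henstock_Kurzweil_Integration.integral_add) (auto intro!: integrable_on_mult_left i)
  show "h k integrable_on {0..pi}" unfolding h_def by (intro integrable_add integrable_on_mult_left integrable_on_mult_right i gi)
  have "integral {0..pi} (h k) = integral {0..pi} (\<lambda>t. cmod (Q t) * M) + integral {0..pi} (\<lambda>t. cmod k * g t)"
    unfolding h_def by (intro Henstock_Kurzweil_Integration.integral_add integrable_on_mult_left integrable_on_mult_right i gi)
  then show "integral {0..pi} (h k) = q1 * M + cmod k * (2 * q2 * M + F)"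
    using g2 by (simp add: q1_def)
  have g: "cmod ((Q t)\<^sup>2 * (\<alpha> t + \<beta> t) - f t) \<le> g t" if t: "t \<in> {0..pi}" for t
  proof -
    have "cmod ((Q t)\<^sup>2 * (\<alpha> t + \<beta> t) - f t) \<le> cmod ((Q t)\<^sup>2 * (\<alpha> t + \<beta> t)) + cmod (f t)"
      by (rule norm_triangle_ineq4)
    also have "cmod ((Q t)\<^sup>2 * (\<alpha> t + \<beta> t)) \<le> (cmod (Q t))\<^sup>2 * (2 * M)"
      unfolding norm_mult norm_power using norm_triangle_ineq[of "\<alpha> t" "\<beta> t"] M[OF t]
      by (intro mult_left_mono) auto
    finally show ?thesis by (simp add: g_def)
  qed
  then show "\<forall>t\<in>{0..pi}. cmod ((Q t)\<^sup>2 * (\<alpha> t + \<beta> t) - f t) \<le> g t" by blast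
  have sb: "cmod (srcG k f \<alpha> \<beta> t) \<le> h k t \<and> cmod (srcH k f \<alpha> \<beta> t) \<le> h k t" if t: "t \<in> {0..pi}" for t
  proof -
    have kg: "cmod (k * ((Q t)\<^sup>2 * (\<alpha> t + \<beta> t) - f t)) \<le> cmod k * g t"
      unfolding norm_mult using g[OF t] by (intro mult_left_mono) auto
    have "cmod (Q t * \<beta> t) \<le> cmod (Q t) * M" "cmod (Q t * \<alpha> t) \<le> cmod (Q t) * M"
      unfolding norm_mult using M[OF t] by (auto intro!: mult_left_mono)
    then show ?thesis
      using kg unfolding srcG_def srcH_def h_def
      by (meson add_mono norm_triangle_ineq4 norm_triangle_ineq order_trans)
  qed
  then show "\<forall>t\<in>{0..pi}. cmod (srcG k f \<alpha> \<beta> t) \<le> h k t" "\<forall>t\<in>{0..pi}. cmod (srcH k f \<alpha> \<beta> t) \<le> h k t"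
    by blast+
qed

text \<open>The frequency \<open>2 * c\<close> is the difference of the exponents \<open>c\<close>
  and \<open>- c\<close> of the two amplitudes that \<open>Q\<close> couples.\<close>

definition osc_small :: "complex \<Rightarrow> real \<Rightarrow> bool" where
  "osc_small c \<epsilon> \<longleftrightarrow> (\<forall>x\<in>{0..pi}. cmod (Vf (2 * c) Q x) \<le> \<epsilon> \<and> cmod (Vb (2 * c) Q x) \<le> \<epsilon>)"

text \<open>The factor \<open>\<epsilon>\<close> in front of \<open>M\<close> and of the majorant
  comes from \<open>Vf_product\<close> and \<open>Vb_product\<close>, which require that the
  amplitudes themselves solve equations with some sources \<open>G\<close> and \<open>H\<close>.
  These may differ from the sources being estimated: the a priori bound takes the same ones, the
  contraction takes those of the preceding iterate.\<close>

lemma src_volterra_bound: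
  assumes s: "free_sol b c G H \<alpha> \<beta>" and c: "Re c \<le> 0" and os: "osc_small c \<epsilon>"
    and GH: "G absolutely_integrable_on {0..pi}" "H absolutely_integrable_on {0..pi}"
    and p: "p integrable_on {0..pi}" "\<forall>t\<in>{0..pi}. cmod (G t) \<le> p t"
      "\<forall>t\<in>{0..pi}. cmod (H t) \<le> p t"
    and f: "f absolutely_integrable_on {0..pi}"
    and M: "\<forall>x\<in>{0..pi}. cmod (\<alpha> x) \<le> M" "\<forall>x\<in>{0..pi}. cmod (\<beta> x) \<le> M"
    and M0: "M \<ge> 0" and x: "x \<in> {0..pi}"
  fixes k :: complex
  defines "F \<equiv> integral {0..pi} (\<lambda>t. cmod (f t))"
  defines "m \<equiv> \<epsilon> * (M + integral {0..pi} p) + cmod k * (2 * q2 * M + F)"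
  shows "cmod (Vf c (srcG k f \<alpha> \<beta>) x) \<le> m" "cmod (Vb c (srcH k f \<alpha> \<beta>) x) \<le> m"
proof -
  have AC: "AC_with_deriv \<alpha> (\<lambda>t. c * \<alpha> t + G t)" "AC_with_deriv \<beta> (\<lambda>t. - c * \<beta> t + H t)"
    using s by (auto simp: free_sol_def)
  note ct = AC[THEN AC_continuous]
  note si = src_integrable[OF ct f]
  note sn = src_norm[OF ct f M M0]
  note p = p(1) p(2,3)[rule_format] and M = M[rule_format]
  have e0: "\<epsilon> \<ge> 0" using os x norm_ge_zero order_trans unfolding osc_small_def by blast
  have os': "cmod (Vf (2 * c) Q t) \<le> \<epsilon>" "cmod (Vb (2 * c) Q t) \<le> \<epsilon>" if "t \<in> {0..pi}" for t
    using os that by (auto simp: osc_small_def)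
  let ?w = "\<lambda>t. (Q t)\<^sup>2 * (\<alpha> t + \<beta> t) - f t"
  have wf: "cmod (Vf c ?w x) \<le> 2 * q2 * M + F" "cmod (Vb c ?w x) \<le> 2 * q2 * M + F"
    using norm_Vf_le[OF si(3) sn(1) c x sn(5)] norm_Vb_le[OF si(3) sn(1) c x sn(5)] sn(2) by (auto simp: F_def)
  have ep: "integral {0..pi} (\<lambda>t. \<epsilon> * p t) = \<epsilon> * integral {0..pi} p" by simp
  have epi: "(\<lambda>t. \<epsilon> * p t) integrable_on {0..pi}" using p(1) by (rule integrable_on_mult_right)
  have "cmod (Vf c (\<lambda>t. Vf (2 * c) Q t * H t) x) \<le> integral {0..pi} (\<lambda>t. \<epsilon> * p t)"
  proof (rule norm_Vf_le[OF _ epi c x])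
    show "(\<lambda>t. Vf (2 * c) Q t * H t) absolutely_integrable_on {0..pi}"
      by (rule absolutely_integrable_continuous_mult[OF GH(2) AC_continuous[OF AC_Vf[OF Qi(1)]]])
    show "\<forall>t\<in>{0..pi}. cmod (Vf (2 * c) Q t * H t) \<le> \<epsilon> * p t"
      unfolding norm_mult using os' p(3) e0 by (intro ballI mult_mono) auto
  qed
  moreover have "cmod (Vf (2 * c) Q x * \<beta> x) \<le> \<epsilon> * M"
    unfolding norm_mult using os'[OF x] M[OF x] e0 by (intro mult_mono) auto
  ultimately have f1: "cmod (Vf c (\<lambda>t. Q t * \<beta> t) x) \<le> \<epsilon> * M + \<epsilon> * integral {0..pi} p"
    unfolding Vf_product[OF AC(2) Qi(1) GH(2) x] ep by (intro norm_triangle_le_diff add_mono)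
  have "cmod (Vb c (\<lambda>t. Vb (2 * c) Q t * G t) x) \<le> integral {0..pi} (\<lambda>t. \<epsilon> * p t)"
  proof (rule norm_Vb_le[OF _ epi c x])
    show "(\<lambda>t. Vb (2 * c) Q t * G t) absolutely_integrable_on {0..pi}"
      by (rule absolutely_integrable_continuous_mult[OF GH(1) AC_continuous[OF AC_Vb[OF Qi(1)]]])
    show "\<forall>t\<in>{0..pi}. cmod (Vb (2 * c) Q t * G t) \<le> \<epsilon> * p t"
      unfolding norm_mult using os' p(2) e0 by (intro ballI mult_mono) auto
  qed
  moreover have "cmod (Vb (2 * c) Q x * \<alpha> x) \<le> \<epsilon> * M"
    unfolding norm_mult using os'[OF x] M[OF x] e0 by (intro mult_mono) auto
  ultimately have b1: "cmod (Vb c (\<lambda>t. Q t * \<alpha> t) x) \<le> \<epsilon> * M + \<epsilon> * integral {0..pi} p"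
    unfolding Vb_product[OF AC(1) Qi(1) GH(1) x] ep by (intro norm_triangle_le add_mono)
  have "srcG k f \<alpha> \<beta> = (\<lambda>t. Q t * \<beta> t + (-k) * ?w t)" "srcH k f \<alpha> \<beta> = (\<lambda>t. Q t * \<alpha> t + k * ?w t)"
    by (auto simp: srcG_def srcH_def)
  then have v: "Vf c (srcG k f \<alpha> \<beta>) x = Vf c (\<lambda>t. Q t * \<beta> t) x + (-k) * Vf c ?w x"
     "Vb c (srcH k f \<alpha> \<beta>) x = Vb c (\<lambda>t. Q t * \<alpha> t) x + k * Vb c ?w x"
    using Vf_lincomb[OF si(2,3) x, of c "-k"] Vb_lincomb[OF si(1,3) x, of c k] by metis+
  have "cmod ((-k) * Vf c ?w x) \<le> cmod k * (2 * q2 * M + F)" "cmod (k * Vb c ?w x) \<le> cmod k * (2 * q2 * M + F)"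
    unfolding norm_mult norm_minus_cancel using wf by (auto intro!: mult_left_mono)
  then show "cmod (Vf c (srcG k f \<alpha> \<beta>) x) \<le> m" "cmod (Vb c (srcH k f \<alpha> \<beta>) x) \<le> m"
    unfolding v m_def distrib_left[of \<epsilon>] using f1 b1
    by (meson add_mono norm_triangle_ineq order_trans)+
qed

end

lemma free_sol_cong:
  assumes "free_sol b c G H \<alpha> \<beta>" "\<And>x. x \<in> {0..pi} \<Longrightarrow> \<alpha>' x = \<alpha> x" "\<And>x. x \<in> {0..pi} \<Longrightarrow> \<beta>' x = \<beta> x"
    "\<And>x. x \<in> {0..pi} \<Longrightarrow> G' x = G x" "\<And>x. x \<in> {0..pi} \<Longrightarrow> H' x = H x"
  shows "free_sol b c G' H' \<alpha>' \<beta>'"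
proof -
  have AC: "AC_with_deriv \<alpha> (\<lambda>t. c * \<alpha> t + G t)" "AC_with_deriv \<beta> (\<lambda>t. - c * \<beta> t + H t)" "bcond b \<alpha> \<beta>"
    using assms(1) by (auto simp: free_sol_def)
  have "AC_with_deriv \<alpha>' (\<lambda>t. c * \<alpha>' t + G' t)" "AC_with_deriv \<beta>' (\<lambda>t. - c * \<beta>' t + H' t)"
    by (rule AC_cong[OF AC(1)] AC_cong[OF AC(2)]; simp add: assms(2-))+
  moreover have "bcond b \<alpha>' \<beta>'" using AC(3) by (cases b) (simp_all add: bcond_def assms(2,3))
  ultimately show ?thesis by (simp add: free_sol_def)
qed

section \<open>A priori bound and existence by a fixed point\<close>

context potential
begin

definition wave_sol :: "bc \<Rightarrow> complex \<Rightarrow> (real \<Rightarrow> complex) \<Rightarrow> (real \<Rightarrow> complex) \<Rightarrow> (real \<Rightarrow> complex) \<Rightarrow> bool" where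
  "wave_sol b c f \<alpha> \<beta> \<longleftrightarrow>
     free_sol b c (srcG (1 / (2 * c)) f \<alpha> \<beta>) (srcH (1 / (2 * c)) f \<alpha> \<beta>) \<alpha> \<beta>"

text \<open>The 1 pays for the boundary term of the integration by parts, \<open>q1\<close> for the
  coupling \<open>Q\<close>, and \<open>2 * q2\<close> for \<open>Q\<^sup>2\<close> acting on both
  amplitudes.\<close>

definition potential_size where "potential_size = 1 + q1 + 2 * q2"

lemma potential_size_ge_1: "potential_size \<ge> 1" using q_nonneg by (simp add: potential_size_def)

text \<open>The pair is estimated through its own sources, so its supremum \<open>M\<close> is at
  most \<open>\<eta> * M\<close> plus a multiple of the integral of the modulus of \<open>f\<close>,
  and the first term is absorbed. The factor \<open>(1 + \<delta>) / (1 - \<eta>)\<close> can be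
  brought close to 1, which keeps the leading constant of the free problem.\<close>

lemma wave_sol_apriori:
  assumes s: "wave_sol b c f \<alpha> \<beta>" and f: "f absolutely_integrable_on {0..pi}"
    and c: "Re c \<le> 0" "exp (2 * of_real pi * c) \<noteq> 1" and K: "amp c \<le> K"
    and os: "osc_small c \<delta>" and k: "cmod (1 / (2 * c)) \<le> \<delta>" and \<delta>: "0 < \<delta>" "\<delta> \<le> 1"
    and \<eta>: "2 * K * potential_size * \<delta> \<le> \<eta>" "\<eta> < 1" and x: "x \<in> {0..pi}"
  defines "bnd \<equiv> amp c * cmod (1 / (2 * c)) * ((1 + \<delta>) / (1 - \<eta>)) * integral {0..pi} (\<lambda>t. cmod (f t))"
  shows "cmod (\<alpha> x) \<le> bnd" "cmod (\<beta> x) \<le> bnd"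
proof -
  let ?k = "1 / (2 * c)"
  let ?F = "integral {0..pi} (\<lambda>t. cmod (f t))"
  note s' = s[unfolded wave_sol_def]
  have ct: "continuous_on {0..pi} \<alpha>" "continuous_on {0..pi} \<beta>"
    using s' by (auto simp: free_sol_def dest: AC_continuous)
  have "continuous_on {0..pi} (\<lambda>x. max (cmod (\<alpha> x)) (cmod (\<beta> x)))"
    by (intro continuous_intros ct)
  then obtain x0 where x0: "x0 \<in> {0..pi}"
    "\<And>x. x \<in> {0..pi} \<Longrightarrow> max (cmod (\<alpha> x)) (cmod (\<beta> x)) \<le> max (cmod (\<alpha> x0)) (cmod (\<beta> x0))"
    using continuous_attains_sup[of "{0..pi}" "\<lambda>x. max (cmod (\<alpha> x)) (cmod (\<beta> x))"] by auto
  define M where "M = max (cmod (\<alpha> x0)) (cmod (\<beta> x0))"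
  have M: "\<forall>x\<in>{0..pi}. cmod (\<alpha> x) \<le> M" "\<forall>x\<in>{0..pi}. cmod (\<beta> x) \<le> M"
    using x0(2) by (auto simp: M_def)
  have M0: "M \<ge> 0" by (simp add: M_def le_max_iff_disj)
  have F0: "?F \<ge> 0" by (rule HK_nonneg[OF abs_integrableD(2)[OF f]]) simp
  note si = src_integrable[OF ct f]
  note sn = src_norm[OF ct f M M0]
  define \<kappa> where "\<kappa> = cmod ?k"
  have \<kappa>: "0 \<le> \<kappa>" "\<kappa> \<le> \<delta>" using k by (simp_all add: \<kappa>_def)
  define m where "m = \<delta> * (M + (q1 * M + \<kappa> * (2 * q2 * M + ?F))) + \<kappa> * (2 * q2 * M + ?F)"
  have V: "\<forall>x\<in>{0..pi}. cmod (Vf c (srcG ?k f \<alpha> \<beta>) x) \<le> m" "\<forall>x\<in>{0..pi}. cmod (Vb c (srcH ?k f \<alpha> \<beta>) x) \<le> m"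
    using src_volterra_bound[OF s' c(1) os si(4,5) sn(3,6,7) f M M0, where k="?k"] unfolding sn(4) m_def \<kappa>_def by blast+
  have "M \<le> amp c * m"
    using free_sol_bound[OF s' c V x0(1)] by (simp add: M_def)
  also have "m \<le> 2 * potential_size * \<delta> * M + \<kappa> * (1 + \<delta>) * ?F"
  proof -
    have q2M: "0 \<le> 2 * q2 * M" using M0 q_nonneg by simp
    \<comment> \<open>\<open>\<kappa> \<le> 1\<close> is enough where a factor
      \<open>\<delta>\<close> is already present; elsewhere \<open>\<kappa> \<le> \<delta>\<close>
      supplies that factor.\<close>
    have 1: "\<kappa> * (2 * q2 * M) \<le> 1 * (2 * q2 * M)" and 2: "\<kappa> * (2 * q2 * M) \<le> \<delta> * (2 * q2 * M)"
      by (rule mult_right_mono[OF _ q2M], use \<kappa> \<delta> in linarith)+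
    have "\<delta> * (M + (q1 * M + \<kappa> * (2 * q2 * M))) \<le> \<delta> * (M + (q1 * M + 2 * q2 * M))"
      by (rule mult_left_mono) (use 1 \<delta> in linarith)+
    also have "\<dots> = potential_size * \<delta> * M" by (simp add: potential_size_def algebra_simps)
    finally have "\<delta> * (M + (q1 * M + \<kappa> * (2 * q2 * M))) + \<kappa> * (2 * q2 * M) \<le> potential_size * \<delta> * M + \<delta> * (2 * q2 * M)"
      using 2 by linarith
    also have "\<dots> = (potential_size + 2 * q2) * \<delta> * M" by (simp add: algebra_simps)
    also have "\<dots> \<le> (2 * potential_size) * \<delta> * M" using \<delta> M0 q_nonneg by (intro mult_right_mono) (auto simp: potential_size_def)
    finally show ?thesis by (simp add: m_def algebra_simps)
  qed
  then have "amp c * m \<le> amp c * (2 * potential_size * \<delta> * M + \<kappa> * (1 + \<delta>) * ?F)"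
    by (rule mult_left_mono) (use amp_ge_1[of c] in linarith)
  also have "\<dots> = (2 * amp c * potential_size * \<delta>) * M + amp c * (\<kappa> * (1 + \<delta>) * ?F)" by (simp add: algebra_simps)
  also have "(2 * amp c * potential_size * \<delta>) * M \<le> \<eta> * M"
  proof (rule mult_right_mono[OF _ M0])
    have "2 * amp c * potential_size * \<delta> \<le> 2 * K * potential_size * \<delta>" using K potential_size_ge_1 \<delta> by (intro mult_right_mono) auto
    then show "2 * amp c * potential_size * \<delta> \<le> \<eta>" using \<eta> by linarith
  qed
  finally have "M * (1 - \<eta>) \<le> amp c * (\<kappa> * (1 + \<delta>) * ?F)" by (simp add: algebra_simps)
  then have "M \<le> amp c * (\<kappa> * (1 + \<delta>) * ?F) / (1 - \<eta>)" using \<eta> by (simp add: pos_le_divide_eq)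
  also have "\<dots> = bnd" by (simp add: bnd_def \<kappa>_def[symmetric])
  finally have "M \<le> bnd" .
  then show "cmod (\<alpha> x) \<le> bnd" "cmod (\<beta> x) \<le> bnd" using bspec[OF M(1) x] bspec[OF M(2) x] by linarith+
qed

text \<open>The first step sees an arbitrary continuous pair and only yields the bound
  \<open>K * potential_size * m0\<close>, without a small factor. Its result solves an amplitude
  equation, so \<open>src_volterra_bound\<close> gains \<open>\<delta>\<close> in the second step.
  The datum is 0 because the lemma is meant for differences of iterates.\<close>

lemma two_step_contraction:
  assumes e0: "continuous_on {0..pi} \<alpha>0" "continuous_on {0..pi} \<beta>0"
    and m0: "\<forall>x\<in>{0..pi}. cmod (\<alpha>0 x) \<le> m0" "\<forall>x\<in>{0..pi}. cmod (\<beta>0 x) \<le> m0"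
    and s1: "free_sol b c (srcG k (\<lambda>_. 0) \<alpha>0 \<beta>0) (srcH k (\<lambda>_. 0) \<alpha>0 \<beta>0) \<alpha>1 \<beta>1"
    and s2: "free_sol b c (srcG k (\<lambda>_. 0) \<alpha>1 \<beta>1) (srcH k (\<lambda>_. 0) \<alpha>1 \<beta>1) \<alpha>2 \<beta>2"
    and c: "Re c \<le> 0" "exp (2 * of_real pi * c) \<noteq> 1" and K: "amp c \<le> K"
    and os: "osc_small c \<delta>" and k: "cmod k \<le> \<delta>" and \<delta>: "0 < \<delta>" "\<delta> \<le> 1"
    and sm: "12 * K\<^sup>2 * potential_size\<^sup>2 * \<delta> \<le> 1" and x: "x \<in> {0..pi}"
  shows "cmod (\<alpha>2 x) \<le> m0 / 4" "cmod (\<beta>2 x) \<le> m0 / 4"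
proof -
  have K1: "K \<ge> 1" using amp_ge_1[of c] K by linarith
  have m00: "m0 \<ge> 0" using m0(1) x norm_ge_zero order_trans by blast
  have z: "(\<lambda>_. 0 :: complex) absolutely_integrable_on {0..pi}" by simp
  have ct1: "continuous_on {0..pi} \<alpha>1" "continuous_on {0..pi} \<beta>1"
    using s1 by (auto simp: free_sol_def dest: AC_continuous)
  note si = src_integrable[OF e0 z]
  note sn = src_norm[OF e0 z m0 m00]
  define L where "L = potential_size * m0"
  have L0: "L \<ge> 0" using m00 potential_size_ge_1 by (simp add: L_def)
  let ?h = "\<lambda>t. cmod (Q t) * m0 + cmod k * ((cmod (Q t))\<^sup>2 * (2 * m0) + cmod (0 :: complex))"
  have hL: "integral {0..pi} ?h \<le> L"
  proof -
    have "cmod k * (2 * q2 * m0) \<le> 1 * (2 * q2 * m0)" using k \<delta> m00 q_nonneg by (intro mult_right_mono) auto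
    then have "q1 * m0 + cmod k * (2 * q2 * m0 + 0) \<le> (q1 + 2 * q2) * m0" by (simp add: algebra_simps)
    also have "\<dots> \<le> potential_size * m0" by (intro mult_right_mono m00) (simp add: potential_size_def)
    finally have "q1 * m0 + cmod k * (2 * q2 * m0 + 0) \<le> L" by (simp add: L_def)
    moreover have "integral {0..pi} ?h = q1 * m0 + cmod k * (2 * q2 * m0 + 0)" using sn(4)[of k] by simp
    ultimately show ?thesis by linarith
  qed
  have V1: "\<forall>x\<in>{0..pi}. cmod (Vf c (srcG k (\<lambda>_. 0) \<alpha>0 \<beta>0) x) \<le> L" "\<forall>x\<in>{0..pi}. cmod (Vb c (srcH k (\<lambda>_. 0) \<alpha>0 \<beta>0) x) \<le> L"
    using norm_Vf_le[OF si(4) sn(3) c(1) _ sn(6)] norm_Vb_le[OF si(5) sn(3) c(1) _ sn(7)] hL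
    by (meson order_trans)+
  have KL: "amp c * L \<le> K * L" using K L0 by (intro mult_right_mono)
  have M1: "\<forall>x\<in>{0..pi}. cmod (\<alpha>1 x) \<le> K * L" "\<forall>x\<in>{0..pi}. cmod (\<beta>1 x) \<le> K * L"
    using free_sol_bound[OF s1 c V1] KL by (meson order_trans)+
  define m where "m = \<delta> * (K * L + integral {0..pi} ?h) + cmod k * (2 * q2 * (K * L) + integral {0..pi} (\<lambda>t. cmod (0 :: complex)))"
  have KL0: "K * L \<ge> 0" using K1 L0 by simp
  have V2: "\<forall>x\<in>{0..pi}. cmod (Vf c (srcG k (\<lambda>_. 0) \<alpha>1 \<beta>1) x) \<le> m" "\<forall>x\<in>{0..pi}. cmod (Vb c (srcH k (\<lambda>_. 0) \<alpha>1 \<beta>1) x) \<le> m"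
    using src_volterra_bound[OF s1 c(1) os si(4,5) sn(3,6,7) z M1 KL0, where k=k] unfolding m_def by blast+
  have mpos: "0 \<le> m" using V2(1) x norm_ge_zero order_trans by blast
  have a: "\<delta> * (K * L + integral {0..pi} ?h) \<le> \<delta> * (K * L + L)"
    by (rule mult_left_mono) (use hL \<delta> in linarith)+
  have b: "cmod k * (2 * q2 * (K * L) + 0) \<le> \<delta> * (2 * q2 * (K * L) + 0)"
    using k KL0 q_nonneg by (intro mult_right_mono) auto
  have "m = \<delta> * (K * L + integral {0..pi} ?h) + cmod k * (2 * q2 * (K * L) + 0)"
    unfolding m_def norm_zero integral_0 ..
  also note add_mono[OF a b]
  finally have "m \<le> \<delta> * (K * L + L) + \<delta> * (2 * q2 * (K * L))" by (simp only: add_0_right)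
  also have "\<dots> \<le> \<delta> * (3 * (K * potential_size) * L)"
  proof -
    have "K * 1 \<le> K * potential_size" by (rule mult_left_mono) (use K1 potential_size_ge_1 in linarith)+
    moreover have "K * (2 * q2) \<le> K * potential_size" by (rule mult_left_mono) (use K1 q_nonneg in \<open>auto simp: potential_size_def\<close>)
    ultimately have "K + 1 + K * (2 * q2) \<le> 3 * (K * potential_size)" using K1 by linarith
    then have "(K + 1 + K * (2 * q2)) * L \<le> (3 * (K * potential_size)) * L" by (intro mult_right_mono L0)
    then have "\<delta> * ((K + 1 + K * (2 * q2)) * L) \<le> \<delta> * ((3 * (K * potential_size)) * L)" using \<delta> by (intro mult_left_mono) auto
    then show ?thesis by (simp add: algebra_simps)
  qed
  finally have "amp c * m \<le> K * (\<delta> * (3 * (K * potential_size) * L))"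
    using K K1 mpos by (intro mult_mono) auto
  \<comment> \<open>12 is 3 times 4: three terms were collected in
    \<open>3 * (K * potential_size) * L\<close>, and each component is to shrink by a factor 4 so
    that the pair shrinks by 2.\<close>
  also have "\<dots> = (12 * K\<^sup>2 * potential_size\<^sup>2 * \<delta>) * (m0 / 4)" by (simp add: L_def power2_eq_square)
  also have "\<dots> \<le> 1 * (m0 / 4)" using sm m00 by (intro mult_right_mono) auto
  finally have "amp c * m \<le> m0 / 4" by simp
  then show "cmod (\<alpha>2 x) \<le> m0 / 4" "cmod (\<beta>2 x) \<le> m0 / 4"
    using free_sol_bound[OF s2 c V2 x] by linarith+
qed

text \<open>\<Theta> solves the problem with sources frozen at the previous pair. Its square is a
  contraction of the complete space of bounded continuous pairs on the line, so Banach's theorem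
  applies to the square.\<close>

lemma wave_sol_exists:
  assumes f: "f absolutely_integrable_on {0..pi}"
    and c: "Re c \<le> 0" "exp (2 * of_real pi * c) \<noteq> 1" and K: "amp c \<le> K"
    and os: "osc_small c \<delta>" and k: "cmod (1 / (2 * c)) \<le> \<delta>" and \<delta>: "0 < \<delta>" "\<delta> \<le> 1"
    and sm: "12 * K\<^sup>2 * potential_size\<^sup>2 * \<delta> \<le> 1"
  obtains \<alpha> \<beta> where "wave_sol b c f \<alpha> \<beta>"
proof -
  let ?k = "1 / (2 * c)"
  \<comment> \<open>Functions are extended from \<open>{0..pi}\<close> to the line by freezing their
    end values, so that the distance of two iterates is decided on \<open>{0..pi}\<close>.\<close>
  define cl where "cl x = max 0 (min pi x)" for x :: real
  have cl: "cl x \<in> {0..pi}" "x \<in> {0..pi} \<Longrightarrow> cl x = x" "cl (cl x) = cl x" for x by (auto simp: cl_def)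
  have clc: "continuous_on UNIV cl" unfolding cl_def by (intro continuous_intros)
  let ?a = "\<lambda>p x. fst (apply_bcontfun p x)" and ?b = "\<lambda>p x. snd (apply_bcontfun p x)"
  have cont: "continuous_on A (?a p)" "continuous_on A (?b p)" for A and p :: "real \<Rightarrow>\<^sub>C (complex \<times> complex)"
    by (intro continuous_on_fst continuous_on_snd continuous_on_apply_bcontfun)+
  define rel where "rel p q \<longleftrightarrow> free_sol b c (srcG ?k f (?a p) (?b p)) (srcH ?k f (?a p) (?b p)) (?a q) (?b q)
      \<and> (\<forall>x. apply_bcontfun q x = apply_bcontfun q (cl x))" for p q :: "real \<Rightarrow>\<^sub>C (complex \<times> complex)"
  have "\<exists>q. rel p q" for p
  proof -
    obtain \<alpha> \<beta> where s: "free_sol b c (srcG ?k f (?a p) (?b p)) (srcH ?k f (?a p) (?b p)) \<alpha> \<beta>"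
      using free_sol_exists[OF src_integrable(4,5)[OF cont f] c(2)] by metis
    then have ct: "continuous_on {0..pi} \<alpha>" "continuous_on {0..pi} \<beta>"
      by (auto simp: free_sol_def dest: AC_continuous)
    define q0 where "q0 x = (\<alpha> (cl x), \<beta> (cl x))" for x
    have q0: "q0 \<in> bcontfun"
      unfolding bcontfun_def
    proof (intro CollectI conjI)
      show "continuous_on UNIV q0" unfolding q0_def
        by (intro continuous_intros continuous_on_compose2[OF ct(1) clc] continuous_on_compose2[OF ct(2) clc]) (use cl in auto)
      have "bounded ((\<lambda>x. (\<alpha> x, \<beta> x)) ` {0..pi})"
        by (intro compact_imp_bounded compact_continuous_image continuous_intros ct) auto
      then show "bounded (range q0)"
        by (rule bounded_subset) (use cl in \<open>auto simp: q0_def\<close>)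
    qed
    have "free_sol b c (srcG ?k f (?a p) (?b p)) (srcH ?k f (?a p) (?b p)) (?a (Bcontfun q0)) (?b (Bcontfun q0))"
      by (rule free_sol_cong[OF s]) (auto simp: Bcontfun_inverse[OF q0] q0_def cl)
    then have "rel p (Bcontfun q0)"
      by (auto simp: rel_def Bcontfun_inverse[OF q0] q0_def cl)
    then show ?thesis by blast
  qed
  then obtain \<Theta> where \<Theta>: "\<And>p. rel p (\<Theta> p)" by metis
  have lin: "(\<lambda>t. srcG ?k f \<alpha> \<beta> t - srcG ?k f \<alpha>' \<beta>' t) = srcG ?k (\<lambda>_. 0) (\<lambda>t. \<alpha> t - \<alpha>' t) (\<lambda>t. \<beta> t - \<beta>' t)"
     "(\<lambda>t. srcH ?k f \<alpha> \<beta> t - srcH ?k f \<alpha>' \<beta>' t) = srcH ?k (\<lambda>_. 0) (\<lambda>t. \<alpha> t - \<alpha>' t) (\<lambda>t. \<beta> t - \<beta>' t)"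
    for \<alpha> \<beta> \<alpha>' \<beta>'
    by (simp_all add: srcG_def srcH_def fun_eq_iff algebra_simps)
  have contr: "dist (\<Theta> (\<Theta> p)) (\<Theta> (\<Theta> q)) \<le> 1 / 2 * dist p q" for p q
  proof (rule dist_bound)
    fix x :: real
    have step: "free_sol b c (srcG ?k (\<lambda>_. 0) (\<lambda>t. ?a p t - ?a q t) (\<lambda>t. ?b p t - ?b q t))
       (srcH ?k (\<lambda>_. 0) (\<lambda>t. ?a p t - ?a q t) (\<lambda>t. ?b p t - ?b q t))
       (\<lambda>t. ?a (\<Theta> p) t - ?a (\<Theta> q) t) (\<lambda>t. ?b (\<Theta> p) t - ?b (\<Theta> q) t)" for p q
      using free_sol_diff[of b c _ _ "?a (\<Theta> p)" "?b (\<Theta> p)" _ _ "?a (\<Theta> q)" "?b (\<Theta> q)"] \<Theta>[of p] \<Theta>[of q]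
      unfolding rel_def lin[symmetric] by blast
    have "cmod (?a p t - ?a q t) \<le> dist p q" "cmod (?b p t - ?b q t) \<le> dist p q" for t
      using dist_bounded[of p t q] dist_fst_le[of "apply_bcontfun p t" "apply_bcontfun q t"]
        dist_snd_le[of "apply_bcontfun p t" "apply_bcontfun q t"] by (auto simp: dist_norm)
    then have d: "\<forall>t\<in>{0..pi}. cmod (?a p t - ?a q t) \<le> dist p q" "\<forall>t\<in>{0..pi}. cmod (?b p t - ?b q t) \<le> dist p q"
      by blast+
    note tc = two_step_contraction[OF _ _ d step step c K os k \<delta> sm cl(1)[of x]]
    have "cmod (?a (\<Theta> (\<Theta> p)) (cl x) - ?a (\<Theta> (\<Theta> q)) (cl x)) \<le> dist p q / 4"
      "cmod (?b (\<Theta> (\<Theta> p)) (cl x) - ?b (\<Theta> (\<Theta> q)) (cl x)) \<le> dist p q / 4"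
      by (rule tc; intro continuous_intros cont)+
    moreover have *: "apply_bcontfun (\<Theta> (\<Theta> r)) x = apply_bcontfun (\<Theta> (\<Theta> r)) (cl x)" for r
      using \<Theta>[of "\<Theta> r"] unfolding rel_def by blast
    ultimately have "cmod (?a (\<Theta> (\<Theta> p)) x - ?a (\<Theta> (\<Theta> q)) x) + cmod (?b (\<Theta> (\<Theta> p)) x - ?b (\<Theta> (\<Theta> q)) x) \<le> 1 / 2 * dist p q"
      unfolding * by linarith
    moreover have "dist u v \<le> cmod (fst u - fst v) + cmod (snd u - snd v)" for u v :: "complex \<times> complex"
      by (metis dist_norm fst_diff norm_Pair_le prod.collapse snd_diff)
    ultimately show "dist (apply_bcontfun (\<Theta> (\<Theta> p)) x) (apply_bcontfun (\<Theta> (\<Theta> q)) x) \<le> 1 / 2 * dist p q"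
      using order_trans by blast
  qed
  then have "\<exists>!p. \<Theta> (\<Theta> p) = p"
    using banach_fix_type[of "1/2" "\<lambda>p. \<Theta> (\<Theta> p)"] by auto
  \<comment> \<open>\<Theta> maps a fixed point of its square to another one; by uniqueness the two
    coincide.\<close>
  then obtain p where p: "\<Theta> p = p" by metis
  then have "wave_sol b c f (?a p) (?b p)"
    using \<Theta>[of p] unfolding rel_def wave_sol_def by simp
  then show ?thesis using that by blast
qed

subsection \<open>Well-posedness of the resolvent equation\<close>

lemma wave_sol_imp_solves:
  assumes s: "wave_sol b c f \<alpha> \<beta>" and f: "L2_on f" and c: "c\<^sup>2 = v0 - z" "c \<noteq> 0"
  shows "solves v0 Q b z f (\<lambda>x. if x \<in> {0..pi} then \<alpha> x + \<beta> x else 0)"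
proof -
  let ?k = "1 / (2 * c)"
  define y where "y x = (if x \<in> {0..pi} then \<alpha> x + \<beta> x else 0)" for x
  define u where "u x = c * \<alpha> x + (- c) * \<beta> x" for x
  \<comment> \<open>The derivative of \<open>u\<close> forced by the equation; with it the
    differential expression equals \<open>z * y - f\<close> at every point.\<close>
  define w where "w x = c\<^sup>2 * y x - Q x * u x - (Q x)\<^sup>2 * y x + f x" for x
  have AC: "AC_with_deriv \<alpha> (\<lambda>t. c * \<alpha> t + srcG ?k f \<alpha> \<beta> t)" "AC_with_deriv \<beta> (\<lambda>t. - c * \<beta> t + srcH ?k f \<alpha> \<beta> t)" "bcond b \<alpha> \<beta>"
    using s by (auto simp: free_sol_def wave_sol_def)
  have yc: "continuous_on {0..pi} y"
    by (rule continuous_on_eq[of _ "\<lambda>x. \<alpha> x + \<beta> x"]) (auto simp: y_def intro!: continuous_intros AC(1,2)[THEN AC_continuous])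
  have ACy: "AC_with_deriv y (\<lambda>t. u t + Q t * y t)"
    by (rule AC_cong[OF AC_lincomb[OF AC(1,2), of 1 1]])
      (auto simp: y_def u_def srcG_def srcH_def algebra_simps)
  have ACu: "AC_with_deriv u w"
  proof (rule AC_cong[OF AC_lincomb[OF AC(1,2), of c "-c"]])
    fix x assume x: "x \<in> {0..pi}"
    have "c * (c * \<alpha> x + srcG ?k f \<alpha> \<beta> x) + - c * (- c * \<beta> x + srcH ?k f \<alpha> \<beta> x) =
      c\<^sup>2 * (\<alpha> x + \<beta> x) - Q x * (c * \<alpha> x + (- c) * \<beta> x) - (2 * c * ?k) * ((Q x)\<^sup>2 * (\<alpha> x + \<beta> x) - f x)"
      unfolding srcG_def srcH_def by algebra
    then show "w x = c * (c * \<alpha> x + srcG ?k f \<alpha> \<beta> x) + - c * (- c * \<beta> x + srcH ?k f \<alpha> \<beta> x)"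
      using c(2) x by (simp add: w_def y_def u_def)
  qed (simp add: u_def)
  have ell: "- w t - Q t * u t - (Q t)\<^sup>2 * y t + v0 * y t = z * y t + (-1) * f t" for t
    by (simp add: w_def c algebra_simps)
  have "dom_rep v0 Q b y u w"
    unfolding dom_rep_def ell
  proof (intro conjI ACy ACu)
    show "\<forall>x. x \<notin> {0..pi} \<longrightarrow> y x = 0" by (simp add: y_def)
    show "L2_on (\<lambda>t. z * y t + (-1) * f t)"
      by (intro L2_on_add_scaled f L2_on_continuous continuous_intros yc)
    show "case b of PerP \<Rightarrow> y pi = y 0 \<and> u pi = u 0 | PerM \<Rightarrow> y pi = - y 0 \<and> u pi = - u 0
        | Dir \<Rightarrow> y 0 = 0 \<and> y pi = 0"
      using AC(3) by (cases b) (auto simp: bcond_def y_def u_def)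
  qed
  moreover have "negligible {x\<in>{0..pi}. z * y x - (- w x - Q x * u x - (Q x)\<^sup>2 * y x + v0 * y x) \<noteq> f x}"
    unfolding ell by simp
  ultimately have "solves v0 Q b z f y" unfolding solves_def by blast
  then show ?thesis by (simp add: y_def[abs_def])
qed

lemma solves_imp_wave_sol:
  assumes s: "solves v0 Q b z f y" and c: "c\<^sup>2 = v0 - z" "c \<noteq> 0"
  obtains \<alpha> \<beta> where "wave_sol b c f \<alpha> \<beta>" "\<And>x. x \<in> {0..pi} \<Longrightarrow> y x = \<alpha> x + \<beta> x" "\<And>x. x \<notin> {0..pi} \<Longrightarrow> y x = 0"
proof -
  let ?k = "1 / (2 * c)"
  obtain u w where d: "dom_rep v0 Q b y u w"
    and n: "negligible {x\<in>{0..pi}. z * y x - (- w x - Q x * u x - (Q x)\<^sup>2 * y x + v0 * y x) \<noteq> f x}"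
    using s unfolding solves_def by blast
  \<comment> \<open>\<open>w\<close> satisfies the equation only almost everywhere. Replacing it by
    the value that the equation prescribes makes the amplitude equations hold with the exact
    sources.\<close>
  define w' where "w' x = c\<^sup>2 * y x - Q x * u x - (Q x)\<^sup>2 * y x + f x" for x
  have ACy: "AC_with_deriv y (\<lambda>t. u t + Q t * y t)" and "AC_with_deriv u w"
    and bc: "case b of PerP \<Rightarrow> y pi = y 0 \<and> u pi = u 0 | PerM \<Rightarrow> y pi = - y 0 \<and> u pi = - u 0
        | Dir \<Rightarrow> y 0 = 0 \<and> y pi = 0" and out: "\<And>x. x \<notin> {0..pi} \<Longrightarrow> y x = 0"
    using d unfolding dom_rep_def by blast+
  have ACu: "AC_with_deriv u w'"
  proof (rule AC_cong_ae[OF \<open>AC_with_deriv u w\<close>])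
    show "negligible {x \<in> {0..pi}. w' x \<noteq> w x}"
    proof (rule negligible_subset[OF n], safe)
      fix x assume x: "w' x \<noteq> w x" "z * y x - (- w x - Q x * u x - (Q x)\<^sup>2 * y x + v0 * y x) = f x"
      then have "w' x = w x" unfolding w'_def c(1) by (simp add: x(2)[symmetric] algebra_simps)
      then show False using x by blast
    qed
  qed
  define \<alpha> where "\<alpha> x = (1 / 2) * y x + ?k * u x" for x
  define \<beta> where "\<beta> x = (1 / 2) * y x + (- ?k) * u x" for x
  have ab: "y x = \<alpha> x + \<beta> x" "u x = c * \<alpha> x - c * \<beta> x" for x
    using c(2) by (simp_all add: \<alpha>_def \<beta>_def field_simps)
  have kc: "?k * c\<^sup>2 = c / 2" "?k * (Q x * u x) = Q x * (\<alpha> x - \<beta> x) / 2" for x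
  proof -
    show "?k * c\<^sup>2 = c / 2" using c(2) by (simp add: field_simps power2_eq_square)
    have "\<alpha> x - \<beta> x = 2 * (?k * u x)" by (simp add: \<alpha>_def \<beta>_def)
    then show "?k * (Q x * u x) = Q x * (\<alpha> x - \<beta> x) / 2" by (simp only:) simp
  qed
  have w'k: "?k * w' x = c / 2 * (\<alpha> x + \<beta> x) - Q x * (\<alpha> x - \<beta> x) / 2 - ?k * ((Q x)\<^sup>2 * (\<alpha> x + \<beta> x) - f x)" for x
  proof -
    have "?k * w' x = (?k * c\<^sup>2) * y x - ?k * (Q x * u x) - ?k * ((Q x)\<^sup>2 * y x - f x)"
      unfolding w'_def by (simp only: algebra_simps)
    then show ?thesis unfolding kc ab(1) by simp
  qed
  have A1: "AC_with_deriv \<alpha> (\<lambda>t. c * \<alpha> t + srcG ?k f \<alpha> \<beta> t)"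
  proof (rule AC_cong[OF AC_lincomb[OF ACy ACu, of "1/2" ?k]])
    fix x
    have "c * \<alpha> x + srcG ?k f \<alpha> \<beta> x = (1 / 2) * ((c * \<alpha> x - c * \<beta> x) + Q x * (\<alpha> x + \<beta> x)) +
       (c / 2 * (\<alpha> x + \<beta> x) - Q x * (\<alpha> x - \<beta> x) / 2 - ?k * ((Q x)\<^sup>2 * (\<alpha> x + \<beta> x) - f x))"
      unfolding srcG_def by (simp add: algebra_simps add_divide_distrib diff_divide_distrib)
    then show "c * \<alpha> x + srcG ?k f \<alpha> \<beta> x = 1 / 2 * (u x + Q x * y x) + ?k * w' x"
      unfolding w'k by (simp only: ab(1,2))
  qed (simp add: \<alpha>_def)
  have A2: "AC_with_deriv \<beta> (\<lambda>t. - c * \<beta> t + srcH ?k f \<alpha> \<beta> t)"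
  proof (rule AC_cong[OF AC_lincomb[OF ACy ACu, of "1/2" "- ?k"]])
    fix x
    have "- c * \<beta> x + srcH ?k f \<alpha> \<beta> x = (1 / 2) * ((c * \<alpha> x - c * \<beta> x) + Q x * (\<alpha> x + \<beta> x)) -
       (c / 2 * (\<alpha> x + \<beta> x) - Q x * (\<alpha> x - \<beta> x) / 2 - ?k * ((Q x)\<^sup>2 * (\<alpha> x + \<beta> x) - f x))"
      unfolding srcH_def by (simp add: algebra_simps add_divide_distrib diff_divide_distrib)
    then show "- c * \<beta> x + srcH ?k f \<alpha> \<beta> x = 1 / 2 * (u x + Q x * y x) + (- ?k) * w' x"
      unfolding minus_mult_left[symmetric] w'k by (simp only: ab(1,2) diff_conv_add_uminus)
  qed (simp add: \<beta>_def)
  have "bcond b \<alpha> \<beta>"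
    using bc by (cases b) (simp_all add: bcond_def \<alpha>_def \<beta>_def)
  then have "wave_sol b c f \<alpha> \<beta>" using A1 A2 by (simp add: wave_sol_def free_sol_def)
  then show ?thesis using that ab(1) out by blast
qed

text \<open>The equivalence expresses existence and uniqueness at once, so that the definite
  description in \<open>resolvent\<close> denotes. The bound is from L1 to the supremum, with the
  integral not divided by \<open>pi\<close>.\<close>

definition regular :: "complex \<Rightarrow> bc \<Rightarrow> real \<Rightarrow> complex \<Rightarrow> bool" where
  "regular v0 b B z \<longleftrightarrow> (\<forall>f. L2_on f \<longrightarrow>
     (\<forall>y. solves v0 Q b z f y \<longleftrightarrow> y = resolvent v0 Q b z f) \<and>
     (\<forall>x. cmod (resolvent v0 Q b z f x) \<le> B * integral {0..pi} (\<lambda>t. cmod (f t))))"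

lemma wave_sol_diff:
  assumes "wave_sol b c f \<alpha> \<beta>" "wave_sol b c f \<alpha>' \<beta>'"
  shows "wave_sol b c (\<lambda>_. 0) (\<lambda>t. \<alpha> t - \<alpha>' t) (\<lambda>t. \<beta> t - \<beta>' t)"
  using free_sol_diff[OF assms[unfolded wave_sol_def]] unfolding wave_sol_def
  by (rule free_sol_cong) (simp_all add: srcG_def srcH_def algebra_simps)

text \<open>\<open>v0\<close> and \<open>z\<close> enter the amplitude equations only through
  \<open>c\<close>, so one threshold serves all of them. The cap \<open>K\<close> is fixed
  beforehand because the admissible oscillation \<open>\<delta>\<close> depends on it.\<close>

theorem eventually_regular:
  assumes K: "K \<ge> 1" and \<tau>: "\<tau> > 0"
  obtains R where "\<And>v0 z c. c\<^sup>2 = v0 - z \<Longrightarrow> Re c \<le> 0 \<Longrightarrow> cmod c \<ge> R \<Longrightarrow> exp (2 * of_real pi * c) \<noteq> 1 \<Longrightarrow>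
     amp c \<le> K \<Longrightarrow> regular v0 b (amp c * (1 + \<tau>) / cmod c) z"
proof -
  \<comment> \<open>Chosen so that \<open>(1 + \<tau>) * (1 - \<eta>) = 1 + \<tau> / 2\<close>,
    which together with \<open>\<delta> \<le> \<tau> / 2\<close> turns the a priori factor into
    \<open>1 + \<tau>\<close>.\<close>
  define \<eta> where "\<eta> = \<tau> / (2 * (1 + \<tau>))"
  have \<eta>: "0 < \<eta>" "\<eta> < 1" "(1 + \<tau>) * (1 - \<eta>) = 1 + \<tau> / 2"
    using \<tau> by (simp_all add: \<eta>_def field_simps)
  define \<delta> where "\<delta> = Min {1, \<tau> / 2, \<eta> / (2 * K * potential_size), 1 / (12 * K\<^sup>2 * potential_size\<^sup>2)}"
  have pos: "2 * K * potential_size > 0" "12 * K\<^sup>2 * potential_size\<^sup>2 > 0" using K potential_size_ge_1 by (auto intro!: mult_pos_pos)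
  have \<delta>0: "0 < \<delta>" using \<tau> \<eta> pos by (simp add: \<delta>_def)
  have \<delta>_le: "\<delta> \<le> 1" "\<delta> \<le> \<tau> / 2" "\<delta> \<le> \<eta> / (2 * K * potential_size)" "\<delta> \<le> 1 / (12 * K\<^sup>2 * potential_size\<^sup>2)"
    by (simp_all add: \<delta>_def)
  have \<delta>: "2 * K * potential_size * \<delta> \<le> \<eta>" "12 * K\<^sup>2 * potential_size\<^sup>2 * \<delta> \<le> 1"
    using \<delta>_le(3,4) pos by (simp_all add: pos_le_divide_eq mult.commute)
  have fr: "(1 + \<delta>) / (1 - \<eta>) \<le> 1 + \<tau>"
    using \<eta> \<delta>_le(2) by (simp add: pos_divide_le_eq)
  obtain R1 where R1: "\<And>c x. Re c \<le> 0 \<Longrightarrow> cmod c \<ge> R1 \<Longrightarrow> x \<in> {0..pi} \<Longrightarrow> cmod (Vf c Q x) \<le> \<delta>"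
    "\<And>c x. Re c \<le> 0 \<Longrightarrow> cmod c \<ge> R1 \<Longrightarrow> x \<in> {0..pi} \<Longrightarrow> cmod (Vb c Q x) \<le> \<delta>"
    using riemann_lebesgue_uniform[OF Qi(1) \<delta>0] by metis
  define R where "R = max 1 (max R1 (1 / \<delta>))"
  have "regular v0 b (amp c * (1 + \<tau>) / cmod c) z"
    if c2: "c\<^sup>2 = v0 - z" and c: "Re c \<le> 0" "exp (2 * of_real pi * c) \<noteq> 1" and R: "cmod c \<ge> R" and a: "amp c \<le> K" for v0 z c
  proof -
    have R': "cmod c \<ge> 1" "cmod c \<ge> R1" "cmod c \<ge> 1 / \<delta>" using R by (auto simp: R_def)
    have c0: "c \<noteq> 0" using R'(1) by auto
    have os: "osc_small c \<delta>"
      unfolding osc_small_def using R'(1,2) c by (auto intro!: R1 simp: norm_mult)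
    have k: "cmod (1 / (2 * c)) \<le> \<delta>"
    proof -
      have "1 \<le> \<delta> * cmod c" using R'(3) \<delta>0 by (simp add: pos_divide_le_eq mult.commute)
      also have "\<dots> \<le> \<delta> * (2 * cmod c)" using \<delta>0 by (intro mult_left_mono) auto
      finally show ?thesis using c0 by (simp add: norm_divide norm_mult pos_divide_le_eq)
    qed
    show ?thesis
      unfolding regular_def
    proof (intro allI impI conjI)
      fix f assume f: "L2_on f"
      note fi = L2_on_imp_absolutely_integrable(1)[OF f]
      let ?F = "integral {0..pi} (\<lambda>t. cmod (f t))"
      have F0: "?F \<ge> 0" by (rule HK_nonneg[OF abs_integrableD(2)[OF fi]]) simp
      obtain \<alpha> \<beta> where ab: "wave_sol b c f \<alpha> \<beta>"
        using wave_sol_exists[OF fi c a os k \<delta>0 \<delta>_le(1) \<delta>(2)] .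
      define y where "y = (\<lambda>x. if x \<in> {0..pi} then \<alpha> x + \<beta> x else 0)"
      have sy: "solves v0 Q b z f y"
        unfolding y_def by (rule wave_sol_imp_solves[OF ab f c2 c0])
      have uniq: "y' = y" if sy': "solves v0 Q b z f y'" for y'
      proof
        fix x
        obtain \<alpha>' \<beta>' where ab': "wave_sol b c f \<alpha>' \<beta>'" "\<And>x. x \<in> {0..pi} \<Longrightarrow> y' x = \<alpha>' x + \<beta>' x"
          "\<And>x. x \<notin> {0..pi} \<Longrightarrow> y' x = 0"
          using solves_imp_wave_sol[OF sy' c2 c0] by metis
        show "y' x = y x"
        proof (cases "x \<in> {0..pi}")
          case True
          \<comment> \<open>The difference of two solutions has datum 0, for which the a priori
            bound is 0.\<close>
          have "cmod (\<alpha>' x - \<alpha> x) \<le> 0" "cmod (\<beta>' x - \<beta> x) \<le> 0"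
            using wave_sol_apriori[OF wave_sol_diff[OF ab'(1) ab] _ c a os k \<delta>0 \<delta>_le(1) \<delta>(1) \<eta>(2) True]
            by simp_all
          then show ?thesis using True by (simp add: y_def ab'(2))
        qed (auto simp: y_def ab'(3))
      qed
      have ry: "resolvent v0 Q b z f = y"
        unfolding resolvent_def using sy uniq by (rule the_equality)
      show "solves v0 Q b z f y' \<longleftrightarrow> y' = resolvent v0 Q b z f" for y'
        unfolding ry using sy uniq by blast
      fix x
      have B0: "0 \<le> amp c * (1 + \<tau>) / cmod c * ?F"
        using F0 \<tau> amp_ge_1[of c] by simp
      show "cmod (resolvent v0 Q b z f x) \<le> amp c * (1 + \<tau>) / cmod c * ?F"
      proof (cases "x \<in> {0..pi}")
        case True
        let ?b = "amp c * cmod (1 / (2 * c)) * ((1 + \<delta>) / (1 - \<eta>)) * ?F"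
        let ?b' = "amp c * cmod (1 / (2 * c)) * (1 + \<tau>) * ?F"
        have 1: "cmod (\<alpha> x) \<le> ?b" "cmod (\<beta> x) \<le> ?b"
          using wave_sol_apriori[OF ab fi c a os k \<delta>0 \<delta>_le(1) \<delta>(1) \<eta>(2) True] by simp_all
        have 2: "?b \<le> ?b'"
          using fr amp_ge_1[of c] F0 by (intro mult_right_mono mult_left_mono) auto
        have "cmod (\<alpha> x) + cmod (\<beta> x) \<le> ?b' + ?b'"
          by (intro add_mono order_trans[OF 1(1) 2] order_trans[OF 1(2) 2])
        also have "\<dots> = amp c * (1 + \<tau>) / cmod c * ?F"
          using c0 by (simp add: norm_divide norm_mult field_simps)
        finally have "cmod (\<alpha> x) + cmod (\<beta> x) \<le> amp c * (1 + \<tau>) / cmod c * ?F" .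
        then show ?thesis
          using True norm_triangle_ineq[of "\<alpha> x" "\<beta> x"] by (simp add: ry y_def)
      qed (use B0 in \<open>auto simp: ry y_def\<close>)
    qed
  qed
  then show ?thesis using that by blast
qed

end

subsection \<open>Calculus of Riesz projections\<close>

lemma mult_half_divide: "x > 0 \<Longrightarrow> x * (e / (2 * x)) = e / (2 :: real)"
  by simp

text \<open>The difference of the two sides, as a function of the upper limit, has derivative zero;
  this replaces an integral with values in a function space.\<close>
lemma bounded_functional_integral:
  fixes \<Phi> :: "(real \<Rightarrow> complex) \<Rightarrow> complex" and k :: "real \<Rightarrow> real \<Rightarrow> complex"
  assumes lin: "\<And>f g a. continuous_on {0..pi} f \<Longrightarrow> continuous_on {0..pi} g \<Longrightarrow>
      \<Phi> (\<lambda>x. f x + a * g x) = \<Phi> f + a * \<Phi> g"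
    and bnd: "\<And>f M. continuous_on {0..pi} f \<Longrightarrow> (\<forall>x\<in>{0..pi}. cmod (f x) \<le> M) \<Longrightarrow> cmod (\<Phi> f) \<le> C * M"
    and k: "continuous_on ({0..1} \<times> {0..pi}) (\<lambda>(t, x). k t x)"
  shows "continuous_on {0..1} (\<lambda>t. \<Phi> (k t))"
    and "continuous_on {0..pi} (\<lambda>x. integral {0..1} (\<lambda>t. k t x))"
    and "\<Phi> (\<lambda>x. integral {0..1} (\<lambda>t. k t x)) = integral {0..1} (\<lambda>t. \<Phi> (k t))"
proof -
  have kx: "continuous_on {0..pi} (k t)" if "t \<in> {0..1}" for t
  proof -
    have "continuous_on {0..pi} (\<lambda>x. case (t, x) of (t, x) \<Rightarrow> k t x)"
      by (rule continuous_on_compose2[OF k]) (use that in \<open>auto intro!: continuous_intros\<close>)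
    then show ?thesis by simp
  qed
  have kt: "continuous_on {0..1} (\<lambda>t. k t x)" if "x \<in> {0..pi}" for x
  proof -
    have "continuous_on {0..1} (\<lambda>t. case (t, x) of (t, x) \<Rightarrow> k t x)"
      by (rule continuous_on_compose2[OF k]) (use that in \<open>auto intro!: continuous_intros\<close>)
    then show ?thesis by simp
  qed
  have C0: "C \<ge> 0"
    using bnd[of "\<lambda>_. 0" 1] norm_ge_zero[of "\<Phi> (\<lambda>_. 0)"] by (simp del: norm_ge_zero)
  have "uniformly_continuous_on ({0..1} \<times> {0..pi}) (\<lambda>(t, x). k t x)"
    by (rule compact_uniformly_continuous[OF k]) (intro compact_Times; simp)
  then have unif: "\<exists>d>0. \<forall>s\<in>{0..1}. \<forall>t\<in>{0..1}. \<bar>s - t\<bar> < d \<longrightarrow> (\<forall>x\<in>{0..pi}. cmod (k s x - k t x) \<le> e)" if e: "e > 0" for e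
  proof -
    obtain d where d: "d > 0" "\<And>u v. u \<in> {0..1} \<times> {0..pi} \<Longrightarrow> v \<in> {0..1} \<times> {0..pi} \<Longrightarrow> dist v u < d \<Longrightarrow>
        dist (case v of (t, x) \<Rightarrow> k t x) (case u of (t, x) \<Rightarrow> k t x) < e"
      using \<open>uniformly_continuous_on _ _\<close> e unfolding uniformly_continuous_on_def by meson
    have "cmod (k s x - k t x) \<le> e" if "s \<in> {0..1}" "t \<in> {0..1}" "\<bar>s - t\<bar> < d" "x \<in> {0..pi}" for s t x
      using d(2)[of "(t, x)" "(s, x)"] that by (simp add: dist_Pair_Pair dist_norm)
    then show ?thesis using d(1) by blast
  qed
  have \<Phi>diff: "cmod (\<Phi> f - \<Phi> g) \<le> C * e"
    if "continuous_on {0..pi} f" "continuous_on {0..pi} g" "\<forall>x\<in>{0..pi}. cmod (f x - g x) \<le> e" for f g e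
  proof -
    have "\<Phi> (\<lambda>x. f x + (-1) * g x) = \<Phi> f + (-1) * \<Phi> g" by (rule lin[OF that(1,2)])
    moreover have "cmod (\<Phi> (\<lambda>x. f x + (-1) * g x)) \<le> C * e"
      by (intro bnd continuous_intros that) (use that in auto)
    ultimately show ?thesis by simp
  qed
  show \<Phi>c: "continuous_on {0..1} (\<lambda>t. \<Phi> (k t))"
    unfolding continuous_on_iff
  proof (intro ballI allI impI)
    fix t e :: real assume t: "t \<in> {0..1}" and e: "0 < e"
    have "e / (2 * (C + 1)) > 0" using e C0 by simp
    then obtain d where d: "d > 0" "\<And>s t x. s \<in> {0..1} \<Longrightarrow> t \<in> {0..1} \<Longrightarrow> \<bar>s - t\<bar> < d \<Longrightarrow> x \<in> {0..pi} \<Longrightarrow>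
        cmod (k s x - k t x) \<le> e / (2 * (C + 1))"
      using unif by meson
    have "dist (\<Phi> (k s)) (\<Phi> (k t)) < e" if s: "s \<in> {0..1}" "dist s t < d" for s
    proof -
      have "cmod (\<Phi> (k s) - \<Phi> (k t)) \<le> C * (e / (2 * (C + 1)))"
        using s t d(2) by (intro \<Phi>diff kx) (auto simp: dist_real_def)
      also have "\<dots> \<le> (C + 1) * (e / (2 * (C + 1)))" using e C0 by (intro mult_right_mono) auto
      also have "\<dots> = e / 2" using C0 by (intro mult_half_divide) simp
      also have "\<dots> < e" using e by simp
      finally show ?thesis by (simp add: dist_norm)
    qed
    then show "\<exists>d>0. \<forall>s\<in>{0..1}. dist s t < d \<longrightarrow> dist (\<Phi> (k s)) (\<Phi> (k t)) < e" using d(1) by blast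
  qed
  define J where "J s = (\<lambda>x. integral {0..s} (\<lambda>t. k t x))" for s
  have Jc': "continuous_on {0..pi} (\<lambda>x. integral {a..b} (\<lambda>t. k t x))" if "{a..b} \<subseteq> {0..1}" for a b
  proof -
    have "continuous_on ({0..pi} \<times> cbox a b) (\<lambda>p. case (snd p, fst p) of (t, x) \<Rightarrow> k t x)"
      by (rule continuous_on_compose2[OF k]) (use that in \<open>auto intro!: continuous_intros\<close>)
    then have "continuous_on ({0..pi} \<times> cbox a b) (\<lambda>(x, t). k t x)"
      by (simp add: case_prod_unfold)
    from integral_continuous_on_param[OF this] show ?thesis by simp
  qed
  show "continuous_on {0..pi} (\<lambda>x. integral {0..1} (\<lambda>t. k t x))" by (rule Jc') simp
  define H where "H s = \<Phi> (J s) - integral {0..s} (\<lambda>t. \<Phi> (k t))" for s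
  \<comment> \<open>Both parts of the increment of \<open>H\<close> are compared with
    \<open>(s' - s) * \<Phi> (k r)\<close> for one frozen \<open>r\<close>. Each is off by at most
    \<open>C * e * (s' - s)\<close>, so uniform continuity of \<open>k\<close> makes the derivative
    of \<open>H\<close> vanish.\<close>
  have est: "cmod (H s' - H s) \<le> 2 * C * e * (s' - s)"
    if s: "0 \<le> s" "s \<le> s'" "s' \<le> 1" and e: "\<And>t x. t \<in> {s..s'} \<Longrightarrow> x \<in> {0..pi} \<Longrightarrow> cmod (k t x - k r x) \<le> e"
      and r: "r \<in> {s..s'}" for s s' e r
  proof -
    have sub: "{s..s'} \<subseteq> {0..1}" using s by auto
    have r01: "r \<in> {0..1}" using r sub by auto
    have "J s' x = J s x + 1 * integral {s..s'} (\<lambda>t. k t x)" if "x \<in> {0..pi}" for x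
    proof -
      have "(\<lambda>t. k t x) integrable_on {0..s'}"
        using s by (intro integrable_continuous_real continuous_on_subset[OF kt[OF that]]) auto
      then show ?thesis
        using s Henstock_Kurzweil_Integration.integral_combine[of 0 s s' "\<lambda>t. k t x"] by (simp add: J_def)
    qed
    \<comment> \<open>The two arguments agree only on \<open>{0..pi}\<close>; the bound with 0 shows
      that \<Phi> does not see other points.\<close>
    then have "cmod (\<Phi> (J s') - \<Phi> (\<lambda>x. J s x + 1 * integral {s..s'} (\<lambda>t. k t x))) \<le> C * 0"
      unfolding J_def by (intro \<Phi>diff continuous_intros Jc') (use s in auto)
    then have J1: "\<Phi> (J s') = \<Phi> (J s) + \<Phi> (\<lambda>x. integral {s..s'} (\<lambda>t. k t x))"
      unfolding J_def using lin[OF Jc' Jc', of 0 s s s' 1] s by auto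
    have "cmod (integral {s..s'} (\<lambda>t. k t x) - of_real (s' - s) * k r x) \<le> e * (s' - s)" if x: "x \<in> {0..pi}" for x
    proof -
      have ki: "(\<lambda>t. k t x) integrable_on {s..s'}"
        using sub by (intro integrable_continuous_real continuous_on_subset[OF kt[OF x]]) auto
      have "integral {s..s'} (\<lambda>t. k t x) - of_real (s' - s) * k r x = integral {s..s'} (\<lambda>t. k t x - k r x)"
        using s by (subst Henstock_Kurzweil_Integration.integral_diff[OF ki]) (auto simp: scaleR_conv_of_real)
      also have "cmod \<dots> \<le> integral {s..s'} (\<lambda>t. e)"
        using e x by (intro HK_norm_bound integrable_diff ki) auto
      finally show ?thesis using s by (simp add: mult.commute)
    qed
    then have "cmod (\<Phi> (\<lambda>x. integral {s..s'} (\<lambda>t. k t x)) - \<Phi> (\<lambda>x. of_real (s' - s) * k r x)) \<le> C * (e * (s' - s))"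
      using sub r01 by (intro \<Phi>diff continuous_intros Jc' kx) auto
    moreover have "\<Phi> (\<lambda>x. of_real (s' - s) * k r x) = of_real (s' - s) * \<Phi> (k r)"
    proof -
      have "\<Phi> (\<lambda>x. 0 + of_real (s' - s) * k r x) = \<Phi> (\<lambda>_. 0) + of_real (s' - s) * \<Phi> (k r)"
        by (rule lin[OF _ kx[OF r01]]) simp
      moreover have "\<Phi> (\<lambda>_. 0) = 0" using bnd[of "\<lambda>_. 0" 0] by simp
      ultimately show ?thesis by simp
    qed
    ultimately have P1: "cmod (\<Phi> (\<lambda>x. integral {s..s'} (\<lambda>t. k t x)) - of_real (s' - s) * \<Phi> (k r)) \<le> C * (e * (s' - s))"
      by simp
    have pi1: "(\<lambda>t. \<Phi> (k t)) integrable_on {s..s'}"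
      using sub by (intro integrable_continuous_real continuous_on_subset[OF \<Phi>c]) auto
    have P2: "cmod (integral {s..s'} (\<lambda>t. \<Phi> (k t)) - of_real (s' - s) * \<Phi> (k r)) \<le> C * e * (s' - s)"
    proof -
      have "integral {s..s'} (\<lambda>t. \<Phi> (k t)) - of_real (s' - s) * \<Phi> (k r) = integral {s..s'} (\<lambda>t. \<Phi> (k t) - \<Phi> (k r))"
        using s by (subst Henstock_Kurzweil_Integration.integral_diff[OF pi1]) (auto simp: scaleR_conv_of_real)
      also have "cmod \<dots> \<le> integral {s..s'} (\<lambda>t. C * e)"
        using e sub r01 by (intro HK_norm_bound integrable_diff pi1 \<Phi>diff kx) auto
      finally show ?thesis using s by (simp add: mult_ac)
    qed
    have "(\<lambda>t. \<Phi> (k t)) integrable_on {0..s'}"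
      using s by (intro integrable_continuous_real continuous_on_subset[OF \<Phi>c]) auto
    then have "integral {0..s} (\<lambda>t. \<Phi> (k t)) + integral {s..s'} (\<lambda>t. \<Phi> (k t)) = integral {0..s'} (\<lambda>t. \<Phi> (k t))"
      using s by (intro Henstock_Kurzweil_Integration.integral_combine) auto
    then have "H s' - H s = (\<Phi> (\<lambda>x. integral {s..s'} (\<lambda>t. k t x)) - of_real (s' - s) * \<Phi> (k r))
       - (integral {s..s'} (\<lambda>t. \<Phi> (k t)) - of_real (s' - s) * \<Phi> (k r))"
      by (simp add: H_def J1 algebra_simps)
    then have "cmod (H s' - H s) \<le> C * (e * (s' - s)) + C * e * (s' - s)"
      using P1 P2 norm_triangle_le_diff by (metis add_mono)
    then show ?thesis by (simp add: algebra_simps)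
  qed
  have "(H has_derivative (\<lambda>h. 0)) (at s within {0..1})" if s: "s \<in> {0..1}" for s
    unfolding has_derivative_within_alt
  proof (intro conjI allI impI)
    fix e :: real assume e: "e > 0"
    have "e / (2 * (C + 1)) > 0" using e C0 by simp
    then obtain d where d: "d > 0" "\<And>s t x. s \<in> {0..1} \<Longrightarrow> t \<in> {0..1} \<Longrightarrow> \<bar>s - t\<bar> < d \<Longrightarrow> x \<in> {0..pi} \<Longrightarrow>
        cmod (k s x - k t x) \<le> e / (2 * (C + 1))"
      using unif by meson
    have "2 * C * (e / (2 * (C + 1))) \<le> 2 * (C + 1) * (e / (2 * (C + 1)))" using e C0 by (intro mult_right_mono) auto
    also have "\<dots> = e" using C0 mult_half_divide[of "C + 1" e] by simp
    finally have Ce: "2 * C * (e / (2 * (C + 1))) \<le> e" .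
    have "norm (H y - H s - 0) \<le> e * norm (y - s)" if y: "y \<in> {0..1}" "norm (y - s) < d" for y
    proof -
      have "cmod (H (max y s) - H (min y s)) \<le> 2 * C * (e / (2 * (C + 1))) * (max y s - min y s)"
      proof (rule est[where r = s])
        show "cmod (k t x - k s x) \<le> e / (2 * (C + 1))" if "t \<in> {min y s..max y s}" "x \<in> {0..pi}" for t x
          using that s y by (intro d(2)) auto
      qed (use s y in auto)
      also have "\<dots> \<le> e * (max y s - min y s)" by (intro mult_right_mono Ce) auto
      finally show ?thesis
        by (cases "y \<le> s") (auto simp: max_def min_def norm_minus_commute abs_if)
    qed
    then show "\<exists>d>0. \<forall>y\<in>{0..1}. norm (y - s) < d \<longrightarrow> norm (H y - H s - 0) \<le> e * norm (y - s)"
      using d(1) by blast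
  qed simp
  then obtain c where "\<And>s. s \<in> {0..1} \<Longrightarrow> H s = c"
    using has_derivative_zero_constant[of "{0..1}" H] by auto
  then have "H 1 = H 0" by simp
  moreover have "H 0 = 0"
    using bnd[of "J 0" 0] by (simp add: H_def J_def)
  ultimately show "\<Phi> (\<lambda>x. integral {0..1} (\<lambda>t. k t x)) = integral {0..1} (\<lambda>t. \<Phi> (k t))"
    by (simp add: H_def J_def)
qed

section \<open>Algebra and regularity of the resolvent\<close>

lemma solves_continuous: "solves v0 Q b z f y \<Longrightarrow> continuous_on {0..pi} y"
  unfolding solves_def dom_rep_def using AC_continuous by blast

lemma solves_lincomb:
  assumes "solves v0 Q b z f y" "solves v0 Q b z g y'"
  shows "solves v0 Q b z (\<lambda>x. f x + a * g x) (\<lambda>x. y x + a * y' x)"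
proof -
  let ?l = "\<lambda>y u w t. - w t - Q t * u t - (Q t)\<^sup>2 * y t + v0 * y t"
  obtain u w where d: "dom_rep v0 Q b y u w" and n: "negligible {x\<in>{0..pi}. z * y x - ?l y u w x \<noteq> f x}"
    using assms(1) unfolding solves_def by blast
  obtain u' w' where d': "dom_rep v0 Q b y' u' w'" and n': "negligible {x\<in>{0..pi}. z * y' x - ?l y' u' w' x \<noteq> g x}"
    using assms(2) unfolding solves_def by blast
  let ?y = "\<lambda>x. y x + a * y' x" and ?u = "\<lambda>x. u x + a * u' x" and ?w = "\<lambda>x. w x + a * w' x"
  have l: "?l ?y ?u ?w t = ?l y u w t + a * ?l y' u' w' t" for t by (simp add: algebra_simps)
  have AC: "AC_with_deriv y (\<lambda>t. u t + Q t * y t)" "AC_with_deriv u w" "L2_on (?l y u w)"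
    "AC_with_deriv y' (\<lambda>t. u' t + Q t * y' t)" "AC_with_deriv u' w'" "L2_on (?l y' u' w')"
    using d d' unfolding dom_rep_def by blast+
  have "AC_with_deriv ?y (\<lambda>t. ?u t + Q t * ?y t)"
    by (rule AC_cong[OF AC_lincomb[OF AC(1,4), of 1 a]]) (auto simp: algebra_simps)
  moreover have "AC_with_deriv ?u ?w"
    by (rule AC_cong[OF AC_lincomb[OF AC(2,5), of 1 a]]) auto
  moreover have "L2_on (?l ?y ?u ?w)"
    unfolding l by (rule L2_on_add_scaled[OF AC(3,6)])
  moreover have "\<forall>x. x \<notin> {0..pi} \<longrightarrow> ?y x = 0" using d d' unfolding dom_rep_def by simp
  moreover have "case b of PerP \<Rightarrow> ?y pi = ?y 0 \<and> ?u pi = ?u 0 | PerM \<Rightarrow> ?y pi = - ?y 0 \<and> ?u pi = - ?u 0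
        | Dir \<Rightarrow> ?y 0 = 0 \<and> ?y pi = 0"
    using d d' unfolding dom_rep_def by (cases b) simp_all
  ultimately have "dom_rep v0 Q b ?y ?u ?w" unfolding dom_rep_def by blast
  moreover have "negligible {x\<in>{0..pi}. z * ?y x - ?l ?y ?u ?w x \<noteq> f x + a * g x}"
  proof (rule negligible_subset[OF negligible_Un[OF n n']], rule subsetI, rule ccontr)
    fix x assume x: "x \<in> {x\<in>{0..pi}. z * ?y x - ?l ?y ?u ?w x \<noteq> f x + a * g x}"
      "x \<notin> {x\<in>{0..pi}. z * y x - ?l y u w x \<noteq> f x} \<union> {x\<in>{0..pi}. z * y' x - ?l y' u' w' x \<noteq> g x}"
    then have e: "z * y x - ?l y u w x = f x" "z * y' x - ?l y' u' w' x = g x" by auto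
    have "z * ?y x - ?l ?y ?u ?w x = (z * y x - ?l y u w x) + a * (z * y' x - ?l y' u' w' x)"
      unfolding l by (simp only: algebra_simps)
    then show False using x(1) unfolding e by simp
  qed
  ultimately show ?thesis unfolding solves_def by blast
qed

lemma solves_shift:
  assumes "solves v0 Q b w g y"
  shows "solves v0 Q b z (\<lambda>x. g x + (z - w) * y x) y"
proof -
  obtain u w' where d: "dom_rep v0 Q b y u w'"
    and n: "negligible {x\<in>{0..pi}. w * y x - (- w' x - Q x * u x - (Q x)\<^sup>2 * y x + v0 * y x) \<noteq> g x}"
    using assms unfolding solves_def by blast
  have eq: "{x\<in>{0..pi}. z * y x - (- w' x - Q x * u x - (Q x)\<^sup>2 * y x + v0 * y x) \<noteq> g x + (z - w) * y x} =
     {x\<in>{0..pi}. w * y x - (- w' x - Q x * u x - (Q x)\<^sup>2 * y x + v0 * y x) \<noteq> g x}"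
    by (auto simp: algebra_simps)
  have "negligible {x\<in>{0..pi}. z * y x - (- w' x - Q x * u x - (Q x)\<^sup>2 * y x + v0 * y x) \<noteq> g x + (z - w) * y x}"
    unfolding eq by (rule n)
  then show ?thesis using d unfolding solves_def by blast
qed

text \<open>\<open>S\<close> collects spectral parameters with a common bound \<open>B\<close>. That
  bound serves continuity and the exchange of integrals; the sharper bound behind the final
  constants is supplied separately on a circle.\<close>

locale regular_region = potential Q for Q :: "real \<Rightarrow> complex" +
  fixes v0 :: complex and b :: bc and B :: real and S :: "complex set"
  assumes reg: "\<And>z. z \<in> S \<Longrightarrow> regular v0 b B z" and B_nonneg: "B \<ge> 0"
begin

abbreviation R where "R \<equiv> resolvent v0 Q b"

lemma R_solves: "z \<in> S \<Longrightarrow> L2_on f \<Longrightarrow> solves v0 Q b z f (R z f)"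
  using reg unfolding regular_def by blast

lemma R_unique: "z \<in> S \<Longrightarrow> L2_on f \<Longrightarrow> solves v0 Q b z f y \<Longrightarrow> y = R z f"
  using reg unfolding regular_def by blast

lemma R_bound: "z \<in> S \<Longrightarrow> L2_on f \<Longrightarrow> cmod (R z f x) \<le> B * integral {0..pi} (\<lambda>t. cmod (f t))"
  using reg unfolding regular_def by blast

lemma R_continuous: "z \<in> S \<Longrightarrow> L2_on f \<Longrightarrow> continuous_on {0..pi} (R z f)"
  using R_solves solves_continuous by blast

lemma R_L2: "z \<in> S \<Longrightarrow> L2_on f \<Longrightarrow> L2_on (R z f)"
  using R_continuous L2_on_continuous by blast

lemma R_lincomb: "z \<in> S \<Longrightarrow> L2_on f \<Longrightarrow> L2_on g \<Longrightarrow> R z (\<lambda>x. f x + a * g x) = (\<lambda>x. R z f x + a * R z g x)"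
  by (rule R_unique[symmetric]) (assumption | rule L2_on_add_scaled solves_lincomb R_solves)+

lemma R_scaled: "z \<in> S \<Longrightarrow> L2_on f \<Longrightarrow> R z (\<lambda>x. a * f x) = (\<lambda>x. a * R z f x)"
proof -
  assume z: "z \<in> S" and f: "L2_on f"
  have "R z (\<lambda>x. f x + (a - 1) * f x) = (\<lambda>x. R z f x + (a - 1) * R z f x)"
    by (rule R_lincomb[OF z f f])
  then show ?thesis by (simp add: algebra_simps)
qed

lemma R_bound_sup:
  assumes "z \<in> S" "continuous_on {0..pi} f" "\<forall>x\<in>{0..pi}. cmod (f x) \<le> M"
  shows "cmod (R z f x) \<le> (B * pi) * M"
proof -
  have "integral {0..pi} (\<lambda>t. cmod (f t)) \<le> integral {0..pi} (\<lambda>t. M)"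
    using assms by (intro integral_le integrable_continuous_real continuous_intros) auto
  then have "B * integral {0..pi} (\<lambda>t. cmod (f t)) \<le> B * (pi * M)"
    using B_nonneg by (intro mult_left_mono) auto
  then show ?thesis using R_bound[OF assms(1) L2_on_continuous[OF assms(2)], of x] by (simp add: mult.assoc)
qed

text \<open>A consequence of uniqueness: splitting \<open>z - L\<close> into \<open>w - L\<close>
  and \<open>z - w\<close> shows that \<open>R w g\<close> solves the equation at \<open>z\<close>
  with source \<open>g + (z - w) * R w g\<close>.\<close>

lemma resolvent_identity:
  assumes "z \<in> S" "w \<in> S" "L2_on g"
  shows "R w g x - R z g x = (z - w) * R z (R w g) x"
proof -
  have "R w g = R z (\<lambda>x. g x + (z - w) * R w g x)"
    by (intro R_unique solves_shift R_solves L2_on_add_scaled R_L2 assms)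
  also have "\<dots> = (\<lambda>x. R z g x + (z - w) * R z (R w g) x)"
    by (intro R_lincomb R_L2 assms)
  finally show ?thesis by (metis add_diff_cancel_left')
qed

lemma R_lipschitz:
  assumes "z \<in> S" "w \<in> S" "L2_on g"
  shows "cmod (R w g x - R z g x) \<le> cmod (w - z) * (B * pi * (B * integral {0..pi} (\<lambda>t. cmod (g t))))"
  unfolding resolvent_identity[OF assms] norm_mult norm_minus_commute[of z w]
  by (intro mult_left_mono R_bound_sup R_continuous assms) (auto intro!: R_bound assms)

lemma R_continuous_on_param: "L2_on g \<Longrightarrow> continuous_on S (\<lambda>z. R z g x)"
  unfolding continuous_on_iff
proof (intro ballI allI impI)
  fix z and e :: real assume g: "L2_on g" and z: "z \<in> S" and e: "e > 0"
  define L where "L = B * pi * (B * integral {0..pi} (\<lambda>t. cmod (g t)))"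
  have L: "L \<ge> 0" unfolding L_def
    using B_nonneg HK_nonneg[OF abs_integrableD(2)[OF L2_on_imp_absolutely_integrable(1)[OF g]]]
    by simp
  have "dist (R w g x) (R z g x) < e" if "w \<in> S" "dist w z < e / (L + 1)" for w
  proof -
    have "cmod (R w g x - R z g x) \<le> cmod (w - z) * L" unfolding L_def by (rule R_lipschitz[OF z that(1) g])
    also have "\<dots> \<le> cmod (w - z) * (L + 1)" by (intro mult_left_mono) auto
    also have "\<dots> < e" using that(2) L by (simp add: dist_norm pos_less_divide_eq)
    finally show ?thesis by (simp add: dist_norm)
  qed
  then show "\<exists>d>0. \<forall>w\<in>S. dist w z < d \<longrightarrow> dist (R w g x) (R z g x) < e"
    using e L by (intro exI[of _ "e / (L + 1)"]) auto
qed

lemma R_jointly_continuous: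
  assumes g: "L2_on g"
  shows "continuous_on (S \<times> {0..pi}) (\<lambda>(z, x). R z g x)"
  unfolding continuous_on_iff
proof (intro ballI allI impI)
  fix p and e :: real assume p: "p \<in> S \<times> {0..pi}" and e: "e > 0"
  obtain z x where p': "p = (z, x)" by (cases p)
  then have z: "z \<in> S" and x: "x \<in> {0..pi}" using p by auto
  define L where "L = B * pi * (B * integral {0..pi} (\<lambda>t. cmod (g t)))"
  have L: "L \<ge> 0" unfolding L_def
    using B_nonneg HK_nonneg[OF abs_integrableD(2)[OF L2_on_imp_absolutely_integrable(1)[OF g]]]
    by simp
  obtain d where d: "d > 0" "\<And>x'. x' \<in> {0..pi} \<Longrightarrow> dist x' x < d \<Longrightarrow> dist (R z g x') (R z g x) < e / 2"
    using R_continuous[OF z g] x e unfolding continuous_on_iff by (metis half_gt_zero)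
  have "dist (R z' g x') (R z g x) < e" if "z' \<in> S" "x' \<in> {0..pi}" "dist (z', x') (z, x) < min d (e / (2 * (L + 1)))" for z' x'
  proof -
    have dz: "dist z' z < e / (2 * (L + 1))" and dx: "dist x' x < d"
      using that(3) dist_fst_le[of "(z', x')" "(z, x)"] dist_snd_le[of "(z', x')" "(z, x)"] by auto
    have "cmod (R z' g x' - R z g x') \<le> cmod (z' - z) * L" unfolding L_def by (rule R_lipschitz[OF z that(1) g])
    also have "\<dots> \<le> (e / (2 * (L + 1))) * (L + 1)" using dz L e by (intro mult_mono) (auto simp: dist_norm)
    also have "\<dots> = e / 2" using L mult_half_divide[of "L + 1" e] by (simp add: mult.commute)
    finally have "dist (R z' g x') (R z g x') \<le> e / 2" by (simp add: dist_norm)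
    then show ?thesis using d(2)[OF that(2) dx] dist_triangle[of "R z' g x'" "R z g x" "R z g x'"] by linarith
  qed
  then show "\<exists>d>0. \<forall>q\<in>S \<times> {0..pi}. dist q p < d \<longrightarrow> dist (case q of (z, x) \<Rightarrow> R z g x) (case p of (z, x) \<Rightarrow> R z g x) < e"
    using d(1) e L unfolding p' by (intro exI[of _ "min d (e / (2 * (L + 1)))"]) auto
qed

text \<open>By the resolvent identity the difference quotient at \<open>w\<close> is
  \<open>- R z (R w g) x\<close>, which is continuous in \<open>z\<close>.\<close>

lemma R_holomorphic:
  assumes "open S" "L2_on g"
  shows "(\<lambda>z. R z g x) holomorphic_on S"
  unfolding holomorphic_on_open[OF assms(1)]
proof
  fix w assume w: "w \<in> S"
  have "((\<lambda>z. - R z (R w g) x) \<longlongrightarrow> - R w (R w g) x) (at w)"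
    using R_continuous_on_param[OF R_L2[OF w assms(2)], of x] w assms(1)
    by (intro tendsto_minus) (simp add: continuous_on_eq_continuous_at isCont_def)
  moreover have "\<forall>\<^sub>F z in at w. - R z (R w g) x = (R z g x - R w g x) / (z - w)"
    using eventually_at_in_open[OF assms(1) w]
  proof eventually_elim
    case (elim z)
    then have "R w g x - R z g x = (z - w) * R z (R w g) x"
      using resolvent_identity[OF _ w assms(2)] by auto
    then have "R z g x - R w g x = (z - w) * - R z (R w g) x" by (simp add: algebra_simps)
    then show ?case using elim by simp
  qed
  ultimately have "((\<lambda>z. (R z g x - R w g x) / (z - w)) \<longlongrightarrow> - R w (R w g) x) (at w)"
    by (rule Lim_transform_eventually)
  then show "\<exists>f'. ((\<lambda>z. R z g x) has_field_derivative f') (at w)"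
    unfolding has_field_derivative_iff by blast
qed

end

section \<open>Contour integrals of the resolvent\<close>

text \<open>Beyond \<open>valid_path\<close>, the derivative is continuous on the whole parameter
  interval. The exchange of integrals uses this, so the rectangle is treated one side at a
  time.\<close>

definition C1_path :: "(real \<Rightarrow> complex) \<Rightarrow> bool" where
  "C1_path \<gamma> \<longleftrightarrow> valid_path \<gamma> \<and> continuous_on {0..1} (\<lambda>t. vector_derivative \<gamma> (at t))"

lemma C1_path_linepath: "C1_path (linepath a b)"
  by (simp add: C1_path_def)

lemma C1_path_circlepath: "C1_path (circlepath z r)"
  by (simp add: C1_path_def vector_derivative_circlepath) (intro continuous_intros)

lemma C1_path_continuous: "C1_path \<gamma> \<Longrightarrow> continuous_on {0..1} \<gamma>"
  using valid_path_imp_path by (auto simp: C1_path_def path_def)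

lemma contour_integrable_C1_path:
  assumes "C1_path \<gamma>" "continuous_on (path_image \<gamma>) h"
  shows "h contour_integrable_on \<gamma>"
  unfolding contour_integrable_on
proof (rule integrable_continuous_real, rule continuous_on_mult)
  show "continuous_on {0..1} (\<lambda>t. h (\<gamma> t))"
    by (rule continuous_on_compose2[OF assms(2) C1_path_continuous[OF assms(1)]]) (simp add: path_image_def)
  show "continuous_on {0..1} (\<lambda>t. vector_derivative \<gamma> (at t))"
    using assms(1) by (simp add: C1_path_def)
qed

context regular_region
begin

definition Rint :: "(real \<Rightarrow> complex) \<Rightarrow> (real \<Rightarrow> complex) \<Rightarrow> real \<Rightarrow> complex" where
  "Rint \<gamma> g x = contour_integral \<gamma> (\<lambda>w. R w g x)"

text \<open>For fixed \<open>x\<close> the map from \<open>f\<close> to \<open>R z f x\<close> is a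
  linear functional bounded in the supremum norm, so \<open>bounded_functional_integral\<close>
  moves it under the integral along \<open>\<gamma>\<close>.\<close>

lemma resolvent_Rint:
  assumes \<gamma>: "C1_path \<gamma>" "path_image \<gamma> \<subseteq> S" and z: "z \<in> S" and g: "L2_on g"
  shows "continuous_on {0..pi} (Rint \<gamma> g)"
    and "R z (Rint \<gamma> g) x = contour_integral \<gamma> (\<lambda>w. R z (R w g) x)"
proof -
  let ?k = "\<lambda>t x. vector_derivative \<gamma> (at t) * R (\<gamma> t) g x"
  have vd: "continuous_on {0..1} (\<lambda>t. vector_derivative \<gamma> (at t))" using \<gamma>(1) by (simp add: C1_path_def)
  have in_S: "\<gamma> t \<in> S" if "t \<in> {0..1}" for t using \<gamma>(2) that by (auto simp: path_image_def)
  have "continuous_on ({0..1} \<times> {0..pi}) (\<lambda>p. case (\<gamma> (fst p), snd p) of (z, x) \<Rightarrow> R z g x)"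
  proof (rule continuous_on_compose2[OF R_jointly_continuous[OF g]])
    show "continuous_on ({0..1} \<times> {0..pi}) (\<lambda>p. (\<gamma> (fst p), snd p))"
      by (intro continuous_intros continuous_on_compose2[OF C1_path_continuous[OF \<gamma>(1)]]) auto
    show "(\<lambda>p. (\<gamma> (fst p), snd p)) ` ({0..1} \<times> {0..pi}) \<subseteq> S \<times> {0..pi}" using in_S by auto
  qed
  moreover have "continuous_on ({0..1} \<times> {0..pi}) (\<lambda>p::real \<times> real. vector_derivative \<gamma> (at (fst p)))"
    by (rule continuous_on_compose2[OF vd]) (auto intro!: continuous_intros)
  ultimately have k: "continuous_on ({0..1} \<times> {0..pi}) (\<lambda>(t, x). ?k t x)"
    by (simp add: case_prod_unfold continuous_on_mult)
  have lin: "R z (\<lambda>x. f x + a * h x) x = R z f x + a * R z h x"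
    if "continuous_on {0..pi} f" "continuous_on {0..pi} h" for f h a
    unfolding R_lincomb[OF z L2_on_continuous[OF that(1)] L2_on_continuous[OF that(2)]] ..
  note bfi = bounded_functional_integral[of "\<lambda>f. R z f x" "B * pi" ?k, OF lin R_bound_sup[OF z] k]
  have J: "Rint \<gamma> g = (\<lambda>x. integral {0..1} (\<lambda>t. ?k t x))"
    unfolding Rint_def[abs_def] contour_integral_integral by (simp add: mult.commute)
  show "continuous_on {0..pi} (Rint \<gamma> g)" unfolding J by (rule bfi(2)) auto
  have "R z (Rint \<gamma> g) x = integral {0..1} (\<lambda>t. R z (?k t) x)" unfolding J by (rule bfi(3)) auto
  also have "\<dots> = integral {0..1} (\<lambda>t. R z (R (\<gamma> t) g) x * vector_derivative \<gamma> (at t))"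
    by (rule integral_cong) (simp add: R_scaled[OF z R_L2[OF in_S g]] mult.commute)
  also have "\<dots> = contour_integral \<gamma> (\<lambda>w. R z (R w g) x)" by (simp add: contour_integral_integral)
  finally show "R z (Rint \<gamma> g) x = contour_integral \<gamma> (\<lambda>w. R z (R w g) x)" .
qed

text \<open>For a closed path inside the disc the term with \<open>R z g\<close> vanishes. It is kept because the
  statement is then additive in the path, and so extends from smooth to piecewise smooth paths.\<close>
definition reproducing :: "complex \<Rightarrow> real \<Rightarrow> (real \<Rightarrow> complex) \<Rightarrow> (real \<Rightarrow> complex) \<Rightarrow> bool" where
  "reproducing z0 r g \<gamma> \<longleftrightarrow> valid_path \<gamma> \<and> path_image \<gamma> \<subseteq> S \<inter> ball z0 r \<and> continuous_on {0..pi} (Rint \<gamma> g) \<and>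
     (\<forall>h. continuous_on (path_image \<gamma>) h \<longrightarrow> h contour_integrable_on \<gamma>) \<and>
     (\<forall>x. ((\<lambda>z. R z (Rint \<gamma> g) x + R z g x * contour_integral \<gamma> (\<lambda>w. 1 / (z - w)))
        has_contour_integral 2 * of_real pi * \<i> * Rint \<gamma> g x) (circlepath z0 r))"

text \<open>The resolvent identity turns \<open>R z (R w g) x\<close> into
  \<open>(R w g x - R z g x) / (z - w)\<close>, whose second part is cancelled by the extra term of
  \<open>reproducing\<close>. After the two contours are interchanged, the circle integral of
  \<open>R w g x / (z - w)\<close> is Cauchy's formula for a constant, because \<open>w\<close> lies
  inside.\<close>

lemma reproducing_C1_path:
  assumes \<gamma>: "C1_path \<gamma>" "path_image \<gamma> \<subseteq> S \<inter> ball z0 r" and r: "r > 0" "sphere z0 r \<subseteq> S" and g: "L2_on g"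
  shows "reproducing z0 r g \<gamma>"
proof -
  have \<gamma>S: "path_image \<gamma> \<subseteq> S" using \<gamma>(2) by auto
  have vd: "continuous_on {0..1} (\<lambda>t. vector_derivative \<gamma> (at t))" using \<gamma>(1) by (simp add: C1_path_def)
  have \<gamma>v: "valid_path \<gamma>" using \<gamma>(1) by (simp add: C1_path_def)
  have cp: "path_image (circlepath z0 r) = sphere z0 r" using r(1) by simp
  have ne: "z - w \<noteq> 0" if "z \<in> sphere z0 r" "w \<in> path_image \<gamma>" for z w
    using that \<gamma>(2) by auto
  have z0S: "\<exists>z. z \<in> S" using r by (metis ex_in_conv sphere_eq_empty subset_empty less_asym)
  have Rc: "continuous_on (path_image \<gamma>) (\<lambda>w. R w g x)" for x
    by (rule continuous_on_subset[OF R_continuous_on_param[OF g] \<gamma>S])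
  have "((\<lambda>z. R z (Rint \<gamma> g) x + R z g x * contour_integral \<gamma> (\<lambda>w. 1 / (z - w)))
        has_contour_integral 2 * of_real pi * \<i> * Rint \<gamma> g x) (circlepath z0 r)" for x
  proof -
    define f where "f z w = R w g x / (z - w)" for z w
    have fc: "continuous_on (sphere z0 r \<times> path_image \<gamma>) (\<lambda>(z, w). f z w)"
      unfolding f_def case_prod_unfold
      by (intro continuous_intros continuous_on_compose2[OF Rc[of x]]) (use ne in auto)
    have T: "R z (Rint \<gamma> g) x + R z g x * contour_integral \<gamma> (\<lambda>w. 1 / (z - w)) = contour_integral \<gamma> (f z)"
      if z: "z \<in> sphere z0 r" for z
    proof -
      have zS: "z \<in> S" using z r by auto
      have i1: "(\<lambda>w. 1 / (z - w)) contour_integrable_on \<gamma>"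
        using ne[OF z] by (intro contour_integrable_C1_path \<gamma> continuous_intros) auto
      have i2: "f z contour_integrable_on \<gamma>" unfolding f_def[abs_def]
        using ne[OF z] by (intro contour_integrable_C1_path \<gamma> continuous_intros Rc) auto
      have "R z (Rint \<gamma> g) x = contour_integral \<gamma> (\<lambda>w. R z (R w g) x)"
        by (rule resolvent_Rint(2)[OF \<gamma>(1) \<gamma>S zS g])
      also have "\<dots> = contour_integral \<gamma> (\<lambda>w. f z w - R z g x * (1 / (z - w)))"
      proof (rule contour_integral_eq)
        fix w assume w: "w \<in> path_image \<gamma>"
        then have "R w g x - R z g x = (z - w) * R z (R w g) x"
          using \<gamma>S by (intro resolvent_identity zS g) auto
        then show "R z (R w g) x = f z w - R z g x * (1 / (z - w))"
          using ne[OF z w] by (simp add: f_def divide_simps)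
      qed
      also have "\<dots> = contour_integral \<gamma> (f z) - R z g x * contour_integral \<gamma> (\<lambda>w. 1 / (z - w))"
        using contour_integral_diff[OF i2 contour_integrable_lmul[OF i1, of "R z g x"]] contour_integral_lmul[OF i1, of "R z g x"]
        by simp
      finally show ?thesis by simp
    qed
    have Tc: "continuous_on (sphere z0 r) (\<lambda>z. contour_integral \<gamma> (f z))"
    proof -
      have "continuous_on (sphere z0 r \<times> cbox 0 1) (\<lambda>p. (case (fst p, \<gamma> (snd p)) of (z, w) \<Rightarrow> f z w) * vector_derivative \<gamma> (at (snd p)))"
      proof (rule continuous_on_mult)
        show "continuous_on (sphere z0 r \<times> cbox 0 1) (\<lambda>p. case (fst p, \<gamma> (snd p)) of (z, w) \<Rightarrow> f z w)"
          by (rule continuous_on_compose2[OF fc])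
            (auto intro!: continuous_intros continuous_on_compose2[OF C1_path_continuous[OF \<gamma>(1)]] simp: path_image_def)
        show "continuous_on (sphere z0 r \<times> cbox 0 1) (\<lambda>p. vector_derivative \<gamma> (at (snd p)))"
          by (rule continuous_on_compose2[OF vd]) (auto intro!: continuous_intros)
      qed
      then have "continuous_on (sphere z0 r \<times> cbox 0 1) (\<lambda>(z, t). f z (\<gamma> t) * vector_derivative \<gamma> (at t))"
        by (simp add: case_prod_unfold)
      from integral_continuous_on_param[OF this] show ?thesis
        by (simp add: contour_integral_integral)
    qed
    have Ti: "(\<lambda>z. contour_integral \<gamma> (f z)) contour_integrable_on circlepath z0 r"
      by (intro contour_integrable_C1_path C1_path_circlepath) (simp only: cp Tc)
    have "contour_integral (circlepath z0 r) (\<lambda>z. contour_integral \<gamma> (f z)) =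
        contour_integral \<gamma> (\<lambda>w. contour_integral (circlepath z0 r) (\<lambda>z. f z w))"
      by (rule contour_integral_swap) (use fc cp \<gamma>(1) C1_path_circlepath[of z0 r] in \<open>auto simp: C1_path_def\<close>)
    also have "\<dots> = contour_integral \<gamma> (\<lambda>w. (2 * of_real pi * \<i>) * R w g x)"
    proof (rule contour_integral_eq)
      fix w assume "w \<in> path_image \<gamma>"
      then have "cmod (w - z0) < r" using \<gamma>(2) by (auto simp: dist_norm norm_minus_commute)
      then have "((\<lambda>z. R w g x / (z - w)) has_contour_integral (2 * of_real pi * \<i> * R w g x)) (circlepath z0 r)"
        by (intro Cauchy_integral_circlepath_simple holomorphic_intros)
      then show "contour_integral (circlepath z0 r) (\<lambda>z. f z w) = (2 * of_real pi * \<i>) * R w g x"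
        by (simp add: f_def contour_integral_unique)
    qed
    also have "\<dots> = 2 * of_real pi * \<i> * Rint \<gamma> g x"
      unfolding Rint_def by (intro contour_integral_lmul contour_integrable_C1_path \<gamma>(1) Rc)
    finally have "((\<lambda>z. contour_integral \<gamma> (f z)) has_contour_integral 2 * of_real pi * \<i> * Rint \<gamma> g x) (circlepath z0 r)"
      using has_contour_integral_integral[OF Ti] by simp
    then show ?thesis
      by (rule has_contour_integral_eq) (rule T[symmetric], simp only: cp)
  qed
  moreover have "continuous_on {0..pi} (Rint \<gamma> g)" using resolvent_Rint(1)[OF \<gamma>(1) \<gamma>S _ g] z0S by blast
  ultimately show ?thesis
    unfolding reproducing_def using \<gamma>v \<gamma>(2) contour_integrable_C1_path[OF \<gamma>(1)] by blast
qed

lemma reproducing_join: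
  assumes 1: "reproducing z0 r g \<gamma>1" and 2: "reproducing z0 r g \<gamma>2" and j: "pathfinish \<gamma>1 = pathstart \<gamma>2"
    and r: "r > 0" "sphere z0 r \<subseteq> S" and g: "L2_on g"
  shows "reproducing z0 r g (\<gamma>1 +++ \<gamma>2)"
proof -
  have v: "valid_path \<gamma>1" "valid_path \<gamma>2" and im: "path_image \<gamma>1 \<subseteq> S \<inter> ball z0 r" "path_image \<gamma>2 \<subseteq> S \<inter> ball z0 r"
    and c: "continuous_on {0..pi} (Rint \<gamma>1 g)" "continuous_on {0..pi} (Rint \<gamma>2 g)"
    and i: "\<And>h. continuous_on (path_image \<gamma>1) h \<Longrightarrow> h contour_integrable_on \<gamma>1"
      "\<And>h. continuous_on (path_image \<gamma>2) h \<Longrightarrow> h contour_integrable_on \<gamma>2"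
    and rep: "\<And>x. ((\<lambda>z. R z (Rint \<gamma>1 g) x + R z g x * contour_integral \<gamma>1 (\<lambda>w. 1 / (z - w)))
        has_contour_integral 2 * of_real pi * \<i> * Rint \<gamma>1 g x) (circlepath z0 r)"
      "\<And>x. ((\<lambda>z. R z (Rint \<gamma>2 g) x + R z g x * contour_integral \<gamma>2 (\<lambda>w. 1 / (z - w)))
        has_contour_integral 2 * of_real pi * \<i> * Rint \<gamma>2 g x) (circlepath z0 r)"
    using 1 2 unfolding reproducing_def by blast+
  let ?p = "\<gamma>1 +++ \<gamma>2"
  have pim: "path_image ?p = path_image \<gamma>1 \<union> path_image \<gamma>2" using j by (rule path_image_join)
  have Rc: "continuous_on (path_image \<gamma>1) (\<lambda>w. R w g x)" "continuous_on (path_image \<gamma>2) (\<lambda>w. R w g x)" for x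
    using im by (auto intro: continuous_on_subset[OF R_continuous_on_param[OF g]])
  have J: "Rint ?p g = (\<lambda>x. Rint \<gamma>1 g x + 1 * Rint \<gamma>2 g x)"
    unfolding Rint_def[abs_def] using v i Rc by (simp add: fun_eq_iff)
  have "((\<lambda>z. R z (Rint ?p g) x + R z g x * contour_integral ?p (\<lambda>w. 1 / (z - w)))
        has_contour_integral 2 * of_real pi * \<i> * Rint ?p g x) (circlepath z0 r)" for x
  proof -
    have "((\<lambda>z. (R z (Rint \<gamma>1 g) x + R z g x * contour_integral \<gamma>1 (\<lambda>w. 1 / (z - w))) +
       (R z (Rint \<gamma>2 g) x + R z g x * contour_integral \<gamma>2 (\<lambda>w. 1 / (z - w))))
        has_contour_integral 2 * of_real pi * \<i> * Rint \<gamma>1 g x + 2 * of_real pi * \<i> * Rint \<gamma>2 g x) (circlepath z0 r)"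
      by (rule has_contour_integral_add[OF rep])
    moreover have "2 * of_real pi * \<i> * Rint \<gamma>1 g x + 2 * of_real pi * \<i> * Rint \<gamma>2 g x = 2 * of_real pi * \<i> * Rint ?p g x"
      unfolding J by (simp add: distrib_left)
    ultimately have "((\<lambda>z. (R z (Rint \<gamma>1 g) x + R z g x * contour_integral \<gamma>1 (\<lambda>w. 1 / (z - w))) +
       (R z (Rint \<gamma>2 g) x + R z g x * contour_integral \<gamma>2 (\<lambda>w. 1 / (z - w))))
        has_contour_integral 2 * of_real pi * \<i> * Rint ?p g x) (circlepath z0 r)" by (simp only:)
    then show ?thesis
    proof (rule has_contour_integral_eq)
      fix z assume "z \<in> path_image (circlepath z0 r)"
      then have z: "z \<in> sphere z0 r" "z \<in> S" using r by auto
      have "continuous_on (path_image \<gamma>1) (\<lambda>w. 1 / (z - w))" "continuous_on (path_image \<gamma>2) (\<lambda>w. 1 / (z - w))"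
        using im z(1) by (auto intro!: continuous_intros)
      then have "contour_integral ?p (\<lambda>w. 1 / (z - w)) = contour_integral \<gamma>1 (\<lambda>w. 1 / (z - w)) + contour_integral \<gamma>2 (\<lambda>w. 1 / (z - w))"
        using i v by simp
      moreover have "R z (Rint ?p g) x = R z (Rint \<gamma>1 g) x + 1 * R z (Rint \<gamma>2 g) x"
        unfolding J R_lincomb[OF z(2) L2_on_continuous[OF c(1)] L2_on_continuous[OF c(2)]] ..
      ultimately show "R z (Rint \<gamma>1 g) x + R z g x * contour_integral \<gamma>1 (\<lambda>w. 1 / (z - w)) +
          (R z (Rint \<gamma>2 g) x + R z g x * contour_integral \<gamma>2 (\<lambda>w. 1 / (z - w))) =
          R z (Rint ?p g) x + R z g x * contour_integral ?p (\<lambda>w. 1 / (z - w))"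
        by (simp add: algebra_simps)
    qed
  qed
  moreover have "continuous_on {0..pi} (Rint ?p g)" unfolding J by (intro continuous_intros c)
  moreover have "h contour_integrable_on ?p" if "continuous_on (path_image ?p) h" for h
    using that i v unfolding pim by (auto intro!: contour_integrable_joinI intro: continuous_on_subset)
  moreover have "valid_path ?p" by (rule valid_path_join[OF v j])
  moreover have "path_image ?p \<subseteq> S \<inter> ball z0 r" unfolding pim using im by blast
  ultimately show ?thesis unfolding reproducing_def by blast
qed

text \<open>The length \<open>2 * pi * r\<close> of the circle cancels the \<open>2 * pi\<close> of
  the projection, which leaves \<open>r * B'\<close>. \<open>B'\<close> concerns the circle alone
  and may therefore be far smaller than \<open>B\<close>.\<close>

theorem riesz_proj_pointwise_bound:
  assumes rep: "reproducing z0 r g \<gamma>" and closed: "pathfinish \<gamma> = pathstart \<gamma>"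
    and r: "r > 0" "sphere z0 r \<subseteq> S" and g: "L2_on g"
    and B': "\<And>z. z \<in> sphere z0 r \<Longrightarrow> regular v0 b B' z" "B' \<ge> 0"
  defines "h \<equiv> riesz_proj v0 Q b \<gamma> g"
  shows "continuous_on {0..pi} h" "cmod (h x) \<le> r * B' * integral {0..pi} (\<lambda>t. cmod (h t))"
proof -
  define c where "c = 1 / (2 * of_real pi * \<i>)"
  have c: "c * (2 * of_real pi * \<i>) = 1" by (simp add: c_def)
  have h: "h = (\<lambda>x. c * Rint \<gamma> g x)"
    by (simp add: h_def riesz_proj_def Rint_def c_def fun_eq_iff)
  have Jc: "continuous_on {0..pi} (Rint \<gamma> g)" and v: "valid_path \<gamma>" and im: "path_image \<gamma> \<subseteq> S \<inter> ball z0 r"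
    and rep': "((\<lambda>z. R z (Rint \<gamma> g) x + R z g x * contour_integral \<gamma> (\<lambda>w. 1 / (z - w)))
        has_contour_integral 2 * of_real pi * \<i> * Rint \<gamma> g x) (circlepath z0 r)"
    using rep unfolding reproducing_def by blast+
  show hc: "continuous_on {0..pi} h" unfolding h by (intro continuous_intros Jc)
  have "((\<lambda>z. c * (R z (Rint \<gamma> g) x + R z g x * contour_integral \<gamma> (\<lambda>w. 1 / (z - w))))
        has_contour_integral c * (2 * of_real pi * \<i> * Rint \<gamma> g x)) (circlepath z0 r)"
    by (rule has_contour_integral_lmul[OF rep'])
  then have "((\<lambda>z. R z h x) has_contour_integral c * (2 * of_real pi * \<i> * Rint \<gamma> g x)) (circlepath z0 r)"
  proof (rule has_contour_integral_eq)
    fix z assume "z \<in> path_image (circlepath z0 r)"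
    then have z: "z \<in> sphere z0 r" "z \<in> S" using r by auto
    \<comment> \<open>As \<open>z\<close> lies on the boundary circle, the integrand is holomorphic
      in the open disc that contains the closed path.\<close>
    have "((\<lambda>w. 1 / (z - w)) has_contour_integral 0) \<gamma>"
      using im z(1) v closed by (intro Cauchy_theorem_disc_simple[of _ z0 r] holomorphic_intros) auto
    then show "c * (R z (Rint \<gamma> g) x + R z g x * contour_integral \<gamma> (\<lambda>w. 1 / (z - w))) = R z h x"
      unfolding h R_scaled[OF z(2) L2_on_continuous[OF Jc]] by (simp add: contour_integral_unique)
  qed
  moreover have "c * (2 * of_real pi * \<i> * Rint \<gamma> g x) = 2 * of_real pi * \<i> * h x"
    unfolding h by simp
  ultimately have hi: "((\<lambda>z. R z h x) has_contour_integral 2 * of_real pi * \<i> * h x) (circlepath z0 r)" by simp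
  let ?H = "integral {0..pi} (\<lambda>t. cmod (h t))"
  have H0: "?H \<ge> 0"
    by (intro HK_nonneg integrable_continuous_real continuous_intros hc) auto
  have "cmod (2 * of_real pi * \<i> * h x) \<le> (B' * ?H) * (2 * pi * r)"
  proof (rule has_contour_integral_bound_circlepath[OF hi])
    show "cmod (R z h x) \<le> B' * ?H" if "cmod (z - z0) = r" for z
      using B'(1)[of z] that L2_on_continuous[OF hc] unfolding regular_def by (auto simp: dist_norm norm_minus_commute)
  qed (use H0 B' r in auto)
  then show "cmod (h x) \<le> r * B' * ?H" by (simp add: norm_mult algebra_simps)
qed

text \<open>The radial homotopy between the circles stays in the closed annulus, where the resolvent
  is holomorphic.\<close>

lemma riesz_proj_circlepath_eq:
  assumes S: "open S" and r: "0 < r1" "r1 \<le> r2" and sub: "\<And>z. r1 \<le> cmod (z - z0) \<Longrightarrow> cmod (z - z0) \<le> r2 \<Longrightarrow> z \<in> S"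
    and g: "L2_on g"
  shows "riesz_proj v0 Q b (circlepath z0 r2) g = riesz_proj v0 Q b (circlepath z0 r1) g"
proof -
  have "homotopic_loops S (circlepath z0 r2) (circlepath z0 r1)"
  proof (rule homotopic_loops_linear)
    fix t :: real assume "t \<in> {0..1}"
    show "closed_segment (circlepath z0 r2 t) (circlepath z0 r1 t) \<subseteq> S"
    proof
      fix p assume "p \<in> closed_segment (circlepath z0 r2 t) (circlepath z0 r1 t)"
      then obtain u where u: "0 \<le> u" "u \<le> 1" "p = (1 - u) *\<^sub>R circlepath z0 r2 t + u *\<^sub>R circlepath z0 r1 t"
        by (auto simp: in_segment)
      define \<rho> where "\<rho> = (1 - u) * r2 + u * r1"
      have "p - z0 = of_real \<rho> * exp (2 * of_real pi * \<i> * of_real t)"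
        by (simp add: u(3) circlepath \<rho>_def scaleR_conv_of_real algebra_simps)
      then have "cmod (p - z0) = \<bar>\<rho>\<bar>" by (simp add: norm_mult)
      moreover have "r1 \<le> \<rho>"
      proof -
        have "(1 - u) * r1 \<le> (1 - u) * r2" using u r by (intro mult_left_mono) auto
        then show ?thesis by (simp add: \<rho>_def algebra_simps)
      qed
      moreover have "\<rho> \<le> r2"
      proof -
        have "u * r1 \<le> u * r2" using u r by (intro mult_left_mono) auto
        then show ?thesis by (simp add: \<rho>_def algebra_simps)
      qed
      ultimately show "p \<in> S" using r by (intro sub) auto
    qed
  qed auto
  then have "contour_integral (circlepath z0 r2) (\<lambda>z. R z g x) = contour_integral (circlepath z0 r1) (\<lambda>z. R z g x)" for x
    using S R_holomorphic[OF S g] by (rule Cauchy_theorem_homotopic_loops) auto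
  then show ?thesis by (simp add: riesz_proj_def)
qed

end

subsection \<open>Comparison of the norms\<close>

lemma norm_inf_le:
  assumes "0 \<le> C" "\<And>x. x \<in> {0..pi} \<Longrightarrow> cmod (f x) \<le> C"
  shows "norm_inf f \<le> C"
proof -
  have "{x \<in> {0..pi}. C < cmod (f x)} = {}" using assms(2) by force
  then have "negligible {x \<in> {0..pi}. C < cmod (f x)}" by (simp only: negligible_empty)
  then show ?thesis
    unfolding norm_inf_def using assms(1) by (intro cInf_lower bdd_belowI[of _ 0]) auto
qed

lemma norm1_le_norm_inf:
  assumes f: "continuous_on {0..pi} f"
  shows "norm1 f \<le> norm_inf f"
  unfolding norm_inf_def
proof (rule cInf_greatest)
  have "compact (f ` {0..pi})" by (intro compact_continuous_image f) auto
  then obtain M where M: "\<And>x. x \<in> {0..pi} \<Longrightarrow> cmod (f x) \<le> M"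
    using compact_imp_bounded bounded_iff by (metis (no_types, lifting) imageI)
  then have "0 \<le> M" using norm_ge_zero order_trans by (metis atLeastAtMost_iff order_refl pi_ge_zero)
  moreover have "{x \<in> {0..pi}. M < cmod (f x)} = {}" using M by force
  ultimately show "{C. 0 \<le> C \<and> negligible {x \<in> {0..pi}. C < cmod (f x)}} \<noteq> {}"
    by (metis (mono_tags, lifting) empty_iff mem_Collect_eq negligible_empty)
  fix C assume "C \<in> {C. 0 \<le> C \<and> negligible {x \<in> {0..pi}. C < cmod (f x)}}"
  then have C: "0 \<le> C" "negligible {x \<in> {0..pi}. C < cmod (f x)}" by auto
  let ?N = "{x \<in> {0..pi}. C < cmod (f x)}"
  have "integral {0..pi} (\<lambda>x. cmod (f x)) = integral {0..pi} (\<lambda>x. min C (cmod (f x)))"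
    by (rule integral_spike[OF C(2)]) (auto simp: min_def)
  also have "\<dots> \<le> integral {0..pi} (\<lambda>x. C)"
    by (intro integral_le integrable_continuous_real continuous_intros f) auto
  finally show "norm1 f \<le> C" by (simp add: norm1_def field_simps)
qed

text \<open>The factor \<open>pi\<close> undoes the normalisation of \<open>norm1\<close>.\<close>

lemma norm_inf_le_norm1:
  assumes "\<And>x. cmod (f x) \<le> D * integral {0..pi} (\<lambda>t. cmod (f t))"
  shows "norm_inf f \<le> (D * pi) * norm1 f"
proof -
  have "0 \<le> D * integral {0..pi} (\<lambda>t. cmod (f t))" using assms[of 0] norm_ge_zero order_trans by blast
  then have "norm_inf f \<le> D * integral {0..pi} (\<lambda>t. cmod (f t))" by (rule norm_inf_le) (rule assms)
  then show ?thesis by (simp add: norm1_def)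
qed

subsection \<open>Location of the contours\<close>

text \<open>\<open>csqrt\<close> has nonnegative real part, so its negative is the root whose
  exponentials decay.\<close>

lemma exists_wave_number: obtains c :: complex where "c\<^sup>2 = w" "Re c \<le> 0" "(cmod c)\<^sup>2 = cmod w"
proof
  show "(- csqrt w)\<^sup>2 = w" by simp
  show "Re (- csqrt w) \<le> 0" by (simp only: uminus_complex.sel neg_le_0_iff_le Re_csqrt)
  show "(cmod (- csqrt w))\<^sup>2 = cmod w" by (simp only: norm_minus_cancel norm_power[symmetric] power2_csqrt)
qed

lemma amp_le:
  assumes "cmod (1 - exp (2 * of_real pi * c)) \<ge> d" "d > 0"
  shows "amp c \<le> 2 / d + 1" "exp (2 * of_real pi * c) \<noteq> 1"
proof -
  have "2 / cmod (1 - exp (2 * of_real pi * c)) \<le> 2 / d"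
    using assms by (intro divide_left_mono mult_pos_pos) auto
  then show "amp c \<le> 2 / d + 1" by (simp add: amp_def)
  show "exp (2 * of_real pi * c) \<noteq> 1" using assms by auto
qed

lemma one_minus_exp_lower_left:
  assumes "Re c \<le> - 1 / 4"
  shows "cmod (1 - exp (2 * of_real pi * c)) \<ge> 1 / 2"
proof -
  have "2 \<le> exp (pi / 2)" using exp_ge_add_one_self[of "pi / 2"] pi_gt3 by linarith
  then have "exp (- (pi / 2)) \<le> 1 / 2" by (simp add: exp_minus field_simps)
  moreover have "2 * pi * Re c \<le> 2 * pi * (- 1 / 4)" using assms by (intro mult_left_mono) auto
  then have "cmod (exp (2 * of_real pi * c)) \<le> exp (- (pi / 2))" by simp
  ultimately show ?thesis using norm_triangle_ineq2[of 1 "exp (2 * of_real pi * c)"] unfolding norm_one by linarith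
qed

text \<open>The zeros of \<open>1 - exp (2 * pi * c)\<close> are the integer multiples of \<i>. If
  the imaginary part stays 1/4 away from the integers, the exponential lies in the closed left
  half-plane, whatever the real part.\<close>

lemma one_minus_exp_lower_gap:
  assumes "real N + 1 / 4 \<le> \<bar>Im c\<bar>" "\<bar>Im c\<bar> \<le> real N + 3 / 4"
  shows "cmod (1 - exp (2 * of_real pi * c)) \<ge> 1 / 2"
proof -
  \<comment> \<open>The shift puts \<open>t\<close> between 0 and \<open>pi\<close>, where the sine
    is nonnegative.\<close>
  define t where "t = 2 * pi * (\<bar>Im c\<bar> - N) - pi / 2"
  have "2 * pi * (1 / 4) \<le> 2 * pi * (\<bar>Im c\<bar> - N)" "2 * pi * (\<bar>Im c\<bar> - N) \<le> 2 * pi * (3 / 4)"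
    using assms by (intro mult_left_mono; simp)+
  then have "sin t \<ge> 0" by (intro sin_ge_zero; unfold t_def; linarith)
  have "cos (2 * pi * Im c) = cos (2 * pi * \<bar>Im c\<bar>)" by (simp add: abs_if)
  also have "2 * pi * \<bar>Im c\<bar> = (t + pi / 2) + 2 * real N * pi" by (simp add: t_def algebra_simps)
  also have "cos \<dots> = cos (t + pi / 2)" unfolding cos_add[of "t + pi / 2"] by simp
  also have "\<dots> = - sin t" by (simp add: cos_add)
  finally have "cos (2 * pi * Im c) \<le> 0" using \<open>sin t \<ge> 0\<close> by simp
  then have "Re (exp (2 * of_real pi * c)) \<le> 0" by (simp add: Re_exp mult_nonneg_nonpos)
  then have "1 \<le> Re (1 - exp (2 * of_real pi * c))" by simp
  also have "\<dots> \<le> cmod (1 - exp (2 * of_real pi * c))" by (rule complex_Re_le_cmod)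
  finally show ?thesis by simp
qed

text \<open>The closed disc without the open rectangle. Since \<open>(N\<^sup>2 + N)\<^sup>2 +
  N\<^sup>2 < (N\<^sup>2 + N + 1)\<^sup>2\<close>, the corners lie inside the disc, and both the
  rectangle's boundary and the circle belong to the region.\<close>

definition outer_region :: "nat \<Rightarrow> complex set" where
  "outer_region N = {z. cmod z \<le> (real N)\<^sup>2 + N + 1 \<and>
     (Re z \<le> - real N \<or> Re z \<ge> (real N)\<^sup>2 + N \<or> \<bar>Im z\<bar> \<ge> N)}"

text \<open>Left of the rectangle \<open>c\<^sup>2\<close> has large real part, so
  \<open>Re c\<close> is at most -1/4. To its right the bound on \<open>cmod z\<close> confines the
  modulus of \<open>Im c\<close> to a neighbourhood of \<open>N + 1/2\<close>, midway between two
  free frequencies, because \<open>(N + 1/2)\<^sup>2\<close> is nearly \<open>N\<^sup>2 + N\<close>.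
  Above and below, \<open>Im z\<close> is close to \<open>- 2 * Re c * Im c\<close> while
  \<open>Im c\<close> has modulus at most \<open>N + 1\<close>, so again \<open>Re c\<close> is at
  most -1/4. Each case bounds \<open>1 - exp (2 * pi * c)\<close> below by 1/2, and
  \<open>2 / (1/2) + 1 = 5\<close>.\<close>

lemma outer_region_amp:
  assumes z: "z \<in> outer_region N" and c: "c\<^sup>2 = v0 - z" "Re c \<le> 0"
    and N: "real N \<ge> 2 * cmod v0 + 1"
  shows "amp c \<le> 5" "exp (2 * of_real pi * c) \<noteq> 1"
proof -
  let ?V = "cmod v0" and ?x = "Re c" and ?y = "Im c"
  have re: "?x\<^sup>2 - ?y\<^sup>2 = Re v0 - Re z" and im: "2 * ?x * ?y = Im v0 - Im z"
    using c(1) by (auto simp: complex_eq_iff power2_eq_square algebra_simps)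
  have V: "\<bar>Re v0\<bar> \<le> ?V" "\<bar>Im v0\<bar> \<le> ?V" by (rule abs_Re_le_cmod abs_Im_le_cmod)+
  have V0: "?V \<ge> 0" by simp
  have sq: "(1 / 4 :: real)\<^sup>2 = 1 / 16" "(real N + 1 / 4)\<^sup>2 = (real N)\<^sup>2 + real N / 2 + 1 / 16"
    "(real N + 3 / 4)\<^sup>2 = (real N)\<^sup>2 + 3 * real N / 2 + 9 / 16" "(real N + 1)\<^sup>2 = (real N)\<^sup>2 + 2 * real N + 1"
    by (simp_all add: power2_eq_square algebra_simps)
  have "(cmod c)\<^sup>2 = cmod (v0 - z)" using c(1) by (metis norm_power)
  then have cn: "?x\<^sup>2 + ?y\<^sup>2 \<le> (real N)\<^sup>2 + N + 1 + ?V"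
    using norm_triangle_ineq4[of v0 z] z by (simp add: cmod_power2 outer_region_def)
  have "?x \<le> - 1 / 4 \<or> (real N + 1 / 4 \<le> \<bar>?y\<bar> \<and> \<bar>?y\<bar> \<le> real N + 3 / 4)"
  proof -
    consider "Re z \<le> - real N" | "Re z \<ge> (real N)\<^sup>2 + N" | "\<bar>Im z\<bar> \<ge> N" using z by (auto simp: outer_region_def)
    then show ?thesis
    proof cases
      case 1
      have "(1 / 4)\<^sup>2 \<le> ?x\<^sup>2" using re 1 V N V0 zero_le_power2[of ?y] unfolding sq by linarith
      then have "1 / 4 \<le> \<bar>?x\<bar>" using abs_le_square_iff[of "1/4" ?x] by simp
      then show ?thesis using c(2) by linarith
    next
      case 2
      have "(real N + 1 / 4)\<^sup>2 \<le> ?y\<^sup>2"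
        using re 2 V N V0 zero_le_power2[of ?x] unfolding sq by linarith
      then have "real N + 1 / 4 \<le> \<bar>?y\<bar>" using abs_le_square_iff[of "real N + 1 / 4" ?y] by simp
      moreover have "?y\<^sup>2 \<le> (real N + 3 / 4)\<^sup>2"
        using cn N V0 zero_le_power2[of ?x] unfolding sq by linarith
      then have "\<bar>?y\<bar> \<le> real N + 3 / 4" using abs_le_square_iff[of ?y "real N + 3 / 4"] by simp
      ultimately show ?thesis by simp
    next
      case 3
      have "?y\<^sup>2 \<le> (real N + 1)\<^sup>2"
        using cn N V0 zero_le_power2[of ?x] unfolding sq by linarith
      then have y: "\<bar>?y\<bar> \<le> real N + 1" using abs_le_square_iff[of ?y "real N + 1"] by simp
      have "real N - ?V \<le> 2 * \<bar>?x\<bar> * \<bar>?y\<bar>"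
      proof -
        have "real N - ?V \<le> \<bar>2 * ?x * ?y\<bar>" unfolding im using 3 V by linarith
        then show ?thesis by (simp add: abs_mult)
      qed
      also have "\<dots> \<le> 2 * \<bar>?x\<bar> * (real N + 1)" using y by (intro mult_left_mono) auto
      finally have "real N - ?V \<le> 2 * \<bar>?x\<bar> * (real N + 1)" .
      moreover have "(real N + 1) / 2 \<le> real N - ?V" using N V0 by simp
      ultimately have "(1 / 4) * (2 * (real N + 1)) \<le> \<bar>?x\<bar> * (2 * (real N + 1))" by linarith
      then have "1 / 4 \<le> \<bar>?x\<bar>" by (rule mult_right_le_imp_le) simp
      then show ?thesis using c(2) by linarith
    qed
  qed
  then have "cmod (1 - exp (2 * of_real pi * c)) \<ge> 1 / 2"
    using one_minus_exp_lower_left one_minus_exp_lower_gap by blast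
  from amp_le[OF this] show "amp c \<le> 5" "exp (2 * of_real pi * c) \<noteq> 1" by simp_all
qed

lemma outer_region_norm: "z \<in> outer_region N \<Longrightarrow> real N \<le> cmod z"
  using abs_Re_le_cmod[of z] abs_Im_le_cmod[of z] zero_le_power2[of "real N"]
  unfolding outer_region_def mem_Collect_eq by (elim conjE disjE; linarith)

lemma sphere_subset_outer_region: "sphere 0 ((real N)\<^sup>2 + N + 1) \<subseteq> outer_region N"
proof
  fix z :: complex assume z: "z \<in> sphere 0 ((real N)\<^sup>2 + N + 1)"
  show "z \<in> outer_region N"
  proof (rule ccontr)
    assume "z \<notin> outer_region N"
    then have n: "- real N < Re z" "Re z < (real N)\<^sup>2 + N" "\<bar>Im z\<bar> < N" using z by (auto simp: outer_region_def)
    have N0: "0 < real N" using n by linarith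
    have "\<bar>Re z\<bar> \<le> (real N)\<^sup>2 + N" using n zero_le_power2[of "real N"] by linarith
    then have "(Re z)\<^sup>2 \<le> ((real N)\<^sup>2 + N)\<^sup>2" using abs_le_square_iff[of "Re z" "(real N)\<^sup>2 + N"] by simp
    moreover have "(Im z)\<^sup>2 \<le> (real N)\<^sup>2" using abs_le_square_iff[of "Im z" "real N"] n by simp
    moreover have "(cmod z)\<^sup>2 = ((real N)\<^sup>2 + N + 1)\<^sup>2" using z by simp
    moreover have "((real N)\<^sup>2 + N + 1)\<^sup>2 = ((real N)\<^sup>2 + N)\<^sup>2 + 2 * ((real N)\<^sup>2 + N) + 1" by (simp add: power2_eq_square algebra_simps)
    ultimately have "2 * ((real N)\<^sup>2 + N) + 1 \<le> (real N)\<^sup>2" unfolding cmod_power2 by linarith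
    then have "(real N)\<^sup>2 + 2 * real N + 1 \<le> 0" by (simp add: distrib_left)
    then show False using N0 zero_le_power2[of "real N"] by linarith
  qed
qed

lemma rect_corner_norm:
  assumes "\<bar>s\<bar> \<le> (real N)\<^sup>2 + N" "\<bar>t\<bar> \<le> real N"
  shows "cmod (Complex s t) < (real N)\<^sup>2 + N + 1"
proof (rule power2_less_imp_less)
  have "s\<^sup>2 \<le> ((real N)\<^sup>2 + N)\<^sup>2" using abs_le_square_iff[of s "(real N)\<^sup>2 + N"] assms by simp
  moreover have "t\<^sup>2 \<le> (real N)\<^sup>2" using abs_le_square_iff[of t "real N"] assms by simp
  moreover have "((real N)\<^sup>2 + N + 1)\<^sup>2 = ((real N)\<^sup>2 + N)\<^sup>2 + 2 * ((real N)\<^sup>2 + N) + 1" by (simp add: power2_eq_square algebra_simps)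
  moreover have "(real N)\<^sup>2 < 2 * ((real N)\<^sup>2 + N) + 1"
    by (rule le_less_trans[of _ "2 * ((real N)\<^sup>2 + N)"]) (simp_all add: distrib_left)
  ultimately show "(cmod (Complex s t))\<^sup>2 < ((real N)\<^sup>2 + N + 1)\<^sup>2" unfolding cmod_power2 complex.sel by linarith
qed simp

lemma segment_subset_outer_region:
  assumes c: "\<bar>s\<bar> \<le> (real N)\<^sup>2 + N" "\<bar>t\<bar> \<le> real N" "\<bar>s'\<bar> \<le> (real N)\<^sup>2 + N" "\<bar>t'\<bar> \<le> real N"
    and e: "(s = s' \<and> (s = - real N \<or> s = (real N)\<^sup>2 + N)) \<or> (t = t' \<and> \<bar>t\<bar> = real N)"
  shows "closed_segment (Complex s t) (Complex s' t') \<subseteq> outer_region N \<inter> ball 0 ((real N)\<^sup>2 + N + 1)"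
proof
  fix p assume p: "p \<in> closed_segment (Complex s t) (Complex s' t')"
  have "closed_segment (Complex s t) (Complex s' t') \<subseteq> ball 0 ((real N)\<^sup>2 + N + 1)"
    by (rule closed_segment_subset) (use rect_corner_norm c in auto)
  then have b: "cmod p < (real N)\<^sup>2 + N + 1" using p by auto
  obtain u where "p = (1 - u) *\<^sub>R Complex s t + u *\<^sub>R Complex s' t'" using p by (auto simp: in_segment)
  then have "Re p = (1 - u) * s + u * s'" "Im p = (1 - u) * t + u * t'" by simp_all
  then have "Re p = s \<or> \<not> s = s'" "Im p = t \<or> \<not> t = t'" by (auto simp: algebra_simps)
  then show "p \<in> outer_region N \<inter> ball 0 ((real N)\<^sup>2 + N + 1)" using b e by (auto simp: outer_region_def)
qed

text \<open>The window surrounds \<open>2 * pi / 64\<close>, about 0.098, the approximate size of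
  \<open>w\<close> on the circle of radius \<open>n / 32\<close>. There the Taylor remainder after
  the linear term takes away at most 13.2 percent of \<open>cmod w\<close>.\<close>

lemma exp_minus_1_lower:
  assumes "9 / 100 \<le> cmod w" "cmod w \<le> 11 / 100"
  shows "cmod (1 - exp w) \<ge> 1 / 13"
proof -
  have "cmod (exp w - (\<Sum>i\<le>1. w ^ i / fact i)) \<le> exp \<bar>Re w\<bar> * (cmod w) ^ Suc 1 / fact 1"
    by (rule Taylor_exp)
  then have t: "cmod (exp w - (1 + w)) \<le> exp \<bar>Re w\<bar> * (cmod w)\<^sup>2" by (simp add: power2_eq_square)
  have "exp \<bar>Re w\<bar> \<le> 1 + \<bar>Re w\<bar> + \<bar>Re w\<bar>\<^sup>2"
    using abs_Re_le_cmod[of w] assms by (intro exp_bound) auto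
  also have "\<bar>Re w\<bar>\<^sup>2 \<le> (11 / 100)\<^sup>2" using abs_Re_le_cmod[of w] assms by (intro power_mono) auto
  finally have "exp \<bar>Re w\<bar> \<le> 6 / 5" using abs_Re_le_cmod[of w] assms by (simp add: power2_eq_square)
  then have "exp \<bar>Re w\<bar> * (cmod w)\<^sup>2 \<le> (6 / 5) * (cmod w)\<^sup>2" by (intro mult_right_mono) auto
  also have "\<dots> = (6 / 5 * cmod w) * cmod w" by (simp add: power2_eq_square)
  also have "\<dots> \<le> (6 / 5 * (11 / 100)) * cmod w" using assms by (intro mult_right_mono mult_left_mono) auto
  finally have "cmod (exp w - (1 + w)) \<le> 132 / 1000 * cmod w" using t by simp
  moreover have "cmod w - cmod (exp w - (1 + w)) \<le> cmod (w + (exp w - (1 + w)))"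
    using norm_diff_ineq[of w "exp w - (1 + w)"] .
  moreover have "cmod (w + (exp w - (1 + w))) = cmod (1 - exp w)" by (simp add: norm_minus_commute)
  ultimately show ?thesis using assms(1) by simp
qed

text \<open>The annulus avoids all multiples of \<open>2 * pi * \<i>\<close>, so compactness gives a
  positive minimum. An explicit \<open>d\<close> is not sought, as it only influences how large
  \<open>n\<close> must be, not the final constant.\<close>

lemma exp_away_from_1:
  obtains d where "d > 0" "\<And>w. 2 * pi / 512 \<le> cmod w \<Longrightarrow> cmod w \<le> 2 * pi * (3 / 4) \<Longrightarrow> cmod (1 - exp w) \<ge> d"
proof -
  let ?A = "cball (0 :: complex) (2 * pi * (3 / 4)) - ball 0 (2 * pi / 512)"
  have cA: "compact ?A" by (intro compact_diff) auto
  have ne: "?A \<noteq> {}"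
  proof -
    have "complex_of_real (2 * pi / 512) \<in> ?A" using pi_gt_zero by auto
    then show ?thesis by blast
  qed
  have cont: "continuous_on ?A (\<lambda>w. cmod (1 - exp w))" by (intro continuous_intros)
  obtain w0 where w0: "w0 \<in> ?A" "\<And>w. w \<in> ?A \<Longrightarrow> cmod (1 - exp w0) \<le> cmod (1 - exp w)"
    using continuous_attains_inf[OF cA ne cont] by blast
  have "exp w0 \<noteq> 1"
  proof
    assume "exp w0 = 1"
    then obtain n :: int where n: "Re w0 = 0" "Im w0 = of_int (2 * n) * pi" by (auto simp: exp_eq_1)
    then have cw: "cmod w0 = \<bar>of_int n\<bar> * (2 * pi)" by (simp add: cmod_eq_Im abs_mult)
    show False
    proof (cases "n = 0")
      case True
      then show False using w0(1) cw by simp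
    next
      case False
      then have "1 \<le> \<bar>real_of_int n\<bar>" by linarith
      then have "1 * (2 * pi) \<le> cmod w0" unfolding cw by (intro mult_right_mono) auto
      then show False using w0(1) pi_gt_zero by auto
    qed
  qed
  then have "cmod (1 - exp w0) > 0" by simp
  then show ?thesis using w0(2) by (intro that[of "cmod (1 - exp w0)"]) auto
qed

text \<open>Let \<open>a\<close> be the square root of \<open>- n\<^sup>2\<close> on the side of
  \<open>c\<close>, and \<open>\<rho> = c - a\<close>. Then \<open>exp (2 * pi * a) = 1\<close>, and
  \<open>\<rho> * (c + a) = v0 - (z - n\<^sup>2)\<close> with \<open>cmod (c + a)\<close> about
  \<open>2 * n\<close>, so \<open>\<rho>\<close> has size about
  \<open>cmod (z - n\<^sup>2) / (2 * n)\<close>.\<close>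

lemma near_square:
  assumes c: "c\<^sup>2 = v0 - z" and n: "real n \<ge> 3 * cmod v0 + 20" and t: "cmod (z - of_nat (n\<^sup>2)) \<le> n + 1"
  obtains \<rho> where "exp (2 * of_real pi * c) = exp (2 * of_real pi * \<rho>)" "cmod c \<ge> real n - 1"
    "(cmod (z - of_nat (n\<^sup>2)) - cmod v0) / (2 * real n + 2) \<le> cmod \<rho>"
    "cmod \<rho> \<le> (cmod (z - of_nat (n\<^sup>2)) + cmod v0) / (2 * real n - 2)"
proof -
  \<comment> \<open>The sign follows \<open>Im c\<close>, so the imaginary parts of \<open>c\<close>
    and \<open>a\<close> reinforce each other in \<open>c + a\<close>.\<close>
  define s :: int where "s = (if Im c \<ge> 0 then 1 else - 1)"
  define a where "a = \<i> * of_int s * of_nat n"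
  have a2: "a\<^sup>2 = - of_nat (n\<^sup>2)" by (simp add: a_def s_def power_mult_distrib)
  have na: "cmod a = n" by (simp add: a_def s_def norm_mult)
  define \<rho> where "\<rho> = c - a"
  have prod: "\<rho> * (c + a) = v0 - (z - of_nat (n\<^sup>2))"
    using c a2 by (simp add: \<rho>_def algebra_simps power2_eq_square)
  have m1: "cmod (c + a) \<ge> n"
  proof -
    have "\<bar>Im (c + a)\<bar> \<ge> n" by (simp add: a_def s_def)
    then show ?thesis using abs_Im_le_cmod[of "c + a"] by linarith
  qed
  have n0: "real n > 2" using n norm_ge_zero[of v0] by linarith
  have up: "cmod \<rho> * cmod (c + a) \<le> cmod (z - of_nat (n\<^sup>2)) + cmod v0"
    unfolding norm_mult[symmetric] prod using norm_triangle_ineq4[of v0 "z - of_nat (n\<^sup>2)"] by simp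
  have lo: "cmod (z - of_nat (n\<^sup>2)) - cmod v0 \<le> cmod \<rho> * cmod (c + a)"
    unfolding norm_mult[symmetric] prod using norm_triangle_ineq2[of "z - of_nat (n\<^sup>2)" v0] by (simp add: norm_minus_commute)
  \<comment> \<open>A crude bound from \<open>cmod (c + a) \<ge> n\<close>, which then sharpens that
    estimate to \<open>2 * n\<close> up to an error 2.\<close>
  have r2: "cmod \<rho> \<le> 2"
  proof -
    have "cmod \<rho> * n \<le> cmod \<rho> * cmod (c + a)" by (intro mult_left_mono m1) auto
    also have "\<dots> \<le> 2 * n" using up t n norm_ge_zero[of v0] by linarith
    finally show ?thesis using n0 by simp
  qed
  have ca: "c + a = \<rho> + 2 * a" by (simp add: \<rho>_def)
  have m2: "cmod (c + a) \<le> 2 * real n + 2" "2 * real n - 2 \<le> cmod (c + a)"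
    using norm_triangle_ineq[of \<rho> "2 * a"] norm_diff_ineq[of "2 * a" \<rho>] r2 na unfolding ca
    by (simp_all add: norm_mult add.commute)
  have L: "(cmod (z - of_nat (n\<^sup>2)) - cmod v0) / (2 * real n + 2) \<le> cmod \<rho>"
  proof -
    have "cmod \<rho> * cmod (c + a) \<le> cmod \<rho> * (2 * real n + 2)" by (intro mult_left_mono m2) auto
    then have "cmod (z - of_nat (n\<^sup>2)) - cmod v0 \<le> cmod \<rho> * (2 * real n + 2)" using lo by linarith
    then show ?thesis by (simp add: divide_le_eq)
  qed
  have U: "cmod \<rho> \<le> (cmod (z - of_nat (n\<^sup>2)) + cmod v0) / (2 * real n - 2)"
  proof -
    have "cmod \<rho> * (2 * real n - 2) \<le> cmod \<rho> * cmod (c + a)" by (intro mult_left_mono m2) auto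
    then have "cmod \<rho> * (2 * real n - 2) \<le> cmod (z - of_nat (n\<^sup>2)) + cmod v0" using up by linarith
    then show ?thesis using n0 by (simp add: le_divide_eq)
  qed
  have "cmod \<rho> \<le> 1"
  proof -
    have "cmod (z - of_nat (n\<^sup>2)) + cmod v0 \<le> 1 * (2 * real n - 2)" using t n norm_ge_zero[of v0] by simp
    then have "(cmod (z - of_nat (n\<^sup>2)) + cmod v0) / (2 * real n - 2) \<le> 1" using n0 by (simp add: divide_le_eq)
    then show ?thesis using U by linarith
  qed
  then have C: "cmod c \<ge> real n - 1"
    using norm_diff_ineq[of a \<rho>] na by (simp add: \<rho>_def)
  have "exp (2 * of_real pi * a) = 1"
  proof -
    have "2 * of_real pi * a = of_real (2 * of_int (s * int n) * pi) * \<i>" by (simp add: a_def)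
    then show ?thesis using exp_integer_2pi[OF Ints_of_int, of "s * int n"] by (simp only:)
  qed
  moreover have "exp (2 * of_real pi * c) = exp (2 * of_real pi * \<rho>) * exp (2 * of_real pi * a)"
    by (simp add: \<rho>_def exp_add[symmetric] algebra_simps)
  ultimately have "exp (2 * of_real pi * c) = exp (2 * of_real pi * \<rho>)" by simp
  then show ?thesis using that L U C by blast
qed

section \<open>The two norm inequalities\<close>

context potential
begin

lemma regular_mono:
  assumes "regular v0 b B z" "B \<le> B'"
  shows "regular v0 b B' z"
  unfolding regular_def
proof (intro allI impI conjI)
  fix f x assume f: "L2_on f"
  show "solves v0 Q b z f y \<longleftrightarrow> y = resolvent v0 Q b z f" for y
    using assms(1) f unfolding regular_def by blast
  have "integral {0..pi} (\<lambda>t. cmod (f t)) \<ge> 0"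
    by (intro HK_nonneg abs_integrableD(2) L2_on_imp_absolutely_integrable f) simp
  then have "B * integral {0..pi} (\<lambda>t. cmod (f t)) \<le> B' * integral {0..pi} (\<lambda>t. cmod (f t))"
    using assms(2) by (intro mult_right_mono)
  then show "cmod (resolvent v0 Q b z f x) \<le> B' * integral {0..pi} (\<lambda>t. cmod (f t))"
    using assms(1) f order_trans unfolding regular_def by blast
qed

text \<open>The radius is of order \<open>N\<^sup>2\<close> and \<open>cmod c\<close> is at least
  \<open>N\<close> on the outer circle, so the constant is linear in \<open>N\<close>; the logarithm
  merely covers a numerical factor once \<open>N \<ge> exp 3\<close>.\<close>

theorem E_big_bound:
  obtains N0 where "\<And>N f. N \<ge> N0 \<Longrightarrow> f \<in> E_big v0 Q b N \<Longrightarrow>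
    continuous_on {0..pi} f \<and> norm_inf f \<le> 50 * real N * ln (real N) * norm1 f"
proof -
  obtain R where R: "\<And>v0 z c. c\<^sup>2 = v0 - z \<Longrightarrow> Re c \<le> 0 \<Longrightarrow> cmod c \<ge> R \<Longrightarrow> exp (2 * of_real pi * c) \<noteq> 1 \<Longrightarrow>
     amp c \<le> 5 \<Longrightarrow> regular v0 b (amp c * (1 + 1) / cmod c) z"
    by (rule eventually_regular[of 5 1]) auto
  define V where "V = cmod v0"
  have V0: "V \<ge> 0" by (simp add: V_def)
  \<comment> \<open>\<open>2 * V + 1\<close> serves \<open>outer_region_amp\<close>,
    \<open>V + 1 + R\<^sup>2\<close> forces \<open>cmod c\<close> above both \<open>R\<close> and 1,
    and \<open>exp 3\<close> makes \<open>ln N\<close> at least 3.\<close>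
  define X where "X = max (2 * V + 1) (max (V + 1 + R\<^sup>2) (exp 3))"
  define N0 where "N0 = nat \<lceil>X\<rceil>"
  have "continuous_on {0..pi} f \<and> norm_inf f \<le> 50 * real N * ln (real N) * norm1 f"
    if N: "N \<ge> N0" and f: "f \<in> E_big v0 Q b N" for N f
  proof -
    have "X \<le> real N" using N unfolding N0_def by linarith
    then have NX: "real N \<ge> 2 * V + 1" "real N \<ge> V + 1 + R\<^sup>2" "real N \<ge> exp 3" by (auto simp: X_def)
    have N1: "real N \<ge> 1" using NX(1) V0 by linarith
    let ?P = "(real N)\<^sup>2 + N + 1"
    \<comment> \<open>Used with \<open>k = 1\<close> on the whole region and with
      \<open>k = N\<close> on the outer circle. The 10 is the bound 5 for \<open>amp\<close> times
      \<open>1 + \<tau> = 2\<close>.\<close>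
    have out_reg: "regular v0 b (10 / k) z" if z: "z \<in> outer_region N" and k: "k\<^sup>2 \<le> cmod z - V" "k \<ge> 1" for z k
    proof -
      obtain c where c: "c\<^sup>2 = v0 - z" "Re c \<le> 0" "(cmod c)\<^sup>2 = cmod (v0 - z)" by (rule exists_wave_number)
      have cz: "(cmod c)\<^sup>2 \<ge> cmod z - V"
        unfolding c(3) V_def using norm_triangle_ineq2[of z v0] by (simp add: norm_minus_commute)
      have "R\<^sup>2 \<le> (cmod c)\<^sup>2" using cz outer_region_norm[OF z] NX(2) by linarith
      then have "\<bar>R\<bar> \<le> \<bar>cmod c\<bar>" using abs_le_square_iff by blast
      then have Rc: "R \<le> cmod c" by simp
      have "k\<^sup>2 \<le> (cmod c)\<^sup>2" using cz k by linarith
      then have kc: "k \<le> cmod c" by (rule power2_le_imp_le) simp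
      have am: "amp c \<le> 5" "exp (2 * of_real pi * c) \<noteq> 1"
        using outer_region_amp[OF z c(1,2)] NX(1) by (simp_all add: V_def)
      have "amp c * (1 + 1) / cmod c \<le> 10 / k"
        using am(1) kc k(2) amp_ge_1[of c] by (intro frac_le) auto
      then show ?thesis using regular_mono[OF R[OF c(1,2) Rc am(2,1)]] by blast
    qed
    interpret regular_region Q v0 b 10 "outer_region N"
    proof
      fix z assume z: "z \<in> outer_region N"
      then show "regular v0 b 10 z" using out_reg[OF z, of 1] outer_region_norm[OF z] NX(2) zero_le_power2[of R] by simp
    qed simp
    have P0: "?P > 0" by (simp add: add_nonneg_pos)
    obtain g where g: "L2_on g" "f = riesz_proj v0 Q b (rect_boundary N) g"
      using f by (auto simp: E_big_def proj_range_def)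
    have seg: "reproducing 0 ?P g (linepath (Complex s t) (Complex s' t'))"
      if "\<bar>s\<bar> \<le> (real N)\<^sup>2 + N" "\<bar>t\<bar> \<le> real N" "\<bar>s'\<bar> \<le> (real N)\<^sup>2 + N" "\<bar>t'\<bar> \<le> real N"
        "(s = s' \<and> (s = - real N \<or> s = (real N)\<^sup>2 + N)) \<or> (t = t' \<and> \<bar>t\<bar> = real N)" for s t s' t'
      using segment_subset_outer_region[OF that]
      by (intro reproducing_C1_path C1_path_linepath P0 sphere_subset_outer_region g) simp
    have rep: "reproducing 0 ?P g (rect_boundary N)"
      unfolding rect_boundary_def Let_def
      by (intro reproducing_join seg P0 sphere_subset_outer_region g) auto
    have closed: "pathfinish (rect_boundary N) = pathstart (rect_boundary N)"
      by (simp add: rect_boundary_def Let_def)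
    have B': "regular v0 b (10 / real N) z" if z: "z \<in> sphere 0 ?P" for z
    proof (rule out_reg)
      show "z \<in> outer_region N" using z sphere_subset_outer_region by blast
      show "(real N)\<^sup>2 \<le> cmod z - V" using z NX(1) V0 by simp
    qed (rule N1)
    note rb = riesz_proj_pointwise_bound[OF rep closed P0 sphere_subset_outer_region g(1) B', folded g(2)]
    have fc: "continuous_on {0..pi} f" using rb(1) by simp
    have H0: "norm1 f \<ge> 0" unfolding norm1_def
      by (intro divide_nonneg_nonneg HK_nonneg integrable_continuous_real continuous_intros fc) auto
    have "norm_inf f \<le> (?P * (10 / real N) * pi) * norm1 f"
      by (rule norm_inf_le_norm1) (use rb(2) in simp)
    also have "\<dots> \<le> (50 * real N * ln (real N)) * norm1 f"
    proof (rule mult_right_mono[OF _ H0])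
      have "1 * real N \<le> real N * real N" "1 * 1 \<le> real N * real N" using N1 by (intro mult_mono; simp)+
      then have "?P \<le> 3 * (real N * real N)" by (simp add: power2_eq_square)
      then have "?P * (10 / real N) \<le> 3 * (real N * real N) * (10 / real N)" by (intro mult_right_mono) auto
      also have "\<dots> = 30 * real N" using N1 by simp
      finally have "?P * (10 / real N) \<le> 30 * real N" .
      then have "?P * (10 / real N) * pi \<le> 30 * real N * 4" by (rule mult_mono) (use pi_less_4 in auto)
      also have "\<dots> \<le> 50 * real N * 3" by simp
      also have "3 \<le> ln (real N)" using NX(3) N1 by (metis exp_gt_zero ln_exp ln_mono less_le_trans)
      then have "50 * real N * 3 \<le> 50 * real N * ln (real N)" by (intro mult_left_mono) auto
      finally show "?P * (10 / real N) * pi \<le> 50 * real N * ln (real N)" .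
    qed
    finally show ?thesis using fc by blast
  qed
  then show ?thesis using that by blast
qed

text \<open>On a circle of radius \<open>s * n\<close> with small \<open>s\<close>,
  \<open>amp\<close> is about \<open>2 / (pi * s) + 1\<close> and \<open>cmod c\<close> about
  \<open>n\<close>, so the method gives a constant near \<open>2 + pi * s\<close>. At
  \<open>s = 1 / 32\<close> coarse numerical bounds still fit below 3.\<close>

theorem E_small_bound:
  obtains n0 where "\<And>n f. n \<ge> n0 \<Longrightarrow> f \<in> E_small v0 Q b n \<Longrightarrow> norm_inf f \<le> 3 * norm1 f"
proof -
  obtain d where d: "d > 0" "\<And>w. 2 * pi / 512 \<le> cmod w \<Longrightarrow> cmod w \<le> 2 * pi * (3 / 4) \<Longrightarrow> cmod (1 - exp w) \<ge> d"
    by (rule exp_away_from_1) blast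
  \<comment> \<open>27 caps \<open>amp\<close> on the circle of radius \<open>n / 32\<close>, the
    other entry caps it on the whole annulus \<open>S\<close>.\<close>
  define K where "K = max 27 (2 / d + 1)"
  have K: "K \<ge> 27" "K \<ge> 2 / d + 1" by (auto simp: K_def)
  obtain R where R: "\<And>v0 z c. c\<^sup>2 = v0 - z \<Longrightarrow> Re c \<le> 0 \<Longrightarrow> cmod c \<ge> R \<Longrightarrow> exp (2 * of_real pi * c) \<noteq> 1 \<Longrightarrow>
     amp c \<le> K \<Longrightarrow> regular v0 b (amp c * (1 + 1 / 20) / cmod c) z"
    by (rule eventually_regular[of K "1 / 20"]) (use K(1) in auto)
  define V where "V = cmod v0"
  have V0: "V \<ge> 0" by (simp add: V_def)
  define X where "X = max (1000 * V + 1000) (R + 1)"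
  define n0 where "n0 = nat \<lceil>X\<rceil>"
  have "norm_inf f \<le> 3 * norm1 f" if n: "n \<ge> n0" and f: "f \<in> E_small v0 Q b n" for n f
  proof -
    have "X \<le> real n" using n unfolding n0_def by linarith
    then have nX: "real n \<ge> 1000 * V + 1000" "real n \<ge> R + 1" by (auto simp: X_def)
    have n1: "real n \<ge> 1000" using nX(1) V0 by linarith
    let ?z0 = "of_nat (n\<^sup>2) :: complex"
    \<comment> \<open>The annulus contains the given contour of radius \<open>n\<close>, its
      replacement of radius \<open>n / 64\<close>, and the circle of radius \<open>n / 32\<close>
      around the latter.\<close>
    define S where "S = {z. real n / 128 < cmod (z - ?z0) \<and> cmod (z - ?z0) < real n + 1}"
    have Sreg: "regular v0 b K z" if z: "z \<in> S" for z
    proof -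
      obtain c where c: "c\<^sup>2 = v0 - z" "Re c \<le> 0" by (rule exists_wave_number)
      obtain \<rho> where \<rho>: "exp (2 * of_real pi * c) = exp (2 * of_real pi * \<rho>)" "cmod c \<ge> real n - 1"
        "(cmod (z - ?z0) - V) / (2 * real n + 2) \<le> cmod \<rho>" "cmod \<rho> \<le> (cmod (z - ?z0) + V) / (2 * real n - 2)"
        using near_square[OF c(1), of n] z nX(1) V0 unfolding S_def V_def by auto
      \<comment> \<open>For large \<open>n\<close>, \<open>\<rho>\<close> ranges about between 1/256
        and 1/2 on \<open>S\<close>; the bounds 1/512 and 3/4 absorb \<open>v0\<close> and the lower
        order terms.\<close>
      have "1 / 512 \<le> (cmod (z - ?z0) - V) / (2 * real n + 2)"
        using z nX(1) V0 by (simp add: S_def le_divide_eq)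
      then have l: "1 / 512 \<le> cmod \<rho>" using \<rho>(3) by linarith
      have "(cmod (z - ?z0) + V) / (2 * real n - 2) \<le> 3 / 4"
        using z nX(1) V0 by (simp add: S_def divide_le_eq)
      then have u: "cmod \<rho> \<le> 3 / 4" using \<rho>(4) by linarith
      have w: "cmod (2 * of_real pi * \<rho>) = 2 * pi * cmod \<rho>" by (simp add: norm_mult)
      have "cmod (1 - exp (2 * of_real pi * \<rho>)) \<ge> d"
      proof (rule d(2); unfold w)
        have "2 * pi * (1 / 512) \<le> 2 * pi * cmod \<rho>" by (intro mult_left_mono l) auto
        then show "2 * pi / 512 \<le> 2 * pi * cmod \<rho>" by simp
        show "2 * pi * cmod \<rho> \<le> 2 * pi * (3 / 4)" by (intro mult_left_mono u) auto
      qed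
      then have am: "amp c \<le> 2 / d + 1" "exp (2 * of_real pi * c) \<noteq> 1"
        using amp_le[of d c] d(1) \<rho>(1) by simp_all
      have Rc: "R \<le> cmod c" and c2: "2 \<le> cmod c" using \<rho>(2) nX n1 by linarith+
      have amK: "amp c \<le> K" using am(1) K(2) by linarith
      have "amp c * (1 + 1 / 20) / cmod c \<le> K"
      proof -
        have "amp c * (1 + 1 / 20) \<le> K * 2" using amK amp_ge_1[of c] by (intro mult_mono) auto
        also have "\<dots> \<le> K * cmod c" using c2 K(1) by (intro mult_left_mono) auto
        finally show ?thesis using c2 K(1) by (simp add: divide_le_eq)
      qed
      then show ?thesis using regular_mono[OF R[OF c(1,2) Rc am(2) amK]] by blast
    qed
    interpret regular_region Q v0 b K S
      by unfold_locales (use Sreg K(1) in auto)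
    have Sopen: "open S"
    proof -
      have "S = ball ?z0 (real n + 1) - cball ?z0 (real n / 128)"
        by (auto simp: S_def dist_norm norm_minus_commute)
      then show ?thesis by (simp add: open_Diff)
    qed
    have r0: "real n / 32 > 0" using n1 by simp
    have sph: "sphere ?z0 (real n / 32) \<subseteq> S" using n1 by (auto simp: S_def dist_norm norm_minus_commute)
    obtain g where g: "L2_on g" "f = riesz_proj v0 Q b (circlepath ?z0 (real n)) g"
      using f by (auto simp: E_small_def proj_range_def circ_contour_def)
    have f': "f = riesz_proj v0 Q b (circlepath ?z0 (real n / 64)) g"
      unfolding g(2) by (rule riesz_proj_circlepath_eq[OF Sopen _ _ _ g(1)]) (use n1 in \<open>auto simp: S_def\<close>)
    have rep: "reproducing ?z0 (real n / 32) g (circlepath ?z0 (real n / 64))"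
      using n1 by (intro reproducing_C1_path C1_path_circlepath r0 sph g)
        (auto simp: S_def dist_norm norm_minus_commute)
    \<comment> \<open>27 is \<open>2 * 13 + 1\<close>, from \<open>exp_minus_1_lower\<close>;
      \<open>1 + 1 / 20\<close> is the loss against the free resolvent, and \<open>n - 1\<close>
      bounds \<open>cmod c\<close> from below.\<close>
    define B' where "B' = 27 * (1 + 1 / 20) / (real n - 1)"
    have reg': "regular v0 b B' z" if z: "z \<in> sphere ?z0 (real n / 32)" for z
    proof -
      have tz: "cmod (z - ?z0) = real n / 32" using z by (simp add: dist_norm norm_minus_commute)
      obtain c where c: "c\<^sup>2 = v0 - z" "Re c \<le> 0" by (rule exists_wave_number)
      obtain \<rho> where \<rho>: "exp (2 * of_real pi * c) = exp (2 * of_real pi * \<rho>)" "cmod c \<ge> real n - 1"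
        "(cmod (z - ?z0) - V) / (2 * real n + 2) \<le> cmod \<rho>" "cmod \<rho> \<le> (cmod (z - ?z0) + V) / (2 * real n - 2)"
        using near_square[OF c(1), of n] tz nX(1) V0 unfolding V_def by auto
      \<comment> \<open>Here \<open>\<rho>\<close> has size about 1/64 = 0.015625.\<close>
      have "145 / 10000 \<le> (cmod (z - ?z0) - V) / (2 * real n + 2)"
        using tz nX(1) V0 by (simp add: le_divide_eq)
      then have l: "145 / 10000 \<le> cmod \<rho>" using \<rho>(3) by linarith
      have "(cmod (z - ?z0) + V) / (2 * real n - 2) \<le> 17 / 1000"
        using tz nX(1) V0 by (simp add: divide_le_eq)
      then have u: "cmod \<rho> \<le> 17 / 1000" using \<rho>(4) by linarith
      have w: "cmod (2 * of_real pi * \<rho>) = 2 * pi * cmod \<rho>" by (simp add: norm_mult)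
      have p: "3.14 \<le> pi" "pi \<le> 3.15" using pi_approx by simp_all
      have "cmod (1 - exp (2 * of_real pi * \<rho>)) \<ge> 1 / 13"
      proof (rule exp_minus_1_lower; unfold w)
        have "2 * 3.14 * (145 / 10000) \<le> 2 * pi * cmod \<rho>" using p l by (intro mult_mono) auto
        then show "9 / 100 \<le> 2 * pi * cmod \<rho>" by simp
        have "2 * pi * cmod \<rho> \<le> 2 * 3.15 * (17 / 1000)" using p u by (intro mult_mono) auto
        then show "2 * pi * cmod \<rho> \<le> 11 / 100" by simp
      qed
      then have am: "amp c \<le> 27" "exp (2 * of_real pi * c) \<noteq> 1"
        using amp_le[of "1 / 13" c] \<rho>(1) by simp_all
      have Rc: "R \<le> cmod c" using \<rho>(2) nX by linarith
      have amK: "amp c \<le> K" using am(1) K(1) by linarith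
      have "amp c * (1 + 1 / 20) / cmod c \<le> B'"
        unfolding B'_def using am(1) \<rho>(2) n1 amp_ge_1[of c] by (intro frac_le mult_mono) auto
      then show ?thesis using regular_mono[OF R[OF c(1,2) Rc am(2) amK]] by blast
    qed
    have B'0: "B' \<ge> 0" using n1 by (simp add: B'_def)
    have closed: "pathfinish (circlepath ?z0 (real n / 64)) = pathstart (circlepath ?z0 (real n / 64))" by simp
    note rb = riesz_proj_pointwise_bound[OF rep closed r0 sph g(1) reg' B'0, folded f']
    have fc: "continuous_on {0..pi} f" using rb(1) by simp
    have H0: "norm1 f \<ge> 0" unfolding norm1_def
      by (intro divide_nonneg_nonneg HK_nonneg integrable_continuous_real continuous_intros fc) auto
    have "norm_inf f \<le> (real n / 32 * B' * pi) * norm1 f"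
      by (rule norm_inf_le_norm1) (use rb(2) in simp)
    also have "\<dots> \<le> 3 * norm1 f"
    proof (rule mult_right_mono[OF _ H0])
      have "real n / 32 * B' = (27 * (21 / 20) / 32) * (real n / (real n - 1))" by (simp add: B'_def)
      also have "\<dots> \<le> (27 * (21 / 20) / 32) * (101 / 100)"
        using n1 by (intro mult_left_mono) (auto simp: divide_le_eq)
      finally have "real n / 32 * B' \<le> (27 * (21 / 20) / 32) * (101 / 100)" .
      \<comment> \<open>The product on the right is about 2.82.\<close>
      then have "real n / 32 * B' * pi \<le> (27 * (21 / 20) / 32) * (101 / 100) * 3.15"
        by (rule mult_mono) (use pi_approx in auto)
      also have "\<dots> \<le> 3" by (simp add: power2_eq_square)
      finally show "real n / 32 * B' * pi \<le> 3" .
    qed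
    finally show ?thesis .
  qed
  then show ?thesis using that by blast
qed

end

theorem theorem2:
  fixes v0 :: complex and Q :: "real \<Rightarrow> complex" and b :: bc
  assumes Q_periodic: "\<forall>x. Q (x + pi) = Q x"
    and Q_L2loc: "\<forall>a c. Q measurable_on {a..c} \<and> (\<lambda>x. (cmod (Q x))\<^sup>2) integrable_on {a..c}"
    and Q_mean: "integral {0..pi} Q = 0"
  shows "(\<exists>N0. \<forall>N\<ge>N0. \<exists>C. C \<le> 50 * real N * ln (real N) \<and>
             (\<forall>f\<in>E_big v0 Q b N. norm1 f \<le> norm_inf f \<and> norm_inf f \<le> C * norm1 f))
       \<and> (\<exists>Nstar. \<forall>n\<ge>Nstar. \<forall>f\<in>E_small v0 Q b n. norm_inf f \<le> 3 * norm1 f)"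
proof -
  interpret potential Q
    using Q_L2loc by unfold_locales (simp add: L2_on_def)
  obtain N0 where N0: "\<And>N f. N \<ge> N0 \<Longrightarrow> f \<in> E_big v0 Q b N \<Longrightarrow>
      continuous_on {0..pi} f \<and> norm_inf f \<le> 50 * real N * ln (real N) * norm1 f"
    using E_big_bound[of v0 b] by blast
  have "\<exists>C. C \<le> 50 * real N * ln (real N) \<and>
      (\<forall>f\<in>E_big v0 Q b N. norm1 f \<le> norm_inf f \<and> norm_inf f \<le> C * norm1 f)" if "N \<ge> N0" for N
    using N0[OF that] norm1_le_norm_inf by blast
  moreover obtain n0 where "\<And>n f. n \<ge> n0 \<Longrightarrow> f \<in> E_small v0 Q b n \<Longrightarrow> norm_inf f \<le> 3 * norm1 f"
    using E_small_bound[of v0 b] by blast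
  ultimately show ?thesis by blast
qed

end
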